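(* Let $T>0$, $\delta\in(0,1]$, $\rho>1$ and $q>1$ be such that $1/\rho-1/q>2/3$. Then for every $\beta\in\left(\frac13,\frac1{2\rho}-\frac1{2q}\right)$ we have $\|\boldsymbol{\omega}\|_\beta,\ \|\boldsymbol{\omega}_\delta\|_\beta\in L_{2q}$. Furthermore, there exists a positive constant $C_{q,\rho,T}$, which may depend on $T$, $q$ and $\rho$ (but not on $\delta$), such that for any $[s,t]\subset[-T,T]$ $$\big|\rho_{\beta,s,t}(\boldsymbol{\omega}_\delta,\boldsymbol{\omega})\big|_{L_{2q}}\le C_{q,\rho,T}\,\delta^{\frac12(1-1/\rho)}.$$ Therefore, $$\lim_{\delta\to0}\mathbb{E}\big(\rho_{\beta,s,t}(\boldsymbol{\omega}_\delta,\boldsymbol{\omega})\big)^{2q}=0$$ for any $[s,t]\subset[-T,T]$.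
   Context: $\omega=(\omega^1,\dots,\omega^m)$ is the canonical two-sided Brownian motion in $\mathbb{R}^m$ (independent components, $\omega(0)=0$) on $(\Omega,\mathcal{F},\mathbb{P}_{1/2})$, $\Omega\subset C_0(\mathbb{R},\mathbb{R}^m)$; $\mathbb{E}$ is the expectation, $|\cdot|_{L_p}$ the $L_p(\Omega)$-norm. For $\delta\in(0,1]$, $\omega_\delta(t)=\frac1\delta\int_0^t(\omega(\delta+r)-\omega(r))\,dr$, $t\in\mathbb{R}$, and $\boldsymbol{\omega}_\delta=(\omega_\delta,\mathbb{W}_\delta)$ with $\mathbb{W}_\delta(s,t)=\int_s^t(\omega_\delta(r)-\omega_\delta(s))\otimes\omega_\delta'(r)\,dr$, $s\le t$. $\boldsymbol{\omega}=(\omega,\mathbb{W})$ is the (geometric) Brownian rough path: for $s\le t$ and $i<j$, $\mathbb{W}^{i,j}(s,t)=\int_s^t(\omega^i(r)-\omega^i(s))\,d\omega^j(r)$ as the $L_2$-limit of Riemann sums as the mesh of partitions of $[s,t]$ tends to zero, $\mathbb{W}^{i,i}(s,t)=\frac12(\omega^i(t)-\omega^i(s))^2$, $\mathbb{W}^{j,i}(s,t)=-\mathbb{W}^{i,j}(s,t)+(\omega^i(t)-\omega^i(s))(\omega^j(t)-\omega^j(s))$; a version is taken such that for all $T>0$ and $\beta\in(1/3,1/2)$, $\omega$ is $\beta$-Hölder and $\mathbb{W}$ is $2\beta$-Hölder (in the sense that the seminorms below are finite) on $[-T,T]$ and Chen's relation $\mathbb{W}(s,t)-\mathbb{W}(s,u)-\mathbb{W}(u,t)=(\omega(u)-\omega(s))\otimes(\omega(t)-\omega(u))$,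 $s\le u\le t$, holds. For ${\bf X}=(X,\mathbb{X})$ on $[T_1,T_2]$: $\|X\|_\beta=\sup_{s<t}\frac{|X(t)-X(s)|}{(t-s)^\beta}$, $\|\mathbb{X}\|_{2\beta}=\sup_{s<t}\frac{|\mathbb{X}(s,t)|}{(t-s)^{2\beta}}$ (suprema over $T_1\le s<t\le T_2$), $\|{\bf X}\|_\beta=\|X\|_\beta+\sqrt{\|\mathbb{X}\|_{2\beta}}$; in the claim these norms are taken on $[-T,T]$. The rough path metric is $$\rho_{\beta,T_1,T_2}({\bf X},{\bf Y})=\sup_{T_1\le s<t\le T_2}\Big(\frac{|X(t)-X(s)-Y(t)+Y(s)|}{(t-s)^\beta}+\frac{|\mathbb{X}(s,t)-\mathbb{Y}(s,t)|}{(t-s)^{2\beta}}\Big).$$ (The number $\rho$ and the metric $\rho_{\beta,\cdot,\cdot}$ are unrelated.) *)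

theory Defs
  imports "HOL-Probability.Probability"
begin

section \<open>Extended-real-valued \<open>L\<^sub>p\<close>-norms\<close>

text \<open>
  All suprema below are taken in the complete lattice of extended nonnegative reals, so that an
  unbounded family gives \<open>\<infinity>\<close>, and finiteness of a norm is a genuine assertion. The library has no
  real powers on this type; only exponents \<open>p > 0\<close> are used.
\<close>

definition epowr :: "ennreal \<Rightarrow> real \<Rightarrow> ennreal"
  where "epowr x p = (if x = \<infinity> then \<infinity> else ennreal (enn2real x powr p))"

definition Lp_norm :: "'a measure \<Rightarrow> real \<Rightarrow> ('a \<Rightarrow> ennreal) \<Rightarrow> ennreal"
  where "Lp_norm M p X = epowr (\<integral>\<^sup>+ x. epowr (X x) p \<partial>M) (1 / p)"

definition in_Lp :: "'a measure \<Rightarrow> real \<Rightarrow> ('a \<Rightarrow> ennreal) \<Rightarrow> bool"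
  where "in_Lp M p X \<longleftrightarrow> X \<in> borel_measurable M \<and> Lp_norm M p X < \<infinity>"

section \<open>Rough path norms and metric\<close>

text \<open>
  A pair \<open>(X, XX)\<close> of a path and a second-level component; only the values \<open>XX s t\<close> with \<open>s \<le> t\<close>
  are relevant. The norm on \<open>real^'m^'m\<close> is the Frobenius norm.
\<close>

type_synonym 'm rough = "(real \<Rightarrow> real^'m) \<times> (real \<Rightarrow> real \<Rightarrow> real^'m^'m)"

definition tensor :: "real^'m \<Rightarrow> real^'m \<Rightarrow> real^'m^'m"
  where "tensor x y = (\<chi> i j. x $ i * y $ j)"

definition holder1 :: "real \<Rightarrow> real \<Rightarrow> real \<Rightarrow> (real \<Rightarrow> 'a::real_normed_vector) \<Rightarrow> ennreal"
  where "holder1 \<beta> T1 T2 X =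
    (SUP (s, t) \<in> {(s, t). T1 \<le> s \<and> s < t \<and> t \<le> T2}.
      ennreal (norm (X t - X s) / (t - s) powr \<beta>))"

definition holder2 :: "real \<Rightarrow> real \<Rightarrow> real \<Rightarrow> (real \<Rightarrow> real \<Rightarrow> 'a::real_normed_vector) \<Rightarrow> ennreal"
  where "holder2 \<gamma> T1 T2 XX =
    (SUP (s, t) \<in> {(s, t). T1 \<le> s \<and> s < t \<and> t \<le> T2}.
      ennreal (norm (XX s t) / (t - s) powr \<gamma>))"

definition rough_norm :: "real \<Rightarrow> real \<Rightarrow> real \<Rightarrow> 'm::finite rough \<Rightarrow> ennreal"
  where "rough_norm \<beta> T1 T2 = (\<lambda>(X, XX).
    holder1 \<beta> T1 T2 X + epowr (holder2 (2 * \<beta>) T1 T2 XX) (1 / 2))"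

definition rough_dist :: "real \<Rightarrow> real \<Rightarrow> real \<Rightarrow> 'm::finite rough \<Rightarrow> 'm rough \<Rightarrow> ennreal"
  where "rough_dist \<beta> T1 T2 = (\<lambda>(X, XX) (Y, YY).
    (SUP (s, t) \<in> {(s, t). T1 \<le> s \<and> s < t \<and> t \<le> T2}.
      ennreal (norm (X t - X s - Y t + Y s) / (t - s) powr \<beta>
             + norm (XX s t - YY s t) / (t - s) powr (2 * \<beta>))))"

section \<open>Canonical two-sided Brownian motion\<close>

text \<open>
  The sample space consists of continuous paths vanishing at \<open>0\<close> and the process is the evaluation
  process. For every increasing finite sequence of (possibly negative) times all scalar increments,
  over all time steps and all components jointly, are independent; this contains both the
  independence of increments and the independence of components.
\<close>

definition canonical_BM :: "(real \<Rightarrow> real^'m::finite) measure \<Rightarrow> bool"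
  where "canonical_BM M \<longleftrightarrow>
    prob_space M \<and>
    (\<forall>\<omega> \<in> space M. continuous_on UNIV \<omega> \<and> \<omega> 0 = 0) \<and>
    (\<forall>t. (\<lambda>\<omega>. \<omega> t) \<in> borel_measurable M) \<and>
    (\<forall>s t i. s < t \<longrightarrow>
      distributed M lborel (\<lambda>\<omega>. \<omega> t $ i - \<omega> s $ i) (normal_density 0 (sqrt (t - s)))) \<and>
    (\<forall>(\<tau> :: nat \<Rightarrow> real) n. (\<forall>k<n. \<tau> k < \<tau> (Suc k)) \<longrightarrow>
      prob_space.indep_vars M (\<lambda>_. borel)
        (\<lambda>(k, i) \<omega>. \<omega> (\<tau> (Suc k)) $ i - \<omega> (\<tau> k) $ i) ({..<n} \<times> (UNIV :: 'm set)))"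

section \<open>The Brownian rough path\<close>

text \<open>\<open>grid s t n p\<close>: \<open>s = p 0 < p 1 < \<dots> < p n = t\<close>, where \<open>n = 0\<close> only if \<open>s = t\<close>.\<close>

definition grid :: "real \<Rightarrow> real \<Rightarrow> nat \<Rightarrow> (nat \<Rightarrow> real) \<Rightarrow> bool"
  where "grid s t n p \<longleftrightarrow> p 0 = s \<and> p n = t \<and> (\<forall>k<n. p k < p (Suc k))"

definition riemann_sum ::
    "(real \<Rightarrow> real^'m) \<Rightarrow> 'm \<Rightarrow> 'm \<Rightarrow> nat \<Rightarrow> (nat \<Rightarrow> real) \<Rightarrow> real"
  where "riemann_sum \<omega> i j n p =
    (\<Sum>k<n. (\<omega> (p k) $ i - \<omega> (p 0) $ i) * (\<omega> (p (Suc k)) $ j - \<omega> (p k) $ j))"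

definition L2_mesh_limit ::
    "(real \<Rightarrow> real^'m::finite) measure \<Rightarrow> 'm \<Rightarrow> 'm \<Rightarrow> real \<Rightarrow> real \<Rightarrow>
      ((real \<Rightarrow> real^'m) \<Rightarrow> real) \<Rightarrow> bool"
  where "L2_mesh_limit M i j s t I \<longleftrightarrow>
    I \<in> borel_measurable M \<and>
    (\<forall>\<epsilon>>0. \<exists>\<eta>>0. \<forall>n p. grid s t n p \<and> (\<forall>k<n. p (Suc k) - p k < \<eta>) \<longrightarrow>
      Lp_norm M 2 (\<lambda>\<omega>. ennreal \<bar>I \<omega> - riemann_sum \<omega> i j n p\<bar>) < ennreal \<epsilon>)"

text \<open>
  \<open>WW\<close> is a version of the second-level process for which the pathwise properties hold on all of
  the sample space, the latter having been reduced to a set of full measure if necessary.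
\<close>

definition brownian_area ::
    "(real \<Rightarrow> real^'m::{finite,linorder}) measure \<Rightarrow>
      ((real \<Rightarrow> real^'m::{finite,linorder}) \<Rightarrow> real \<Rightarrow> real \<Rightarrow>
        real^'m::{finite,linorder}^'m::{finite,linorder}) \<Rightarrow> bool"
  where "brownian_area M WW \<longleftrightarrow>
    (\<forall>s t i j. s \<le> t \<and> i < j \<longrightarrow> L2_mesh_limit M i j s t (\<lambda>\<omega>. WW \<omega> s t $ i $ j)) \<and>
    (\<forall>\<omega> \<in> space M.
      (\<forall>s t i. s \<le> t \<longrightarrow> WW \<omega> s t $ i $ i = (\<omega> t $ i - \<omega> s $ i)\<^sup>2 / 2) \<and>
      (\<forall>s t i j. s \<le> t \<and> i < j \<longrightarrow>
        WW \<omega> s t $ j $ i = - (WW \<omega> s t $ i $ j) + (\<omega> t $ i - \<omega> s $ i) * (\<omega> t $ j - \<omega> s $ j)) \<and>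
      (\<forall>T>0. \<forall>\<beta>\<in>{1/3<..<1/2}.
        holder1 \<beta> (-T) T \<omega> < \<infinity> \<and> holder2 (2 * \<beta>) (-T) T (WW \<omega>) < \<infinity>) \<and>
      (\<forall>s u t. s \<le> u \<and> u \<le> t \<longrightarrow>
        WW \<omega> s t - WW \<omega> s u - WW \<omega> u t = tensor (\<omega> u - \<omega> s) (\<omega> t - \<omega> u)))"

section \<open>The smooth approximation\<close>

text \<open>\<open>LBINT\<close> is the oriented integral, as needed for \<open>t < 0\<close>.\<close>

definition approx_path :: "real \<Rightarrow> (real \<Rightarrow> real^'m::finite) \<Rightarrow> real \<Rightarrow> real^'m"
  where "approx_path \<delta> \<omega> t = (1 / \<delta>) *\<^sub>R (LBINT r=ereal 0..ereal t. \<omega> (\<delta> + r) - \<omega> r)"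

definition approx_area :: "real \<Rightarrow> (real \<Rightarrow> real^'m::finite) \<Rightarrow> real \<Rightarrow> real \<Rightarrow> real^'m^'m"
  where "approx_area \<delta> \<omega> s t =
    (LBINT r=ereal s..ereal t.
      tensor (approx_path \<delta> \<omega> r - approx_path \<delta> \<omega> s)
             (vector_derivative (approx_path \<delta> \<omega>) (at r)))"

definition approx_rough :: "real \<Rightarrow> (real \<Rightarrow> real^'m::finite) \<Rightarrow> 'm rough"
  where "approx_rough \<delta> \<omega> = (approx_path \<delta> \<omega>, approx_area \<delta> \<omega>)"

end

theory Submission
  imports Defs
begin

text \<open>
  Write \<open>X\<^sub>\<delta>\<close>, \<open>A\<^sub>\<delta>\<close> for the two levels of the approximation, \<open>X\<close>, \<open>A\<close> for those of the Brownian rough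
  path, and let \<open>h = t - s\<close>. A Kolmogorov argument for rough paths (dyadic chaining, with
  Chen's relation controlling the second level) reduces the theorem to the moment bounds
  \<open>E |X\<^sub>\<delta> - X|^(2n) \<le> C min(\<delta>, h)^n\<close> and \<open>E |A\<^sub>\<delta> - A|^(2n) \<le> C (h min(\<delta>, h))^n\<close> for all increments, since
  \<open>min(\<delta>, h) \<le> \<delta>^(1 - 1/\<rho>) h^(1/\<rho>)\<close>.

  The first bound holds because \<open>X\<^sub>\<delta>\<close> is an average of time-shifted copies of \<open>X\<close>. For the second, take
  components \<open>i < j\<close> and \<open>h/\<delta>\<close> rational, and discretize \<open>A\<^sub>\<delta>\<close> and \<open>A\<close> on a common uniform grid: \<open>A\<^sub>\<delta>\<close> becomes
  an average over pairs of shifts \<open>l, l'\<close> of Riemann sums of \<open>X\<^sup>i\<close> shifted by \<open>l\<close> against \<open>X\<^sup>j\<close> shifted by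
  \<open>l'\<close>, so the difference is an average of bilinear forms in two independent Gaussian vectors. Conditioning
  on one vector bounds the \<open>2n\<close>-th moment of such a form by the \<open>n\<close>-th power of the squared Frobenius norm
  of its matrix scaled by the grid step, which here is at most \<open>4 h min(\<delta>, h)\<close>. Fatou's lemma passes to the limit and, by continuity,
  to all \<open>h\<close>. The remaining components follow by integration by parts.
\<close>

text \<open>The obstacle is the second level. The difference of two areas satisfies Chen's relation
  only up to products of an increment of the difference path \<open>Z\<close> with one of
  \<open>Y\<close> or \<open>Z\<close>, so the chaining has to tolerate a cross term, and a product
  of a small and an order-one supremum must be shown to have the small order. Young's inequality
  with weight \<kappa> = \<delta>^((1 - 1/\<rho>)/2), the size of \<open>Z\<close>, splits it into
  two terms of size \<kappa>; hence moments of two orders are tracked.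

  Moments are taken at even integer orders, where they are explicit for Gaussian variables, and
  interpolation leads back to the exponent 2q. An order strictly above 2q allows chaining at the
  endpoint 1/(2\<rho>) - 1/(2q) itself, so that one constant serves all \<beta> below it.

  The grid step has to divide both h and \<delta>: then shifts map nodes to nodes, and every
  variable is a combination of increments over the same disjoint cells. The matrix of the difference
  is a difference of indicators of two triangles, one of them displaced by the shifts, and its
  squared Frobenius norm counts the cells where they disagree.\<close>

section \<open>Dyadic chaining\<close>

text \<open>The combinatorial core, on integers so that dyadic blocks are exact. The cross term has
  the same homogeneity \<open>2 * a\<close> as the target, so on a block of length
  \<open>2 ^ g\<close> it costs only \<open>c * \<theta> ^ g\<close>; a segment touching an end of a
  block is halved repeatedly, and the levels sum geometrically since \<theta> > 1. Any interval
  splits at one or two block boundaries into such segments.\<close>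

lemma chain_nat:
  fixes F :: "nat \<Rightarrow> nat \<Rightarrow> real" and a M c \<theta> :: real
  assumes a: "a > 0" and M: "M \<ge> 0" and c: "c \<ge> 0"
    and zero: "\<And>i. F i i = 0"
    and tri: "\<And>i j k. i \<le> j \<Longrightarrow> j \<le> k \<Longrightarrow> k \<le> 2 ^ N \<Longrightarrow>
      F i k \<le> F i j + F j k + c * (real (j - i) powr a * real (k - j) powr a)"
    and blk: "\<And>g k. (k + 1) * 2 ^ g \<le> (2::nat) ^ N \<Longrightarrow>
      F (k * 2 ^ g) ((k + 1) * 2 ^ g) \<le> M * (2 ^ g) powr (2 * a)"
    and ij: "i \<le> j" "j \<le> 2 ^ N"
    and \<theta>: "\<theta> = 2 powr (2 * a)"
  shows "F i j \<le> 4 * \<theta> / (\<theta> - 1) * (M + c) * real (j - i) powr (2 * a)"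
proof -
  have \<theta>1: "\<theta> > 1" using a \<theta> by simp
  \<comment> \<open>\<open>B\<close> satisfies the recursion of the halving step,
    \<open>B + (M + c) \<le> B * \<theta>\<close>. The numerator \<theta>, instead of 1, also gives
    \<open>M + c \<le> B\<close>, which the base case and the final count need.\<close>
  define B where "B = \<theta> / (\<theta> - 1) * (M + c)"
  have frac: "\<theta> / (\<theta> - 1) \<ge> 1" using \<theta>1 by (simp add: field_simps)
  have BM: "M + c \<le> B"
    using mult_right_mono[OF frac, of "M + c"] M c by (simp add: B_def)
  have Brec: "B + (M + c) = B * \<theta> - (M + c) * (\<theta> - 1)"
    using \<theta>1 unfolding B_def by (simp add: field_simps)
  have Bstep: "B + (M + c) \<le> B * \<theta>"
    using Brec M c \<theta>1 mult_nonneg_nonneg[of "M + c" "\<theta> - 1"] by linarith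
  have pw: "(2 ^ g) powr (2 * a) = \<theta> ^ g" "((2::real) ^ g) powr a * (2 ^ g) powr a = \<theta> ^ g" for g :: nat
  proof -
    show 1: "(2 ^ g) powr (2 * a) = \<theta> ^ g"
      by (simp add: \<theta> powr_powr powr_realpow[symmetric] mult.commute)
    show "((2::real) ^ g) powr a * (2 ^ g) powr a = \<theta> ^ g"
      unfolding 1[symmetric] by (simp add: powr_add[symmetric])
  qed
  have \<theta>g: "\<theta> ^ g > 0" for g using \<theta>1 by simp
  have cross: "c * (real x powr a * real y powr a) \<le> c * \<theta> ^ g"
    if "x \<le> 2 ^ g" "y \<le> 2 ^ g" for x y g
  proof -
    have "real x \<le> 2 ^ g" "real y \<le> 2 ^ g"
      using that by (metis of_nat_le_iff of_nat_numeral of_nat_power)+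
    then have "real x powr a * real y powr a \<le> (2 ^ g) powr a * (2 ^ g) powr a"
      using a by (intro mult_mono powr_mono2) auto
    then show ?thesis using c by (simp add: pw mult_left_mono)
  qed
  have step: "B * \<theta> ^ g + (M + c) * \<theta> ^ g \<le> B * \<theta> ^ Suc g" for g
    using mult_right_mono[OF Bstep, of "\<theta> ^ g"] \<theta>g[of g] by (simp add: algebra_simps)
  have mono: "B * \<theta> ^ g \<le> B * \<theta> ^ Suc g" for g
    using step[of g] mult_nonneg_nonneg[of "M + c" "\<theta> ^ g"] M c \<theta>g[of g] by linarith
  \<comment> \<open>Initial segments of a level-\<open>g\<close> block: such a segment lies in the
    left half, or consists of the left half and an initial segment of the right half.\<close>
  have right: "F (k * 2 ^ g) (k * 2 ^ g + r) \<le> B * \<theta> ^ g"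
    if "r \<le> 2 ^ g" "k * 2 ^ g + r \<le> 2 ^ N" for g k r
    using that
  proof (induction g arbitrary: k r)
    case 0
    then have "r = 0 \<or> r = 1" by auto
    then show ?case using 0 zero[of k] blk[of k 0] BM M c by auto
  next
    case (Suc g)
    have eq: "k * 2 ^ Suc g = (2 * k) * 2 ^ g" by simp
    show ?case
    proof (cases "r \<le> 2 ^ g")
      case True
      have "F (k * 2 ^ Suc g) (k * 2 ^ Suc g + r) \<le> B * \<theta> ^ g"
        unfolding eq using Suc.IH[of r "2 * k"] True Suc.prems by (simp add: mult_ac)
      also have "\<dots> \<le> B * \<theta> ^ Suc g"
        by (rule mono)
      finally show ?thesis .
    next
      case False
      then obtain r' where r': "r = 2 ^ g + r'" "r' \<le> 2 ^ g"
        using Suc.prems(1) by (metis add_le_cancel_left le_Suc_ex mult_2 nat_le_linear power_Suc)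
      have e2: "(2 * k) * 2 ^ g + 2 ^ g = (2 * k + 1) * 2 ^ g" by simp
      have le: "(2 * k + 1) * 2 ^ g + r' \<le> 2 ^ N" using Suc.prems(2) r' by simp
      have "F (2 * k * 2 ^ g) ((2 * k + 1) * 2 ^ g + r') \<le>
          F (2 * k * 2 ^ g) ((2 * k + 1) * 2 ^ g) + F ((2 * k + 1) * 2 ^ g) ((2 * k + 1) * 2 ^ g + r')
          + c * (real (2 ^ g) powr a * real r' powr a)"
        using tri[of "2 * k * 2 ^ g" "(2 * k + 1) * 2 ^ g" "(2 * k + 1) * 2 ^ g + r'"] le by simp
      also have "\<dots> \<le> M * \<theta> ^ g + B * \<theta> ^ g + c * \<theta> ^ g"
        using blk[of "2 * k" g] le Suc.IH[of r' "2 * k + 1"] r' cross[of "2 ^ g" g r'] pw(1)[of g]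
        by (intro add_mono) auto
      also have "\<dots> \<le> B * \<theta> ^ Suc g" using step[of g] by (simp add: algebra_simps)
      finally show ?thesis unfolding eq r' by (simp add: algebra_simps)
    qed
  qed
  \<comment> \<open>Mirror image for final segments; the subtraction does not truncate, because
    \<open>r\<close> never exceeds the block length.\<close>
  have left: "F ((k + 1) * 2 ^ g - r) ((k + 1) * 2 ^ g) \<le> B * \<theta> ^ g"
    if "r \<le> 2 ^ g" "(k + 1) * 2 ^ g \<le> 2 ^ N" for g k r
    using that
  proof (induction g arbitrary: k r)
    case 0
    then have "r = 0 \<or> r = 1" by auto
    then show ?case using 0 zero[of "Suc k"] blk[of k 0] BM M c by auto
  next
    case (Suc g)
    have eq: "(k + 1) * 2 ^ Suc g = ((2 * k + 1) + 1) * 2 ^ g" by simp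
    show ?case
    proof (cases "r \<le> 2 ^ g")
      case True
      have "F ((k + 1) * 2 ^ Suc g - r) ((k + 1) * 2 ^ Suc g) \<le> B * \<theta> ^ g"
        unfolding eq by (rule Suc.IH) (use True Suc.prems in simp_all)
      also have "\<dots> \<le> B * \<theta> ^ Suc g"
        by (rule mono)
      finally show ?thesis .
    next
      case False
      then obtain r' where r': "r = 2 ^ g + r'" "r' \<le> 2 ^ g"
        using Suc.prems(1) by (metis add_le_cancel_left le_Suc_ex mult_2 nat_le_linear power_Suc)
      let ?m = "(2 * k + 1) * 2 ^ g :: nat" and ?e = "(2 * k + 1 + 1) * 2 ^ g :: nat"
      have me: "?e - ?m = 2 ^ g" "?m \<le> ?e" by (auto simp: algebra_simps)
      have r'm: "r' \<le> ?m" using r' by (simp add: trans_le_add2)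
      have le: "?e \<le> 2 ^ N" using Suc.prems(2) by simp
      have "F (?m - r') ?e \<le> F (?m - r') ?m + F ?m ?e
          + c * (real r' powr a * real (2 ^ g) powr a)"
        using tri[of "?m - r'" ?m ?e] le me r'm by simp
      also have "\<dots> \<le> B * \<theta> ^ g + M * \<theta> ^ g + c * \<theta> ^ g"
        using blk[of "2 * k + 1" g] le me Suc.IH[of r' "2 * k"] r' cross[of r' g "2 ^ g"] pw(1)[of g]
        by (intro add_mono) auto
      also have "\<dots> \<le> B * \<theta> ^ Suc g" using step[of g] by (simp add: algebra_simps)
      finally have "F (?m - r') ?e \<le> B * \<theta> ^ Suc g" .
      moreover have "(k + 1) * 2 ^ Suc g - r = ?m - r'" using r' by (simp add: algebra_simps)
      ultimately show ?thesis unfolding eq by simp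
    qed
  qed
  show ?thesis
  proof (cases "i = j")
    case True
    then show ?thesis using zero by simp
  next
    case False
    define d where "d = j - i"
    have d: "d \<ge> 1" using False ij d_def by simp
    \<comment> \<open>\<open>2 ^ g\<close> is the block size comparable to the length, and
      \<open>u\<close> is the first multiple of it at or after \<open>i\<close>. Then
      \<open>u - i < 2 ^ g \<le> d\<close> places \<open>u\<close> inside the interval.\<close>
    obtain g where g: "2 ^ g \<le> d" "d < 2 ^ (g + 1)" using ex_power_ivl1[of 2 d] d by auto
    define u where "u = ((i + 2 ^ g - 1) div 2 ^ g) * 2 ^ g"
    define k where "k = (i + 2 ^ g - 1) div 2 ^ g"
    have p: "(2::nat) ^ g > 0" by simp
    have u: "u = k * 2 ^ g" by (simp add: u_def k_def)
    have mod: "u + (i + 2 ^ g - 1) mod 2 ^ g = i + 2 ^ g - 1"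
      unfolding u_def by (rule div_mult_mod_eq)
    have ml: "(i + 2 ^ g - 1) mod 2 ^ g < 2 ^ g" by (rule mod_less_divisor[OF p])
    have iu: "i \<le> u" "u - i < 2 ^ g" using mod ml p by linarith+
    have uj: "u \<le> j" using iu g d_def ij by linarith
    have dg: "\<theta> ^ g \<le> real d powr (2 * a)"
    proof -
      have "(2::real) ^ g \<le> real d" using g(1) by (metis of_nat_le_iff of_nat_numeral of_nat_power)
      then show ?thesis unfolding pw(1)[symmetric] using a by (intro powr_mono2) auto
    qed
    define R where "R = real d powr (2 * a)"
    have R: "R > 0" using d by (simp add: R_def)
    have crossd: "c * (real x powr a * real y powr a) \<le> c * R" if "x \<le> d" "y \<le> d" for x y
    proof -
      have "real x powr a * real y powr a \<le> real d powr a * real d powr a"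
        using a that by (intro mult_mono powr_mono2) auto
      also have "\<dots> = R" by (simp add: R_def powr_add[symmetric])
      finally show ?thesis using c by (simp add: mult_left_mono)
    qed
    have BR: "B * \<theta> ^ g \<le> B * R" "M * \<theta> ^ g \<le> M * R"
      using dg M c BM by (auto simp: R_def mult_left_mono)
    have 1: "F i u \<le> B * R"
    proof (cases "k = 0")
      case True
      then have "i = u" using u iu by simp
      then show ?thesis using zero[of i] BM M c R by simp
    next
      case False
      then obtain k' where k': "k = k' + 1" by (metis Suc_eq_plus1 not0_implies_Suc)
      have "F u' u \<le> B * \<theta> ^ g" if "u' = u - (u - i)" for u'
        unfolding that unfolding u k' by (rule left) (use iu uj ij u k' in auto)
      from this[of i] show ?thesis using BR iu by simp
    qed
    \<comment> \<open>Less than two block lengths remain after \<open>u\<close>: an initial segment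
      of one block, or one full block and an initial segment of the next.\<close>
    have 2: "F u j \<le> (B + (M + c)) * R"
    proof (cases "j - u \<le> 2 ^ g")
      case True
      have "F u j \<le> B * \<theta> ^ g" using right[of "j - u" g k] True uj ij u by simp
      then show ?thesis
        using BR mult_nonneg_nonneg[of "M + c" R] M c R unfolding distrib_right[of B] by linarith
    next
      case False
      let ?v = "(k + 1) * 2 ^ g"
      have v: "?v = u + 2 ^ g" using u by simp
      have vj: "u \<le> ?v" "?v \<le> j" using False uj v by linarith+
      have jv: "j - ?v \<le> 2 ^ g" using v iu d_def g ij by simp
      have "F u j \<le> F u ?v + F ?v j + c * (real (?v - u) powr a * real (j - ?v) powr a)"
        using tri[OF vj] ij by simp
      also have "\<dots> \<le> M * R + B * R + c * R"
      proof (intro add_mono)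
        show "F u ?v \<le> M * R" using blk[of k g] vj ij u BR pw(1)[of g] by simp
        show "F ?v j \<le> B * R" using right[of "j - ?v" g "k + 1"] vj ij BR jv by simp
        show "c * (real (?v - u) powr a * real (j - ?v) powr a) \<le> c * R"
          by (rule crossd) (use v jv g in simp_all)
      qed
      finally show ?thesis by (simp add: algebra_simps)
    qed
    have "F i j \<le> F i u + F u j + c * (real (u - i) powr a * real (j - u) powr a)"
      using tri[OF iu(1) uj] ij by simp
    also have "\<dots> \<le> B * R + (B + (M + c)) * R + c * R"
      using 1 2 by (intro add_mono crossd) (use iu uj d_def in auto)
    \<comment> \<open>\<open>4 * B\<close> absorbs the bracket, as both \<open>M + c\<close> and
      \<open>c\<close> are at most \<open>B\<close>.\<close>
    also have "\<dots> = (2 * B + (M + c) + c) * R" by (simp add: algebra_simps)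
    also have "\<dots> \<le> (4 * B) * R"
      using BM M c R by (intro mult_right_mono) auto
    finally show ?thesis by (simp add: R_def d_def B_def)
  qed
qed

definition dyadic :: "real \<Rightarrow> real \<Rightarrow> nat \<Rightarrow> nat \<Rightarrow> real"
  where "dyadic a b n k = a + (b - a) * real k / 2 ^ n"

text \<open>The constant of \<open>chain_nat\<close> with
  \<open>\<theta> = 2 powr e\<close>.\<close>

definition chain_const :: "real \<Rightarrow> real"
  where "chain_const e = 4 * 2 powr e / (2 powr e - 1)"

lemma chain_const_pos: "e > 0 \<Longrightarrow> chain_const e > 0"
  by (simp add: chain_const_def)

text \<open>\<open>G\<close> has two arguments so that path increments (with \<open>c = 0\<close>)
  and areas are covered at once. Rescaling carries \<open>chain_nat\<close> to every dyadic level
  with a constant independent of the level, and continuity along ordered approximations extends the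
  bound to real end points.\<close>

lemma dyadic_holder:
  fixes G :: "real \<Rightarrow> real \<Rightarrow> 'v::real_normed_vector"
  assumes ab: "a < b" and e: "e > 0" and M: "M \<ge> 0" and c: "c \<ge> 0"
    and zero: "\<And>s. G s s = 0"
    and tri: "\<And>s u t. a \<le> s \<Longrightarrow> s \<le> u \<Longrightarrow> u \<le> t \<Longrightarrow> t \<le> b \<Longrightarrow>
      norm (G s t) \<le> norm (G s u) + norm (G u t) + c * ((u - s) powr (e / 2) * (t - u) powr (e / 2))"
    and blk: "\<And>n k. k < 2 ^ n \<Longrightarrow>
      norm (G (dyadic a b n k) (dyadic a b n (Suc k))) \<le> M * ((b - a) / 2 ^ n) powr e"
    and cont: "\<And>x y. (\<And>n. a \<le> x n \<and> x n \<le> y n \<and> y n \<le> b) \<Longrightarrow> x \<longlonglongrightarrow> s \<Longrightarrow> y \<longlonglongrightarrow> t \<Longrightarrow>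
      (\<lambda>n. G (x n) (y n)) \<longlonglongrightarrow> G s t"
    and st: "a \<le> s" "s \<le> t" "t \<le> b"
  shows "norm (G s t) \<le> chain_const e * (M + c) * (t - s) powr e"
proof -
  have mono: "dyadic a b N i \<le> dyadic a b N j" if "i \<le> j" for N i j
    using that ab unfolding dyadic_def
    by (intro add_left_mono divide_right_mono mult_left_mono) auto
  have range: "a \<le> dyadic a b N i" "i \<le> 2 ^ N \<Longrightarrow> dyadic a b N i \<le> b" for N i
    using mono[of 0 i N] mono[of i "2 ^ N" N] by (auto simp: dyadic_def)
  have diff: "dyadic a b N j - dyadic a b N i = (b - a) / 2 ^ N * real (j - i)" if "i \<le> j" for i j N
    using that by (simp add: dyadic_def of_nat_diff field_simps)
  have pts: "norm (G (dyadic a b N i) (dyadic a b N j)) \<le>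
      chain_const e * (M + c) * (dyadic a b N j - dyadic a b N i) powr e"
    if ij: "i \<le> j" "j \<le> 2 ^ N" for N i j
  proof -
    let ?p = "dyadic a b N" and ?L = "((b - a) / 2 ^ N) powr e"
    have L: "?L = ((b - a) / 2 ^ N) powr (e / 2) * ((b - a) / 2 ^ N) powr (e / 2)"
      by (simp add: powr_add[symmetric])
    have diffp: "(?p j - ?p i) powr x = ((b - a) / 2 ^ N) powr x * real (j - i) powr x"
      if "i \<le> j" for i j x
      unfolding diff[OF that] by (subst powr_mult) (use ab in auto)
    have "norm (G (?p i) (?p j)) \<le>
      4 * (2 powr (2 * (e / 2))) / (2 powr (2 * (e / 2)) - 1) * (M * ?L + c * ?L) * real (j - i) powr (2 * (e / 2))"
    proof (rule chain_nat[where N = N and F = "\<lambda>i j. norm (G (?p i) (?p j))"])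
      show "norm (G (?p i) (?p i)) = 0" for i
        by (simp add: zero)
      show "norm (G (?p i) (?p k)) \<le> norm (G (?p i) (?p j)) + norm (G (?p j) (?p k))
          + c * ?L * (real (j - i) powr (e / 2) * real (k - j) powr (e / 2))"
        if "i \<le> j" "j \<le> k" "k \<le> 2 ^ N" for i j k
        using tri[of "?p i" "?p j" "?p k"] that range(1)[of N i] range(2)[of k N] mono[of i j N] mono[of j k N]
        by (simp add: diffp L mult_ac)
      show "norm (G (?p (k * 2 ^ g)) (?p ((k + 1) * 2 ^ g))) \<le> M * ?L * (2 ^ g) powr (2 * (e / 2))"
        if "(k + 1) * 2 ^ g \<le> (2::nat) ^ N" for g k
      proof -
        have "2 ^ g \<le> (2::nat) ^ N" using that by (simp add: order_trans[OF le_add1])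
        then have gN: "g \<le> N" by (meson one_less_numeral_iff power_le_imp_le_exp semiring_norm(76))
        \<comment> \<open>An aligned block of \<open>2 ^ g\<close> cells at level \<open>N\<close>
          is one cell at level \<open>n = N - g\<close>, where the block hypothesis applies.\<close>
        then obtain n where n: "N = n + g" by (metis add.commute le_Suc_ex)
        then have "(k + 1) * 2 ^ g \<le> (2::nat) ^ n * 2 ^ g" using that by (simp add: power_add)
        then have k: "k < 2 ^ n" by (subst (asm) mult_le_cancel2) simp
        have p: "?p (j * 2 ^ g) = dyadic a b n j" for j by (simp add: dyadic_def n power_add)
        have "(b - a) / 2 ^ n = (b - a) / 2 ^ N * 2 ^ g" by (simp add: n power_add)
        then have "((b - a) / 2 ^ n) powr e = ?L * (2 ^ g) powr e"
          using ab by (simp only: powr_mult)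
        then show ?thesis using blk[OF k] unfolding p by (simp add: mult_ac)
      qed
    qed (use e M c ij in auto)
    also have "\<dots> = chain_const e * (M + c) * (?L * real (j - i) powr e)"
      by (simp add: chain_const_def algebra_simps add_divide_distrib)
    also have "?L * real (j - i) powr e = (?p j - ?p i) powr e"
      using diffp[OF ij(1), of e] by simp
    finally show ?thesis .
  qed
  \<comment> \<open>Index of the largest level-\<open>N\<close> dyadic point not exceeding
    \<open>x\<close>. Rounding both points down keeps their order, as \<open>cont\<close>
    demands.\<close>
  define fl where "fl x N = nat \<lfloor>(x - a) * 2 ^ N / (b - a)\<rfloor>" for x N
  have fl: "dyadic a b N (fl x N) \<le> x" "x - (b - a) / 2 ^ N \<le> dyadic a b N (fl x N)"
    if "a \<le> x" for x N
  proof -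
    define z where "z = (x - a) * 2 ^ N / (b - a)"
    have z: "z \<ge> 0" using that ab by (simp add: z_def)
    have 1: "real (fl x N) \<le> z" "z \<le> real (fl x N) + 1"
      using z by (auto simp: fl_def z_def[symmetric])
    have x: "x = a + (b - a) * z / 2 ^ N" using ab by (simp add: z_def)
    show "dyadic a b N (fl x N) \<le> x"
      using 1(1) ab unfolding dyadic_def by (subst (2) x) (intro add_left_mono divide_right_mono mult_left_mono; simp)
    have "(b - a) * z / 2 ^ N \<le> (b - a) * (real (fl x N) + 1) / 2 ^ N"
      using 1(2) ab by (intro divide_right_mono mult_left_mono) auto
    then show "x - (b - a) / 2 ^ N \<le> dyadic a b N (fl x N)"
      unfolding dyadic_def by (subst x) (simp add: distrib_left add_divide_distrib)
  qed
  have conv: "(\<lambda>N. dyadic a b N (fl x N)) \<longlonglongrightarrow> x" if "a \<le> x" for x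
  proof (rule tendsto_sandwich)
    show "\<forall>\<^sub>F N in sequentially. x - (b - a) / 2 ^ N \<le> dyadic a b N (fl x N)"
      "\<forall>\<^sub>F N in sequentially. dyadic a b N (fl x N) \<le> x"
      using fl that by auto
    have "(\<lambda>N. x - (b - a) * (1 / 2) ^ N) \<longlonglongrightarrow> x - (b - a) * 0"
      by (intro tendsto_intros LIMSEQ_power_zero) auto
    then show "(\<lambda>N. x - (b - a) / 2 ^ N) \<longlonglongrightarrow> x" by (simp add: power_divide)
  qed auto
  have flm: "fl s N \<le> fl t N" for N
    unfolding fl_def using st ab by (intro nat_mono floor_mono divide_right_mono mult_right_mono) auto
  have flt: "fl t N \<le> 2 ^ N" for N
  proof -
    have "(t - a) * 2 ^ N / (b - a) \<le> (b - a) * 2 ^ N / (b - a)"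
      using st ab by (intro divide_right_mono mult_right_mono) auto
    then have "(t - a) * 2 ^ N / (b - a) \<le> 2 ^ N" using ab by simp
    then have "\<lfloor>(t - a) * 2 ^ N / (b - a)\<rfloor> \<le> 2 ^ N"
      by (metis floor_mono floor_of_int of_int_numeral of_int_power)
    then show ?thesis by (simp add: fl_def nat_le_iff)
  qed
  let ?x = "\<lambda>N. dyadic a b N (fl s N)" and ?y = "\<lambda>N. dyadic a b N (fl t N)"
  have 1: "(\<lambda>N. norm (G (?x N) (?y N))) \<longlonglongrightarrow> norm (G s t)"
    using st by (intro tendsto_norm cont conv) (auto intro!: mono range flm flt)
  have "(\<lambda>N. (?y N - ?x N) powr e) \<longlonglongrightarrow> (t - s) powr e"
    using e st by (intro tendsto_powr2 tendsto_diff conv tendsto_const) (auto intro!: mono flm always_eventually)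
  then have 2: "(\<lambda>N. chain_const e * (M + c) * (?y N - ?x N) powr e) \<longlonglongrightarrow> chain_const e * (M + c) * (t - s) powr e"
    by (rule tendsto_mult_left)
  show ?thesis
    by (rule LIMSEQ_le[OF 1 2]) (use pts flm flt in blast)
qed

section \<open>Chaining for rough paths\<close>

lemma norm_tensor: "norm (tensor x y) = norm x * norm (y :: real^'m::finite)"
proof -
  have "norm (tensor x y $ i) = \<bar>x $ i\<bar> * norm y" for i
  proof -
    have "tensor x y $ i = x $ i *\<^sub>R y" by (simp add: tensor_def vec_eq_iff)
    then show ?thesis by simp
  qed
  then have "norm (tensor x y) = L2_set (\<lambda>i. \<bar>x $ i\<bar> * norm y) UNIV"
    by (simp add: norm_vec_def[of "tensor x y"])
  also have "\<dots> = norm x * norm y"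
    by (simp add: norm_vec_def[of x] L2_set_left_distrib)
  finally show ?thesis .
qed

lemma bounded_bilinear_tensor: "bounded_bilinear (tensor :: real^'m::finite \<Rightarrow> _)"
  by standard (auto simp: tensor_def vec_eq_iff algebra_simps
      intro!: exI[of _ 1] order_eq_refl norm_tensor[unfolded tensor_def])

interpretation tensor: bounded_bilinear "tensor :: real^'m::finite \<Rightarrow> _"
  by (rule bounded_bilinear_tensor)

text \<open>Continuity of the area is asked for in the second argument only; Chen's relation
  upgrades it to joint continuity.\<close>

definition rough_path :: "(real \<Rightarrow> real^'m::finite) \<Rightarrow> (real \<Rightarrow> real \<Rightarrow> real^'m^'m) \<Rightarrow> bool"
  where "rough_path X XX \<longleftrightarrow> continuous_on UNIV X \<and> (\<forall>a. continuous_on {a..} (XX a)) \<and>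
    (\<forall>s u t. s \<le> u \<longrightarrow> u \<le> t \<longrightarrow> XX s t - XX s u - XX u t = tensor (X u - X s) (X t - X u))"

lemma rough_path_zero: "rough_path (\<lambda>_. 0) (\<lambda>_ _. 0)"
  by (simp add: rough_path_def tensor.zero_left)

lemma rough_path_chen:
  assumes "rough_path X XX" "s \<le> u" "u \<le> t"
  shows "XX s t = XX s u + XX u t + tensor (X u - X s) (X t - X u)"
proof -
  have "XX s t - XX s u - XX u t = tensor (X u - X s) (X t - X u)"
    using assms unfolding rough_path_def by blast
  then show ?thesis by (simp add: diff_eq_eq ac_simps)
qed

lemma rough_path_same: "rough_path X XX \<Longrightarrow> XX s s = 0"
  using rough_path_chen[of X XX s s s] by (simp add: tensor.zero_left)

text \<open>Chen's relation with a fixed base point \<open>a\<close> to the left of all times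
  expresses \<open>XX s t\<close> through two values of \<open>XX a\<close> and increments of
  \<open>X\<close>.\<close>

lemma rough_path_tendsto:
  assumes X: "rough_path X XX" and xy: "\<And>n. a \<le> x n \<and> x n \<le> y n"
    and lim: "x \<longlonglongrightarrow> s" "y \<longlonglongrightarrow> t"
  shows "(\<lambda>n. X (x n)) \<longlonglongrightarrow> X s" "(\<lambda>n. XX (x n) (y n)) \<longlonglongrightarrow> XX s t"
proof -
  have cX: "(\<lambda>n. X (z n)) \<longlonglongrightarrow> X u" if "z \<longlonglongrightarrow> u" for z u
  proof -
    have "isCont X u" using X by (simp add: rough_path_def continuous_on_eq_continuous_at)
    then show ?thesis using that by (rule isCont_tendsto_compose)
  qed
  show "(\<lambda>n. X (x n)) \<longlonglongrightarrow> X s" by (rule cX[OF lim(1)])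
  have le: "a \<le> s" "a \<le> t" "s \<le> t"
  proof -
    show "a \<le> s" by (rule LIMSEQ_le_const[OF lim(1)]) (use xy in auto)
    show "a \<le> t" by (rule LIMSEQ_le_const[OF lim(2)]) (use xy order_trans in blast)
    show "s \<le> t" by (rule LIMSEQ_le[OF lim]) (use xy in auto)
  qed
  have xy': "a \<le> x n" "a \<le> y n" for n using xy[of n] by auto
  have cP: "(\<lambda>n. XX a (z n)) \<longlonglongrightarrow> XX a u" if "z \<longlonglongrightarrow> u" "\<And>n. a \<le> z n" "a \<le> u" for z u
    using X that by (auto simp: rough_path_def intro!: continuous_on_tendsto_compose[of "{a..}" "XX a"])
  have eq: "XX s t = XX a t - XX a s - tensor (X s - X a) (X t - X s)" if "a \<le> s" "s \<le> t" for s t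
    using rough_path_chen[OF X that] by simp
  have "(\<lambda>n. XX a (y n) - XX a (x n) - tensor (X (x n) - X a) (X (y n) - X (x n))) \<longlonglongrightarrow>
      XX a t - XX a s - tensor (X s - X a) (X t - X s)"
    by (intro tendsto_diff tensor.tendsto cX cP lim tendsto_const le xy')
  then show "(\<lambda>n. XX (x n) (y n)) \<longlonglongrightarrow> XX s t"
    by (simp only: eq[OF le(1,3)] eq[OF xy'(1) conjunct2[OF xy]])
qed

lemma rough_path_continuous:
  assumes X: "rough_path X XX"
  shows "continuous_on {(s, t). a \<le> s \<and> s \<le> t} (\<lambda>(s, t). XX s t)"
  unfolding continuous_on_sequentially
proof (intro ballI allI impI, elim conjE)
  fix z :: "nat \<Rightarrow> real \<times> real" and p :: "real \<times> real"
  assume p: "p \<in> {(s, t). a \<le> s \<and> s \<le> t}" and z: "\<forall>n. z n \<in> {(s, t). a \<le> s \<and> s \<le> t}" "z \<longlonglongrightarrow> p"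
  have "(\<lambda>n. XX (fst (z n)) (snd (z n))) \<longlonglongrightarrow> XX (fst p) (snd p)"
    using z by (intro rough_path_tendsto(2)[OF X, of a] tendsto_fst tendsto_snd) (auto simp: case_prod_beta)
  then show "((\<lambda>(s, t). XX s t) \<circ> z) \<longlonglongrightarrow> (case p of (s, t) \<Rightarrow> XX s t)"
    by (simp add: o_def case_prod_beta)
qed

text \<open>The increments of \<open>X\<close> are eliminated in favour of \<open>Z = X - Y\<close>,
  so every summand of the remainder in Chen's relation for \<open>XX - YY\<close> carries a factor
  \<open>Z\<close>. With the path bounds obtained from chaining, this remainder has the form of the
  cross term of \<open>dyadic_holder\<close>.\<close>

lemma rough_dist_chain:
  fixes X Y :: "real \<Rightarrow> real^'m::finite"
  assumes X: "rough_path X XX" and Y: "rough_path Y YY"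
    and ab: "a < b" and e: "e > 0" and K: "KZ \<ge> 0" "KY \<ge> 0" "KD \<ge> 0"
    and Z: "\<And>n k s t. k < 2 ^ n \<Longrightarrow> s = dyadic a b n k \<Longrightarrow> t = dyadic a b n (Suc k) \<Longrightarrow>
      norm (X t - X s - Y t + Y s) \<le> KZ * ((b - a) / 2 ^ n) powr e"
    and Yb: "\<And>n k s t. k < 2 ^ n \<Longrightarrow> s = dyadic a b n k \<Longrightarrow> t = dyadic a b n (Suc k) \<Longrightarrow>
      norm (Y t - Y s) \<le> KY * ((b - a) / 2 ^ n) powr e"
    and D: "\<And>n k s t. k < 2 ^ n \<Longrightarrow> s = dyadic a b n k \<Longrightarrow> t = dyadic a b n (Suc k) \<Longrightarrow>
      norm (XX s t - YY s t) \<le> KD * ((b - a) / 2 ^ n) powr (2 * e)"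
    and Q: "Q = chain_const e" "Q' = chain_const (2 * e)"
    and st: "a \<le> s" "s \<le> t" "t \<le> b"
  shows "norm (X t - X s - Y t + Y s) \<le> Q * KZ * (t - s) powr e"
    and "norm (XX s t - YY s t) \<le> Q' * (KD + Q\<^sup>2 * (2 * KY * KZ + KZ\<^sup>2)) * (t - s) powr (2 * e)"
proof -
  have tri: "norm ((f t - f s) :: real^'m) \<le> norm (f u - f s) + norm (f t - f u)" for f s u t
    using norm_triangle_ineq[of "f u - f s" "f t - f u"] by simp
  have path: "norm (f t - f s) \<le> Q * K * (t - s) powr e"
    if K: "K \<ge> 0" and blk: "\<And>n k s t. k < 2 ^ n \<Longrightarrow> s = dyadic a b n k \<Longrightarrow> t = dyadic a b n (Suc k) \<Longrightarrow>
      norm (f t - f s) \<le> K * ((b - a) / 2 ^ n) powr e"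
      and f: "continuous_on UNIV f" and st: "a \<le> s" "s \<le> t" "t \<le> b"
    for f :: "real \<Rightarrow> real^'m" and K s t
  proof -
    have "norm (f t - f s) \<le> chain_const e * (K + 0) * (t - s) powr e"
    proof (rule dyadic_holder[OF ab e, where G = "\<lambda>s t. f t - f s"])
      have c: "(\<lambda>n. f (z n)) \<longlonglongrightarrow> f u" if "z \<longlonglongrightarrow> u" for z u
        using f that by (intro isCont_tendsto_compose[of u f]) (simp_all add: continuous_on_eq_continuous_at)
      show "(\<lambda>n. f (y n) - f (x n)) \<longlonglongrightarrow> f t - f s" if "x \<longlonglongrightarrow> s" "y \<longlonglongrightarrow> t" for x y
        using that by (intro tendsto_diff c)
    qed (use K st blk tri in auto)
    then show ?thesis using Q by simp
  qed
  let ?Z = "\<lambda>t. X t - Y t"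
  have ZY: "X t - X s - Y t + Y s = ?Z t - ?Z s" for s t by simp
  have cX: "continuous_on UNIV X" "continuous_on UNIV Y" using X Y by (auto simp: rough_path_def)
  have HZ: "norm (?Z t - ?Z s) \<le> Q * KZ * (t - s) powr e" if "a \<le> s" "s \<le> t" "t \<le> b" for s t
    by (rule path) (use K Z that cX in \<open>auto simp: ZY intro!: continuous_intros\<close>)
  have HY: "norm (Y t - Y s) \<le> Q * KY * (t - s) powr e" if "a \<le> s" "s \<le> t" "t \<le> b" for s t
    by (rule path) (use K Yb that cX in auto)
  show "norm (X t - X s - Y t + Y s) \<le> Q * KZ * (t - s) powr e"
    unfolding ZY by (rule HZ[OF st])
  have Qp: "Q > 0" using chain_const_pos[OF e] Q by simp
  show "norm (XX s t - YY s t) \<le> Q' * (KD + Q\<^sup>2 * (2 * KY * KZ + KZ\<^sup>2)) * (t - s) powr (2 * e)"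
    unfolding Q(2)
  proof (rule dyadic_holder[OF ab, where G = "\<lambda>s t. XX s t - YY s t"])
    show "(\<lambda>n. XX (x n) (y n) - YY (x n) (y n)) \<longlonglongrightarrow> XX s t - YY s t"
      if "\<And>n. a \<le> x n \<and> x n \<le> y n \<and> y n \<le> b" "x \<longlonglongrightarrow> s" "y \<longlonglongrightarrow> t" for x y
      using that by (intro tendsto_diff rough_path_tendsto(2)[OF X, of a] rough_path_tendsto(2)[OF Y, of a]) auto
    show "norm (XX s t - YY s t) \<le> norm (XX s u - YY s u) + norm (XX u t - YY u t)
       + Q\<^sup>2 * (2 * KY * KZ + KZ\<^sup>2) * ((u - s) powr (2 * e / 2) * (t - u) powr (2 * e / 2))"
      if st: "a \<le> s" "s \<le> u" "u \<le> t" "t \<le> b" for s u t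
    proof -
      let ?p = "(u - s) powr e" and ?q = "(t - u) powr e"
      let ?A = "?Z u - ?Z s" and ?B = "?Z t - ?Z u" and ?C = "Y u - Y s" and ?D = "Y t - Y u"
      have A: "norm ?A \<le> Q * KZ * ?p" "norm ?C \<le> Q * KY * ?p" using st by (auto intro!: HZ HY)
      have B: "norm ?B \<le> Q * KZ * ?q" "norm ?D \<le> Q * KY * ?q" using st by (auto intro!: HZ HY)
      \<comment> \<open>Substituting \<open>X = Y + Z\<close> cancels the pure \<open>Y\<close>
        product.\<close>
      have "tensor (X u - X s) (X t - X u) - tensor ?C ?D = tensor ?A ?B + tensor ?A ?D + tensor ?C ?B"
        by (simp add: tensor.diff_left tensor.diff_right tensor.add_left tensor.add_right algebra_simps)
      then have "XX s t - YY s t = (XX s u - YY s u) + (XX u t - YY u t) + (tensor ?A ?B + tensor ?A ?D + tensor ?C ?B)"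
        using rough_path_chen[OF X st(2,3)] rough_path_chen[OF Y st(2,3)] by simp
      moreover have "norm (tensor ?A ?B + tensor ?A ?D + tensor ?C ?B)
          \<le> norm ?A * norm ?B + norm ?A * norm ?D + norm ?C * norm ?B"
        by (intro order_trans[OF norm_triangle_ineq] add_mono order_refl) (simp_all only: norm_tensor order_refl)
      moreover have "\<dots> \<le> (Q * KZ * ?p) * (Q * KZ * ?q) + (Q * KZ * ?p) * (Q * KY * ?q) + (Q * KY * ?p) * (Q * KZ * ?q)"
        using A B K Qp by (intro add_mono mult_mono) auto
      moreover have "\<dots> = Q\<^sup>2 * (2 * KY * KZ + KZ\<^sup>2) * (?p * ?q)"
        by (simp add: power2_eq_square algebra_simps)
      ultimately show ?thesis
        using norm_triangle_ineq[of "XX s u - YY s u" "XX u t - YY u t"]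
          norm_triangle_ineq[of "(XX s u - YY s u) + (XX u t - YY u t)" "tensor ?A ?B + tensor ?A ?D + tensor ?C ?B"]
        by simp
    qed
  qed (use e K Qp D st rough_path_same[OF X] rough_path_same[OF Y] in auto)
qed

text \<open>Only neighbouring dyadic points enter, so this is a countable supremum: measurability
  and moment bounds come from single increments.\<close>

definition dyadic_sup :: "real \<Rightarrow> real \<Rightarrow> real \<Rightarrow> (real \<Rightarrow> real \<Rightarrow> real) \<Rightarrow> ennreal"
  where "dyadic_sup a b e F = (SUP (n, k) \<in> {(n, k). k < 2 ^ n}.
    ennreal (F (dyadic a b n k) (dyadic a b n (Suc k)) / ((b - a) / 2 ^ n) powr e))"

lemma dyadic_sup_bound:
  assumes "dyadic_sup a b e F = ennreal K" "K \<ge> 0" "a < b" "k < 2 ^ n" "s = dyadic a b n k" "t = dyadic a b n (Suc k)"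
  shows "F s t \<le> K * ((b - a) / 2 ^ n) powr e"
proof -
  have "ennreal (F s t / ((b - a) / 2 ^ n) powr e) \<le> dyadic_sup a b e F"
    unfolding dyadic_sup_def assms(5,6) by (rule SUP_upper2[of "(n, k)"]) (use assms in auto)
  then have "F s t / ((b - a) / 2 ^ n) powr e \<le> K"
    using assms(1,2) by (simp add: ennreal_le_iff)
  then show ?thesis using assms(3) by (simp add: divide_le_eq mult.commute)
qed

text \<open>\<open>C\<close> depends on \<open>a\<close>, \<open>b\<close> and \<open>e\<close>
  only. The free parameter \<kappa> is the anticipated size of the difference: the mixed product of
  suprema from \<open>rough_dist_chain\<close> is separated into squares so that moments can be
  taken term by term, each summand then being of order \<kappa>.\<close>

lemma rough_dist_le_sup:
  fixes X Y :: "real \<Rightarrow> real^'m::finite"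
  assumes ab: "a < b" and e: "e > 0"
  shows "\<exists>C>0. \<forall>X XX Y (YY :: real \<Rightarrow> real \<Rightarrow> real^'m^'m) \<kappa> \<beta> s t. rough_path X XX \<longrightarrow> rough_path Y YY \<longrightarrow>
    0 < \<kappa> \<longrightarrow> \<kappa> \<le> 1 \<longrightarrow> 0 < \<beta> \<longrightarrow> \<beta> \<le> e \<longrightarrow> a \<le> s \<longrightarrow> s \<le> t \<longrightarrow> t \<le> b \<longrightarrow>
    rough_dist \<beta> s t (X, XX) (Y, YY) \<le> ennreal C *
      (dyadic_sup a b e (\<lambda>s t. norm (X t - X s - Y t + Y s))
       + dyadic_sup a b (2 * e) (\<lambda>s t. norm (XX s t - YY s t))
       + ennreal \<kappa> * dyadic_sup a b e (\<lambda>s t. norm (Y t - Y s)) ^ 2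
       + ennreal (1 / \<kappa>) * dyadic_sup a b e (\<lambda>s t. norm (X t - X s - Y t + Y s)) ^ 2)"
proof -
  \<comment> \<open>Bounds \<open>h powr (x * (e - \<beta>))\<close> for
    \<open>h \<le> b - a\<close> and \<open>x \<le> 2\<close>, uniformly in \<beta>, so that a bound
    of exponent \<open>e\<close> yields one of exponent \<beta>.\<close>
  define R where "R = max 1 (b - a) powr (2 * e)"
  define Q where "Q = chain_const e"
  define Q' where "Q' = chain_const (2 * e)"
  define C where "C = R * (Q + Q' + 2 * Q' * Q\<^sup>2)"
  have R: "R \<ge> 1" using e by (simp add: R_def ge_one_powr_ge_zero)
  have Qp: "Q > 0" "Q' > 0" using chain_const_pos e by (auto simp: Q_def Q'_def)
  have C: "C > 0" using R Qp by (auto simp: C_def intro!: mult_pos_pos add_pos_pos)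
  have Rb: "h powr (x * e) \<le> R * h powr (x * \<beta>)"
    if "0 < h" "h \<le> b - a" "0 < \<beta>" "\<beta> \<le> e" "0 < x" "x \<le> 2" for h x \<beta>
  proof -
    have "h powr (x * (e - \<beta>)) \<le> (max 1 (b - a)) powr (x * (e - \<beta>))"
      using that by (intro powr_mono2) auto
    also have "\<dots> \<le> (max 1 (b - a)) powr (2 * e)"
      using that e by (intro powr_mono mult_mono) auto
    finally have "h powr (x * (e - \<beta>)) \<le> R" by (simp add: R_def)
    then have "h powr (x * (e - \<beta>)) * h powr (x * \<beta>) \<le> R * h powr (x * \<beta>)"
      by (intro mult_right_mono) auto
    then show ?thesis by (simp add: powr_add[symmetric] algebra_simps)
  qed
  show ?thesis
  proof (intro exI[of _ C] conjI allI impI C)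
    fix X Y :: "real \<Rightarrow> real^'m" and XX YY and \<kappa> \<beta> s t :: real
    assume X: "rough_path X XX" and Y: "rough_path Y YY" and \<kappa>: "0 < \<kappa>" "\<kappa> \<le> 1"
      and \<beta>: "0 < \<beta>" "\<beta> \<le> e" and st: "a \<le> s" "s \<le> t" "t \<le> b"
    let ?FZ = "\<lambda>s t. norm (X t - X s - Y t + Y s)" and ?FD = "\<lambda>s t. norm (XX s t - YY s t)"
      and ?FY = "\<lambda>s t. norm (Y t - Y s)"
    let ?SZ = "dyadic_sup a b e ?FZ" and ?SD = "dyadic_sup a b (2 * e) ?FD" and ?SY = "dyadic_sup a b e ?FY"
    show "rough_dist \<beta> s t (X, XX) (Y, YY) \<le>
      ennreal C * (?SZ + ?SD + ennreal \<kappa> * ?SY ^ 2 + ennreal (1 / \<kappa>) * ?SZ ^ 2)" (is "_ \<le> ?rhs")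
    \<comment> \<open>An infinite supremum makes the right-hand side infinite, since \<kappa> and
      \<open>C\<close> are positive; otherwise all three suprema are real numbers.\<close>
    proof (cases "?SZ = \<infinity> \<or> ?SD = \<infinity> \<or> ?SY = \<infinity>")
      case True
      moreover have top: "x * \<infinity>\<^sup>2 = \<infinity>" if "x > 0" for x :: ennreal
        using that by (simp add: power2_eq_square ennreal_mult_eq_top_iff)
      ultimately have "?SZ + ?SD + ennreal \<kappa> * ?SY ^ 2 + ennreal (1 / \<kappa>) * ?SZ ^ 2 = \<infinity>"
        using \<kappa> by (elim disjE) (simp_all add: top)
      moreover have "ennreal C * \<infinity> = \<infinity>" using C by (simp add: ennreal_mult_eq_top_iff)
      ultimately have "?rhs = \<infinity>" by (simp only:)
      then show ?thesis by (simp only: infinity_ennreal_def top_greatest)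
    next
      case False
      moreover have fin: "\<exists>K. S = ennreal K \<and> K \<ge> 0" if "S \<noteq> \<infinity>" for S
        using that by (cases S) auto
      ultimately obtain KZ KD KY where K: "?SZ = ennreal KZ" "KZ \<ge> 0" "?SD = ennreal KD" "KD \<ge> 0" "?SY = ennreal KY" "KY \<ge> 0"
        by blast
      define V where "V = KZ + KD + \<kappa> * KY\<^sup>2 + 1 / \<kappa> * KZ\<^sup>2"
      have rhs: "?rhs = ennreal (C * V)"
        unfolding K V_def using K C \<kappa>
        by (simp add: ennreal_plus[symmetric] ennreal_mult[symmetric] ennreal_power del: ennreal_plus)
      \<comment> \<open>Young's inequality weighted by \<kappa>; \<open>\<kappa> \<le> 1\<close>
        lets \<open>KZ ^ 2 / \<kappa>\<close> absorb the leftover \<open>KZ ^ 2\<close>.\<close>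
      have yz: "2 * KY * KZ + KZ\<^sup>2 \<le> 2 * (\<kappa> * KY\<^sup>2 + 1 / \<kappa> * KZ\<^sup>2)"
      proof -
        have "0 \<le> (\<kappa> * KY - KZ)\<^sup>2 / \<kappa>" using \<kappa> by simp
        also have "\<dots> = \<kappa> * KY\<^sup>2 + 1 / \<kappa> * KZ\<^sup>2 - 2 * KY * KZ"
          using \<kappa> by (simp add: power2_eq_square field_simps)
        finally have 1: "2 * KY * KZ \<le> \<kappa> * KY\<^sup>2 + 1 / \<kappa> * KZ\<^sup>2" by simp
        have "1 * KZ\<^sup>2 \<le> 1 / \<kappa> * KZ\<^sup>2" using \<kappa> by (intro mult_right_mono) auto
        moreover have "\<kappa> * KY\<^sup>2 \<ge> 0" using \<kappa> by simp
        ultimately show ?thesis using 1 unfolding mult_1 mult_2[of "_ + _"] by linarith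
      qed
      have main: "norm (X v - X u - Y v + Y u) / (v - u) powr \<beta> + norm (XX u v - YY u v) / (v - u) powr (2 * \<beta>) \<le> C * V"
        if uv: "s \<le> u" "u < v" "v \<le> t" for u v
      proof -
        have r: "a \<le> u" "u \<le> v" "v \<le> b" using uv st by auto
        have bZ: "norm (X t - X s - Y t + Y s) \<le> KZ * ((b - a) / 2 ^ n) powr e"
          and bY: "norm (Y t - Y s) \<le> KY * ((b - a) / 2 ^ n) powr e"
          and bD: "norm (XX s t - YY s t) \<le> KD * ((b - a) / 2 ^ n) powr (2 * e)"
          if "k < 2 ^ n" "s = dyadic a b n k" "t = dyadic a b n (Suc k)" for n k s t
          using dyadic_sup_bound[OF K(1,2) ab that] dyadic_sup_bound[OF K(5,6) ab that]
            dyadic_sup_bound[OF K(3,4) ab that] by auto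
        note ch = rough_dist_chain[OF X Y ab e K(2) K(6) K(4) bZ bY bD Q_def Q'_def r]
        have pos: "(v - u) powr x > 0" for x using uv by simp
        have "norm (X v - X u - Y v + Y u) \<le> Q * KZ * (v - u) powr e"
          by (rule ch(1)) assumption+
        also have "\<dots> \<le> Q * KZ * (R * (v - u) powr \<beta>)"
          using Rb[of "v - u" \<beta> 1] uv r \<beta> K Qp by (intro mult_left_mono) auto
        finally have 1: "norm (X v - X u - Y v + Y u) / (v - u) powr \<beta> \<le> Q * R * KZ"
          using pos by (simp add: divide_le_eq mult_ac)
        have "norm (XX u v - YY u v) \<le> Q' * (KD + Q\<^sup>2 * (2 * KY * KZ + KZ\<^sup>2)) * (v - u) powr (2 * e)"
          by (rule ch(2)) assumption+
        also have "\<dots> \<le> Q' * (KD + Q\<^sup>2 * (2 * (\<kappa> * KY\<^sup>2 + 1 / \<kappa> * KZ\<^sup>2))) * (R * (v - u) powr (2 * \<beta>))"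
          using Rb[of "v - u" \<beta> 2] uv r \<beta> K Qp yz \<kappa> by (intro mult_mono[of "Q' * _"] mult_left_mono add_mono order_refl) auto
        finally have 2: "norm (XX u v - YY u v) / (v - u) powr (2 * \<beta>) \<le> Q' * (KD + Q\<^sup>2 * (2 * (\<kappa> * KY\<^sup>2 + 1 / \<kappa> * KZ\<^sup>2))) * R"
          using pos by (simp add: divide_le_eq mult_ac)
        let ?W = "\<kappa> * KY\<^sup>2 + 1 / \<kappa> * KZ\<^sup>2"
        have W: "?W \<ge> 0" using \<kappa> by simp
        have "Q * R * KZ + Q' * (KD + Q\<^sup>2 * (2 * ?W)) * R
          = R * (Q * KZ + Q' * KD + 2 * Q' * Q\<^sup>2 * ?W)" by (simp only: algebra_simps)
        also have "\<dots> \<le> R * ((Q + Q' + 2 * Q' * Q\<^sup>2) * KZ + (Q + Q' + 2 * Q' * Q\<^sup>2) * KD + (Q + Q' + 2 * Q' * Q\<^sup>2) * ?W)"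
          using R Qp K W by (intro mult_left_mono[of _ _ R] add_mono mult_right_mono) auto
        also have "\<dots> = C * V" by (simp add: C_def V_def algebra_simps)
        finally show ?thesis using 1 2 by linarith
      qed
      show ?thesis unfolding rhs rough_dist_def
        by (auto simp del: ennreal_plus intro!: SUP_least ennreal_leI main)
    qed
  qed
qed

section \<open>Moments, measurability and \<open>L\<^sub>p\<close>-norms\<close>

lemma ennreal_SUP_power_le:
  fixes x :: "'i \<Rightarrow> ennreal"
  assumes r: "r > 0" and le: "\<And>i. i \<in> I \<Longrightarrow> x i ^ r \<le> S"
  shows "(SUP i\<in>I. x i) ^ r \<le> S"
proof (cases S)
  case (real s)
  have "x i \<le> ennreal (root r s)" if "i \<in> I" for i
  proof (cases "x i")
    case (real y)
    have "ennreal (y ^ r) \<le> ennreal s"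
      using le[OF that] real \<open>S = ennreal s\<close> by (simp add: ennreal_power)
    then have "y ^ r \<le> s" using \<open>0 \<le> s\<close> by simp
    then have "y \<le> root r s" using real r by (metis real_root_le_mono real_root_power_cancel)
    then show ?thesis using real by (simp add: ennreal_leI)
  next
    case top
    then show ?thesis using le[OF that] real r by (simp add: top_unique power_eq_top_ennreal)
  qed
  then have "(SUP i\<in>I. x i) ^ r \<le> ennreal (root r s) ^ r" by (intro power_mono SUP_least) auto
  also have "\<dots> = S" using real r by (simp add: ennreal_power)
  finally show ?thesis .
qed simp

text \<open>\<open>ennreal\<close> cuts negative values off to zero, so wherever this is used either
  \<open>k\<close> is even or \<open>f\<close> is nonnegative.\<close>

abbreviation moment :: "'a measure \<Rightarrow> nat \<Rightarrow> ('a \<Rightarrow> real) \<Rightarrow> ennreal"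
  where "moment M k f \<equiv> (\<integral>\<^sup>+ \<omega>. ennreal (f \<omega> ^ k) \<partial>M)"

text \<open>The value of the geometric series of \<open>2 ^ n * ((b - a) / 2 ^ n) powr x\<close>
  over all levels \<open>n\<close>.\<close>

definition dyadic_moment_const :: "real \<Rightarrow> real \<Rightarrow> real \<Rightarrow> real"
  where "dyadic_moment_const a b x = (b - a) powr x / (1 - 2 powr (1 - x))"

lemma dyadic_moment_const_pos: "a < b \<Longrightarrow> x > 1 \<Longrightarrow> dyadic_moment_const a b x > 0"
  by (simp add: dyadic_moment_const_def powr_less_one)

text \<open>Kolmogorov's argument: the power of a supremum is at most the sum of the powers. Level
  \<open>n\<close> has \<open>2 ^ n\<close> blocks, each contributing at most
  \<open>A * ((b - a) / 2 ^ n) powr x\<close>, and \<open>x > 1\<close> makes the total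
  finite.\<close>

lemma dyadic_sup_moment:
  fixes F :: "'a \<Rightarrow> real \<Rightarrow> real \<Rightarrow> real"
  assumes ab: "a < b" and r: "r > 0" and x: "x = (g - e) * real r" "x > 1" and A: "A \<ge> 0"
    and F: "\<And>\<omega> s t. F \<omega> s t \<ge> 0"
    and meas: "\<And>s t. s < t \<Longrightarrow> (\<lambda>\<omega>. F \<omega> s t) \<in> borel_measurable M"
    and mom: "\<And>s t. a \<le> s \<Longrightarrow> s < t \<Longrightarrow> t \<le> b \<Longrightarrow>
      (moment M r (\<lambda>\<omega>. F \<omega> s t)) \<le> ennreal (A * (t - s) powr (g * real r))"
  shows "(\<integral>\<^sup>+ \<omega>. dyadic_sup a b e (F \<omega>) ^ r \<partial>M) \<le> ennreal (A * dyadic_moment_const a b x)"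
proof -
  let ?h = "\<lambda>n. (b - a) / 2 ^ n" and ?p = "dyadic a b"
  define T where "T n k \<omega> = ennreal ((F \<omega> (?p n k) (?p n (Suc k)) / ?h n powr e) ^ r)" for n k \<omega>
  have h: "?h n > 0" for n using ab by simp
  have step: "?p n (Suc k) - ?p n k = ?h n" for n k by (simp add: dyadic_def field_simps)
  have lt: "?p n k < ?p n (Suc k)" for n k using step[of n k] h[of n] by linarith
  have lo: "a \<le> ?p n k" for n k using ab by (simp add: dyadic_def)
  have hi: "?p n (Suc k) \<le> b" if "k < 2 ^ n" for n k
  proof -
    have "real (Suc k) \<le> 2 ^ n" using that
      by (metis Suc_leI of_nat_le_iff of_nat_numeral of_nat_power)
    then have "(b - a) * real (Suc k) / 2 ^ n \<le> (b - a) * 2 ^ n / 2 ^ n"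
      using ab by (intro divide_right_mono mult_left_mono) auto
    then show ?thesis by (simp add: dyadic_def)
  qed
  have Tm: "T n k \<in> borel_measurable M" for n k
    unfolding T_def using meas[OF lt] by measurable
  have 1: "dyadic_sup a b e (F \<omega>) ^ r \<le> (\<Sum>n. \<Sum>k<2 ^ n. T n k \<omega>)" for \<omega>
    unfolding dyadic_sup_def
  proof (rule ennreal_SUP_power_le[OF r], clarify)
    fix n k :: nat assume k: "k < 2 ^ n"
    have "ennreal (F \<omega> (?p n k) (?p n (Suc k)) / ?h n powr e) ^ r = T n k \<omega>"
      unfolding T_def using F by (simp add: ennreal_power)
    also have "\<dots> \<le> (\<Sum>k<2 ^ n. T n k \<omega>)" using k by (intro member_le_sum) auto
    also have "\<dots> \<le> (\<Sum>n. \<Sum>k<2 ^ n. T n k \<omega>)"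
      using sum_le_suminf[of "\<lambda>n. \<Sum>k<2 ^ n. T n k \<omega>" "{n}"] by simp
    finally show "ennreal (F \<omega> (?p n k) (?p n (Suc k)) / ?h n powr e) ^ r \<le> (\<Sum>n. \<Sum>k<2 ^ n. T n k \<omega>)" .
  qed
  define z where "z = 2 powr (1 - x)"
  have z: "0 < z" "z < 1" using x by (auto simp: z_def powr_less_one)
  have 2: "(\<integral>\<^sup>+ \<omega>. T n k \<omega> \<partial>M) \<le> ennreal (A * ?h n powr x)" if k: "k < 2 ^ n" for n k
  proof -
    let ?c = "(?h n powr e) ^ r"
    have c: "?c > 0" "?c = ?h n powr (e * real r)"
    proof -
      have p: "?h n powr e > 0" using ab by simp
      show "?c > 0" using p by (rule zero_less_power)
      show "?c = ?h n powr (e * real r)" by (simp only: powr_realpow[OF p, symmetric] powr_powr)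
    qed
    have "(\<integral>\<^sup>+ \<omega>. T n k \<omega> \<partial>M) = (\<integral>\<^sup>+ \<omega>. ennreal (1 / ?c) * ennreal (F \<omega> (?p n k) (?p n (Suc k)) ^ r) \<partial>M)"
      unfolding T_def using F c by (intro nn_integral_cong) (simp add: power_divide ennreal_mult[symmetric])
    also have "\<dots> = ennreal (1 / ?c) * (moment M r (\<lambda>\<omega>. F \<omega> (?p n k) (?p n (Suc k))))"
      by (rule nn_integral_cmult) (use meas[OF lt] in measurable)
    also have "\<dots> \<le> ennreal (1 / ?c) * ennreal (A * ?h n powr (g * real r))"
      using mom[OF lo lt hi[OF k], unfolded step] by (rule mult_left_mono) simp
    also have "\<dots> = ennreal (A * (?h n powr (g * real r) / ?h n powr (e * real r)))"
      unfolding c(2)[symmetric] using c(1) A by (subst ennreal_mult[symmetric]) auto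
    also have "?h n powr (g * real r) / ?h n powr (e * real r) = ?h n powr x"
      by (simp add: powr_diff[symmetric] x(1) algebra_simps)
    finally show ?thesis .
  qed
  have 3: "(\<Sum>k<(2::nat) ^ n. A * ?h n powr x) = A * (b - a) powr x * z ^ n" for n
  proof -
    have "((b - a) / 2 ^ n) powr x = (b - a) powr x / (2 powr x) ^ n"
      using ab by (simp add: powr_divide powr_powr powr_realpow[symmetric] mult.commute)
    then show ?thesis
      by (simp add: z_def powr_diff power_divide)
  qed
  have "(\<integral>\<^sup>+ \<omega>. dyadic_sup a b e (F \<omega>) ^ r \<partial>M) \<le> (\<integral>\<^sup>+ \<omega>. (\<Sum>n. \<Sum>k<2 ^ n. T n k \<omega>) \<partial>M)"
    by (intro nn_integral_mono 1)
  also have "\<dots> = (\<Sum>n. \<integral>\<^sup>+ \<omega>. (\<Sum>k<2 ^ n. T n k \<omega>) \<partial>M)"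
    by (rule nn_integral_suminf) (use Tm in measurable)
  also have "\<dots> = (\<Sum>n. \<Sum>k<2 ^ n. \<integral>\<^sup>+ \<omega>. T n k \<omega> \<partial>M)"
    by (subst nn_integral_sum) (use Tm in auto)
  also have "\<dots> \<le> (\<Sum>n. ennreal (A * (b - a) powr x * z ^ n))"
  proof (rule suminf_le)
    fix n
    have "(\<Sum>k<2 ^ n. \<integral>\<^sup>+ \<omega>. T n k \<omega> \<partial>M) \<le> (\<Sum>k<(2::nat) ^ n. ennreal (A * ?h n powr x))"
      by (intro sum_mono 2) auto
    also have "\<dots> = ennreal (A * (b - a) powr x * z ^ n)"
      unfolding 3[symmetric] using A by (intro sum_ennreal) auto
    finally show "(\<Sum>k<2 ^ n. \<integral>\<^sup>+ \<omega>. T n k \<omega> \<partial>M) \<le> ennreal (A * (b - a) powr x * z ^ n)" .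
  qed auto
  also have "\<dots> = ennreal (\<Sum>n. A * (b - a) powr x * z ^ n)"
    using A z by (intro suminf_ennreal2) (auto intro!: summable_mult summable_geometric)
  also have "(\<Sum>n. A * (b - a) powr x * z ^ n) = A * dyadic_moment_const a b x"
    using z by (subst suminf_mult) (auto simp: suminf_geometric dyadic_moment_const_def z_def[symmetric] intro!: summable_geometric)
  finally show ?thesis .
qed

text \<open>Continuity on \<open>A\<close> lets a countable dense subset of \<open>A\<close> replace
  \<open>A\<close> itself.\<close>

lemma borel_measurable_SUP_continuous:
  fixes f :: "'a \<Rightarrow> 'b::{metric_space, second_countable_topology} \<Rightarrow> ennreal"
  assumes meas: "\<And>x. x \<in> A \<Longrightarrow> (\<lambda>\<omega>. f \<omega> x) \<in> borel_measurable M"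
    and cont: "\<And>\<omega>. \<omega> \<in> space M \<Longrightarrow> continuous_on A (f \<omega>)"
  shows "(\<lambda>\<omega>. SUP x\<in>A. f \<omega> x) \<in> borel_measurable M"
proof -
  obtain D where D: "countable D" "D \<subseteq> A" "A \<subseteq> closure D" by (rule separable)
  have "(SUP x\<in>A. f \<omega> x) = (SUP x\<in>D. f \<omega> x)" if \<omega>: "\<omega> \<in> space M" for \<omega>
  proof (rule antisym)
    show "(SUP x\<in>A. f \<omega> x) \<le> (SUP x\<in>D. f \<omega> x)"
    proof (rule SUP_least)
      fix x assume x: "x \<in> A"
      then obtain u where u: "\<And>n. u n \<in> D" "u \<longlonglongrightarrow> x" using D(3) by (meson closure_sequential subsetD)
      have "(\<lambda>n. f \<omega> (u n)) \<longlonglongrightarrow> f \<omega> x"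
        by (rule continuous_on_tendsto_compose[OF cont[OF \<omega>] u(2) x]) (intro always_eventually allI subsetD[OF D(2)] u(1))
      then show "f \<omega> x \<le> (SUP x\<in>D. f \<omega> x)"
        by (rule LIMSEQ_le_const2) (use u(1) in \<open>auto intro!: SUP_upper\<close>)
    qed
  qed (use D in \<open>auto intro!: SUP_subset_mono\<close>)
  then show ?thesis
    using D(1,2) meas by (subst measurable_cong) (auto intro!: borel_measurable_SUP)
qed

text \<open>Joint continuity of the areas makes every quotient continuous off the diagonal, so that
  \<open>borel_measurable_SUP_continuous\<close> applies.\<close>

lemma rough_measurable:
  fixes X Y :: "'a \<Rightarrow> real \<Rightarrow> real^'m::finite"
  assumes X: "\<And>\<omega>. \<omega> \<in> space M \<Longrightarrow> rough_path (X \<omega>) (XX \<omega>)"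
    and Y: "\<And>\<omega>. \<omega> \<in> space M \<Longrightarrow> rough_path (Y \<omega>) (YY \<omega>)"
    and mX: "\<And>t. (\<lambda>\<omega>. X \<omega> t) \<in> borel_measurable M" and mY: "\<And>t. (\<lambda>\<omega>. Y \<omega> t) \<in> borel_measurable M"
    and mXX: "\<And>s t. s \<le> t \<Longrightarrow> (\<lambda>\<omega>. XX \<omega> s t) \<in> borel_measurable M"
    and mYY: "\<And>s t. s \<le> t \<Longrightarrow> (\<lambda>\<omega>. YY \<omega> s t) \<in> borel_measurable M"
  shows "(\<lambda>\<omega>. rough_dist \<beta> a b (X \<omega>, XX \<omega>) (Y \<omega>, YY \<omega>)) \<in> borel_measurable M"
    and "(\<lambda>\<omega>. holder1 \<beta> a b (X \<omega>)) \<in> borel_measurable M"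
    and "(\<lambda>\<omega>. holder2 \<beta> a b (XX \<omega>)) \<in> borel_measurable M"
proof -
  let ?A = "{(s, t). a \<le> s \<and> s < t \<and> t \<le> b}"
  have c2: "continuous_on ?A (\<lambda>x. ZZ (fst x) (snd x))" if "rough_path Z ZZ" for Z :: "real \<Rightarrow> real^'m" and ZZ
  proof -
    have "continuous_on ?A (\<lambda>(s, t). ZZ s t)"
      by (rule continuous_on_subset[OF rough_path_continuous[OF that, of a]]) auto
    then show ?thesis by (simp only: case_prod_beta')
  qed
  have c1: "continuous_on ?A (\<lambda>x. Z (fst x))" "continuous_on ?A (\<lambda>x. Z (snd x))"
    if "rough_path Z ZZ" for Z :: "real \<Rightarrow> real^'m" and ZZ
    using that unfolding rough_path_def
    by (auto intro!: continuous_on_compose2[of UNIV Z] continuous_intros)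
  have cp: "continuous_on ?A (\<lambda>x. (snd x - fst x) powr \<beta>)" for \<beta>
    by (intro continuous_on_powr continuous_intros) auto
  have pp: "\<forall>x\<in>?A. (snd x - fst x) powr \<beta> \<noteq> 0" for \<beta> by auto
  have "(\<lambda>\<omega>. SUP x\<in>?A. ennreal (norm (X \<omega> (snd x) - X \<omega> (fst x) - Y \<omega> (snd x) + Y \<omega> (fst x)) / (snd x - fst x) powr \<beta>
      + norm (XX \<omega> (fst x) (snd x) - YY \<omega> (fst x) (snd x)) / (snd x - fst x) powr (2 * \<beta>))) \<in> borel_measurable M"
  proof (rule borel_measurable_SUP_continuous)
    fix x assume "x \<in> ?A"
    then have "fst x \<le> snd x" by auto
    note [measurable] = mX mY mXX[OF this] mYY[OF this]
    show "(\<lambda>\<omega>. ennreal (norm (X \<omega> (snd x) - X \<omega> (fst x) - Y \<omega> (snd x) + Y \<omega> (fst x)) / (snd x - fst x) powr \<beta>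
      + norm (XX \<omega> (fst x) (snd x) - YY \<omega> (fst x) (snd x)) / (snd x - fst x) powr (2 * \<beta>))) \<in> borel_measurable M"
      by measurable
  next
    fix \<omega> assume \<omega>: "\<omega> \<in> space M"
    show "continuous_on ?A (\<lambda>x. ennreal (norm (X \<omega> (snd x) - X \<omega> (fst x) - Y \<omega> (snd x) + Y \<omega> (fst x)) / (snd x - fst x) powr \<beta>
      + norm (XX \<omega> (fst x) (snd x) - YY \<omega> (fst x) (snd x)) / (snd x - fst x) powr (2 * \<beta>)))"
      by (intro continuous_on_ennreal continuous_on_add continuous_on_divide continuous_on_norm continuous_on_diff
         c1[OF X[OF \<omega>]] c1[OF Y[OF \<omega>]] c2[OF X[OF \<omega>]] c2[OF Y[OF \<omega>]] cp pp)
  qed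
  then show "(\<lambda>\<omega>. rough_dist \<beta> a b (X \<omega>, XX \<omega>) (Y \<omega>, YY \<omega>)) \<in> borel_measurable M"
    unfolding rough_dist_def prod.case by (simp only: case_prod_beta')
  have "(\<lambda>\<omega>. SUP x\<in>?A. ennreal (norm (X \<omega> (snd x) - X \<omega> (fst x)) / (snd x - fst x) powr \<beta>)) \<in> borel_measurable M"
  proof (rule borel_measurable_SUP_continuous)
    note [measurable] = mX
    show "(\<lambda>\<omega>. ennreal (norm (X \<omega> (snd x) - X \<omega> (fst x)) / (snd x - fst x) powr \<beta>)) \<in> borel_measurable M" for x
      by measurable
  next
    fix \<omega> assume \<omega>: "\<omega> \<in> space M"
    show "continuous_on ?A (\<lambda>x. ennreal (norm (X \<omega> (snd x) - X \<omega> (fst x)) / (snd x - fst x) powr \<beta>))"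
      by (intro continuous_on_ennreal continuous_on_divide continuous_on_norm continuous_on_diff c1[OF X[OF \<omega>]] cp pp)
  qed
  then show "(\<lambda>\<omega>. holder1 \<beta> a b (X \<omega>)) \<in> borel_measurable M"
    unfolding holder1_def by (simp only: case_prod_beta')
  have "(\<lambda>\<omega>. SUP x\<in>?A. ennreal (norm (XX \<omega> (fst x) (snd x)) / (snd x - fst x) powr \<beta>)) \<in> borel_measurable M"
  proof (rule borel_measurable_SUP_continuous)
    fix x assume "x \<in> ?A"
    then have "fst x \<le> snd x" by auto
    note [measurable] = mXX[OF this]
    show "(\<lambda>\<omega>. ennreal (norm (XX \<omega> (fst x) (snd x)) / (snd x - fst x) powr \<beta>)) \<in> borel_measurable M"
      by measurable
  next
    fix \<omega> assume \<omega>: "\<omega> \<in> space M"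
    show "continuous_on ?A (\<lambda>x. ennreal (norm (XX \<omega> (fst x) (snd x)) / (snd x - fst x) powr \<beta>))"
      by (intro continuous_on_ennreal continuous_on_divide continuous_on_norm c2[OF X[OF \<omega>]] cp pp)
  qed
  then show "(\<lambda>\<omega>. holder2 \<beta> a b (XX \<omega>)) \<in> borel_measurable M"
    unfolding holder2_def by (simp only: case_prod_beta')
qed

section \<open>From moments of integer order to real exponents\<close>

lemma borel_measurable_epowr [measurable]: "(\<lambda>x. epowr x p) \<in> borel_measurable borel"
  unfolding epowr_def by measurable

text \<open>Comparison of \<open>x / v\<close> with 1: below, \<open>x powr p\<close> is at most
  \<open>v powr p\<close>; above, the larger exponent \<open>r\<close> dominates. If
  \<open>v\<close> is the natural scale of \<open>x\<close>, both terms have size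
  \<open>v powr p\<close> in the mean.\<close>

lemma epowr_le_moment:
  assumes v: "v > 0" and p: "0 < p" "p \<le> real r"
  shows "epowr x p \<le> ennreal (v powr p) + ennreal (v powr p / v ^ r) * x ^ r"
proof (cases x)
  case (real y)
  have r: "r > 0" using p by (cases r) auto
  have "y powr p \<le> v powr p + v powr p / v ^ r * y ^ r"
  proof (cases "y \<le> v")
    case True
    then have "y powr p \<le> v powr p" using real p by (intro powr_mono2) auto
    moreover have "0 \<le> v powr p / v ^ r * y ^ r" using v real by simp
    ultimately show ?thesis by linarith
  next
    case False
    then have "y / v \<ge> 1" using v by simp
    then have "(y / v) powr p \<le> (y / v) powr real r" using p by (intro powr_mono) auto
    also have "\<dots> = y ^ r / v ^ r" using v False by (simp add: powr_realpow power_divide)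
    finally have "y powr p / v powr p \<le> y ^ r / v ^ r" using v real by (simp add: powr_divide)
    then have "y powr p \<le> v powr p / v ^ r * y ^ r" using v by (simp add: field_simps)
    then show ?thesis using v by (smt (verit) powr_gt_zero)
  qed
  then have "ennreal (y powr p) \<le> ennreal (v powr p + v powr p / v ^ r * y ^ r)" by (rule ennreal_leI)
  also have "\<dots> = ennreal (v powr p) + ennreal (v powr p / v ^ r) * x ^ r"
    using v real by (subst ennreal_plus) (auto simp: ennreal_power ennreal_mult[symmetric])
  finally show ?thesis using real by (simp add: epowr_def)
next
  case top
  have "r > 0" using p by (cases r) auto
  then show ?thesis using top v by (simp add: ennreal_mult_eq_top_iff power_eq_top_ennreal)
qed

text \<open>The bound on the \<open>r\<close>-th moment fixes the scale \<open>v\<close>, so that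
  each of the two terms of \<open>epowr_le_moment\<close> integrates to at most
  \<open>v powr p\<close>. This is Lyapunov's inequality up to a factor 2.\<close>

lemma Lp_from_moment:
  assumes M: "prob_space M" and v: "v > 0" and p: "0 < p" "p \<le> real r"
    and f: "f \<in> borel_measurable M" and le: "(\<integral>\<^sup>+ x. f x ^ r \<partial>M) \<le> ennreal (v ^ r)"
  shows "(\<integral>\<^sup>+ x. epowr (f x) p \<partial>M) \<le> ennreal (2 * v powr p)"
    and "Lp_norm M p f \<le> ennreal (2 powr (1 / p) * v)"
proof -
  interpret prob_space M by (rule M)
  have "(\<integral>\<^sup>+ x. epowr (f x) p \<partial>M) \<le> (\<integral>\<^sup>+ x. ennreal (v powr p) + ennreal (v powr p / v ^ r) * f x ^ r \<partial>M)"
    by (intro nn_integral_mono epowr_le_moment v p)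
  also have "\<dots> = ennreal (v powr p) + ennreal (v powr p / v ^ r) * (\<integral>\<^sup>+ x. f x ^ r \<partial>M)"
    using f by (subst nn_integral_add) (auto simp: nn_integral_cmult emeasure_space_1)
  also have "\<dots> \<le> ennreal (v powr p) + ennreal (v powr p / v ^ r) * ennreal (v ^ r)"
    using le by (intro add_left_mono mult_left_mono) auto
  also have "\<dots> = ennreal (2 * v powr p)"
    using v by (simp add: ennreal_mult[symmetric] ennreal_plus[symmetric] del: ennreal_plus)
  finally show 1: "(\<integral>\<^sup>+ x. epowr (f x) p \<partial>M) \<le> ennreal (2 * v powr p)" .
  then obtain z where z: "(\<integral>\<^sup>+ x. epowr (f x) p \<partial>M) = ennreal z" "0 \<le> z" "z \<le> 2 * v powr p"
    using v by (cases "\<integral>\<^sup>+ x. epowr (f x) p \<partial>M") (auto simp: top_unique)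
  have "z powr (1 / p) \<le> (2 * v powr p) powr (1 / p)" using z p by (intro powr_mono2) auto
  also have "\<dots> = 2 powr (1 / p) * v" using v p by (simp add: powr_mult powr_powr)
  finally show "Lp_norm M p f \<le> ennreal (2 powr (1 / p) * v)"
    unfolding Lp_norm_def z(1) using z by (simp add: epowr_def ennreal_leI)
qed

text \<open>The norm is compared with the distance to the zero rough path. The root on the second
  level is removed by \<open>sqrt x \<le> 1 + x\<close>, which preserves integrability of any
  order.\<close>

lemma rough_norm_le: "rough_norm \<beta> a b (X, XX) \<le> 1 + 2 * rough_dist \<beta> a b (X, XX) (\<lambda>_. 0, \<lambda>_ _. 0)"
proof -
  let ?d = "rough_dist \<beta> a b (X, XX) (\<lambda>_. 0, \<lambda>_ _. 0)"
  have 1: "holder1 \<beta> a b X \<le> ?d" "holder2 (2 * \<beta>) a b XX \<le> ?d"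
    unfolding holder1_def holder2_def rough_dist_def prod.case
    by (rule SUP_mono, force intro!: ennreal_leI)+
  have "epowr x (1 / 2) \<le> 1 + x" for x
    using epowr_le_moment[of 1 "1 / 2" 1 x] by simp
  then have "rough_norm \<beta> a b (X, XX) \<le> ?d + (1 + ?d)"
    unfolding rough_norm_def prod.case using 1
    by (intro add_mono) (auto intro: order_trans add_left_mono)
  then show ?thesis by (simp add: mult_2 ac_simps)
qed

lemma rough_dist_triangle:
  "rough_dist \<beta> a b (X, XX) (Z, ZZ) \<le> rough_dist \<beta> a b (X, XX) (Y, YY) + rough_dist \<beta> a b (Y, YY) (Z, ZZ)"
  unfolding rough_dist_def prod.case
proof (rule SUP_least, clarify)
  fix s t assume st: "a \<le> s" "s < t" "t \<le> b"
  let ?f = "\<lambda>X XX Y YY (s, t). ennreal (norm (X t - X s - Y t + Y s) / (t - s) powr \<beta> + norm (XX s t - YY s t) / (t - s) powr (2 * \<beta>))"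
  have n1: "norm (X t - X s - Z t + Z s) \<le> norm (X t - X s - Y t + Y s) + norm (Y t - Y s - Z t + Z s)"
  proof -
    have "X t - X s - Z t + Z s = (X t - X s - Y t + Y s) + (Y t - Y s - Z t + Z s)" by simp
    then show ?thesis by (simp only: norm_triangle_ineq)
  qed
  have n2: "norm (XX s t - ZZ s t) \<le> norm (XX s t - YY s t) + norm (YY s t - ZZ s t)"
    by (rule order_trans[OF _ norm_triangle_ineq]) simp
  have "?f X XX Z ZZ (s, t) \<le> ?f X XX Y YY (s, t) + ?f Y YY Z ZZ (s, t)"
    unfolding prod.case using divide_right_mono[OF n1, of "(t - s) powr \<beta>"] divide_right_mono[OF n2, of "(t - s) powr (2 * \<beta>)"]
    by (subst ennreal_plus[symmetric]) (auto simp: add_divide_distrib intro!: ennreal_leI simp del: ennreal_plus)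
  also have "\<dots> \<le> (SUP x\<in>{(s, t). a \<le> s \<and> s < t \<and> t \<le> b}. ?f X XX Y YY x) + (SUP x\<in>{(s, t). a \<le> s \<and> s < t \<and> t \<le> b}. ?f Y YY Z ZZ x)"
    by (intro add_mono SUP_upper) (use st in auto)
  finally show "ennreal (norm (X t - X s - Z t + Z s) / (t - s) powr \<beta> + norm (XX s t - ZZ s t) / (t - s) powr (2 * \<beta>)) \<le>
    (SUP (s, t)\<in>{(s, t). a \<le> s \<and> s < t \<and> t \<le> b}. ennreal (norm (X t - X s - Y t + Y s) / (t - s) powr \<beta> + norm (XX s t - YY s t) / (t - s) powr (2 * \<beta>)))
    + (SUP (s, t)\<in>{(s, t). a \<le> s \<and> s < t \<and> t \<le> b}. ennreal (norm (Y t - Y s - Z t + Z s) / (t - s) powr \<beta> + norm (YY s t - ZZ s t) / (t - s) powr (2 * \<beta>)))"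
    by simp
qed

section \<open>The smooth approximation as a rough path\<close>

text \<open>An antiderivative on the whole line, so that oriented integrals with arbitrary end
  points become differences of its values.\<close>

lemma continuous_antiderivative:
  fixes f :: "real \<Rightarrow> 'a::euclidean_space"
  assumes "continuous_on UNIV f"
  shows "\<exists>F. \<forall>x. (F has_vector_derivative f x) (at x)"
proof (intro exI allI)
  fix x :: real
  let ?a = "- \<bar>x\<bar> - 1" and ?b = "\<bar>x\<bar> + 1"
  have "((\<lambda>u. LBINT y=ereal 0..ereal u. f y) has_vector_derivative f x) (at x within {?a..?b})"
    by (rule interval_integral_FTC2) (use assms in \<open>auto intro: continuous_on_subset\<close>)
  moreover have "at x within {?a..?b} = at x" by (rule at_within_interior) (auto simp: abs_if)
  ultimately show "((\<lambda>u. LBINT y=ereal 0..ereal u. f y) has_vector_derivative f x) (at x)" by (simp only:)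
qed

lemma interval_integral_antiderivative:
  fixes f :: "real \<Rightarrow> 'a::euclidean_space" and s t :: real
  assumes "continuous_on UNIV f" "\<And>x. (F has_vector_derivative f x) (at x)"
  shows "(LBINT x=ereal s..ereal t. f x) = F t - F s"
  by (rule interval_integral_FTC_finite)
    (use assms in \<open>auto intro: continuous_on_subset has_vector_derivative_at_within\<close>)

text \<open>On each cell the mean value theorem replaces the integral of \<phi> by a value of \<phi>
  in that cell; comparing it with the value at the left node costs at most \<open>e\<close>.\<close>

lemma riemann_mean:
  fixes \<phi> \<Phi> :: "real \<Rightarrow> real"
  assumes \<Phi>: "\<And>x. (\<Phi> has_real_derivative \<phi> x) (at x)" and \<delta>: "\<delta> > 0" and b: "b > (0::nat)"
    and mod: "\<And>x y. x \<in> {r..r + \<delta>} \<Longrightarrow> y \<in> {r..r + \<delta>} \<Longrightarrow> \<bar>x - y\<bar> \<le> \<delta> / b \<Longrightarrow> \<bar>\<phi> x - \<phi> y\<bar> \<le> e"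
  shows "\<bar>(1 / b) * (\<Sum>l<b. \<phi> (r + real l * (\<delta> / b))) - (\<Phi> (r + \<delta>) - \<Phi> r) / \<delta>\<bar> \<le> e"
proof -
  define \<eta> where "\<eta> = \<delta> / b"
  have \<eta>: "\<eta> > 0" "b * \<eta> = \<delta>" using \<delta> b by (auto simp: \<eta>_def)
  have cell: "\<bar>\<eta> * \<phi> (r + real l * \<eta>) - (\<Phi> (r + Suc l * \<eta>) - \<Phi> (r + real l * \<eta>))\<bar> \<le> \<eta> * e" if l: "l < b" for l
  proof -
    have lt: "r + real l * \<eta> < r + Suc l * \<eta>" using \<eta> by (simp add: algebra_simps)
    obtain z where z: "r + real l * \<eta> < z" "z < r + Suc l * \<eta>"
      "\<Phi> (r + Suc l * \<eta>) - \<Phi> (r + real l * \<eta>) = (r + Suc l * \<eta> - (r + real l * \<eta>)) * \<phi> z"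
      using MVT2[OF lt, of \<Phi> \<phi>] \<Phi> by blast
    have "real (Suc l) * \<eta> \<le> b * \<eta>" using l \<eta> by (intro mult_right_mono) auto
    then have hi: "r + Suc l * \<eta> \<le> r + \<delta>" using \<eta> by simp
    have lo: "r \<le> r + real l * \<eta>" using \<eta> by simp
    have sl: "r + Suc l * \<eta> = r + real l * \<eta> + \<eta>" by (simp add: algebra_simps)
    have "\<bar>\<phi> (r + real l * \<eta>) - \<phi> z\<bar> \<le> e"
    proof (rule mod)
      show "\<bar>r + real l * \<eta> - z\<bar> \<le> \<delta> / real b" using z(1,2) sl unfolding \<eta>_def[symmetric] by linarith
      show "r + real l * \<eta> \<in> {r..r + \<delta>}" "z \<in> {r..r + \<delta>}"
        using z(1,2) lo hi lt unfolding atLeastAtMost_iff by linarith+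
    qed
    moreover have "\<eta> * \<phi> (r + real l * \<eta>) - (\<Phi> (r + Suc l * \<eta>) - \<Phi> (r + real l * \<eta>)) = \<eta> * (\<phi> (r + real l * \<eta>) - \<phi> z)"
      unfolding z(3) by (simp add: algebra_simps)
    ultimately show ?thesis using \<eta> by (simp add: abs_mult)
  qed
  have tele: "(\<Sum>l<b. \<Phi> (r + Suc l * \<eta>) - \<Phi> (r + real l * \<eta>)) = \<Phi> (r + \<delta>) - \<Phi> r"
    using sum_lessThan_telescope[of "\<lambda>l. \<Phi> (r + real l * \<eta>)" b] \<eta> by simp
  have "\<bar>\<eta> * (\<Sum>l<b. \<phi> (r + real l * \<eta>)) - (\<Phi> (r + \<delta>) - \<Phi> r)\<bar>
      = \<bar>\<Sum>l<b. \<eta> * \<phi> (r + real l * \<eta>) - (\<Phi> (r + Suc l * \<eta>) - \<Phi> (r + real l * \<eta>))\<bar>"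
    unfolding tele[symmetric] by (simp add: sum_subtractf sum_distrib_left)
  also have "\<dots> \<le> (\<Sum>l<b. \<eta> * e)"
    by (rule order_trans[OF sum_abs]) (intro sum_mono cell, simp)
  also have "\<dots> = \<delta> * e" using \<eta> by simp
  finally have "\<bar>\<eta> * (\<Sum>l<b. \<phi> (r + real l * \<eta>)) - (\<Phi> (r + \<delta>) - \<Phi> r)\<bar> \<le> \<delta> * e" .
  moreover have "\<eta> * S - D = \<delta> * ((1 / b) * S - D / \<delta>)" for S D
    using \<delta> b by (simp add: \<eta>_def field_simps)
  ultimately show ?thesis using \<delta> by (simp add: abs_mult \<eta>_def[symmetric])
qed

lemma modulus_on_interval:
  fixes \<phi> :: "real \<Rightarrow> real"
  assumes "continuous_on UNIV \<phi>" "e > 0"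
  obtains d where "d > 0" "\<And>x y. x \<in> {A..B} \<Longrightarrow> y \<in> {A..B} \<Longrightarrow> \<bar>x - y\<bar> \<le> d \<Longrightarrow> \<bar>\<phi> x - \<phi> y\<bar> \<le> e"
proof -
  have "uniformly_continuous_on {A..B} \<phi>"
    using assms by (intro compact_uniformly_continuous) (auto intro: continuous_on_subset)
  then obtain d where d: "d > 0" "\<And>x y. x \<in> {A..B} \<Longrightarrow> y \<in> {A..B} \<Longrightarrow> dist y x < d \<Longrightarrow> dist (\<phi> y) (\<phi> x) < e"
    using \<open>e > 0\<close> unfolding uniformly_continuous_on_def by meson
  show thesis
    by (rule that[of "d / 2"]) (use d in \<open>force simp: dist_real_def abs_minus_commute\<close>)+
qed

text \<open>Uniformity in \<open>r\<close> is needed because this mean occurs inside the outer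
  Riemann sum for the area.\<close>

lemma riemann_mean_uniform:
  fixes \<phi> \<Phi> :: "real \<Rightarrow> real" and b :: "nat \<Rightarrow> nat"
  assumes \<Phi>: "\<And>x. (\<Phi> has_real_derivative \<phi> x) (at x)" and \<phi>: "continuous_on UNIV \<phi>" and \<delta>: "\<delta> > 0"
    and b: "filterlim b at_top sequentially" and e: "e > 0"
  shows "\<forall>\<^sub>F N in sequentially. \<forall>r\<in>{A..B}.
    \<bar>(1 / b N) * (\<Sum>l<b N. \<phi> (r + real l * (\<delta> / b N))) - (\<Phi> (r + \<delta>) - \<Phi> r) / \<delta>\<bar> \<le> e"
proof -
  obtain d where d: "d > 0" "\<And>x y. x \<in> {A..B + \<delta>} \<Longrightarrow> y \<in> {A..B + \<delta>} \<Longrightarrow> \<bar>x - y\<bar> \<le> d \<Longrightarrow> \<bar>\<phi> x - \<phi> y\<bar> \<le> e"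
    using modulus_on_interval[OF \<phi> e] by metis
  have "\<forall>\<^sub>F N in sequentially. max 1 (nat \<lceil>\<delta> / d\<rceil>) \<le> b N"
    using b unfolding filterlim_at_top by blast
  then show ?thesis
  proof eventually_elim
    case (elim N)
    then have bN: "b N > 0" "\<delta> / d \<le> b N" by linarith+
    then have bd: "\<delta> / b N \<le> d" using d(1) \<delta> by (simp add: field_simps)
    show ?case
    proof (intro ballI riemann_mean[OF \<Phi> \<delta> bN(1)] d(2))
      show "\<bar>x - y\<bar> \<le> d" if "\<bar>x - y\<bar> \<le> \<delta> / real (b N)" for x y using that bd by linarith
    qed auto
  qed
qed

lemma riemann_mean_tendsto:
  fixes \<phi> \<Phi> :: "real \<Rightarrow> real" and b :: "nat \<Rightarrow> nat"
  assumes \<Phi>: "\<And>x. (\<Phi> has_real_derivative \<phi> x) (at x)" and \<phi>: "continuous_on UNIV \<phi>" and \<delta>: "\<delta> > 0"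
    and b: "filterlim b at_top sequentially"
  shows "(\<lambda>N. (1 / b N) * (\<Sum>l<b N. \<phi> (r + real l * (\<delta> / b N)))) \<longlonglongrightarrow> (\<Phi> (r + \<delta>) - \<Phi> r) / \<delta>"
proof (rule tendstoI)
  fix e :: real assume e: "e > 0"
  then have "\<forall>\<^sub>F N in sequentially. \<forall>x\<in>{r..r}.
    \<bar>(1 / b N) * (\<Sum>l<b N. \<phi> (x + real l * (\<delta> / b N))) - (\<Phi> (x + \<delta>) - \<Phi> x) / \<delta>\<bar> \<le> e / 2"
    by (intro riemann_mean_uniform assms) auto
  then show "\<forall>\<^sub>F N in sequentially. dist ((1 / b N) * (\<Sum>l<b N. \<phi> (r + real l * (\<delta> / b N)))) ((\<Phi> (r + \<delta>) - \<Phi> r) / \<delta>) < e"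
    by eventually_elim (use e in \<open>auto simp: dist_real_def\<close>)
qed

section \<open>Calculus of the approximating path and its area\<close>

lemma has_vector_derivative_component:
  "(F has_vector_derivative f) (at x) \<Longrightarrow> ((\<lambda>t. F t $ i) has_real_derivative f $ i) (at x)"
  for F :: "real \<Rightarrow> real^'n::finite"
  unfolding has_real_derivative_iff_has_vector_derivative
  by (rule bounded_linear.has_vector_derivative[OF bounded_linear_vec_nth])

context
  fixes w :: "real \<Rightarrow> real^'m::finite" and \<delta> :: real
  assumes w: "continuous_on UNIV w" and \<delta>: "\<delta> > 0"
begin

lemma shift_continuous: "continuous_on UNIV (\<lambda>r. w (r + \<delta>))"
  by (rule continuous_on_compose2[OF w]) (auto intro!: continuous_intros)

text \<open>Up to a constant, the approximation at \<open>t\<close> is the mean of \<open>w\<close>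
  over the window from \<open>t\<close> to \<open>t + \<delta>\<close>; this form exhibits it as an
  average of shifts.\<close>

lemma approx_path_antiderivative:
  assumes \<Phi>: "\<And>x. (\<Phi> has_vector_derivative w x) (at x)"
  shows "approx_path \<delta> w t = (1 / \<delta>) *\<^sub>R ((\<Phi> (t + \<delta>) - \<Phi> t) - (\<Phi> \<delta> - \<Phi> 0))"
    and "(approx_path \<delta> w has_vector_derivative (1 / \<delta>) *\<^sub>R (w (t + \<delta>) - w t)) (at t)"
proof -
  have D: "((\<lambda>t. \<Phi> (t + \<delta>) - \<Phi> t) has_vector_derivative w (\<delta> + x) - w x) (at x)" for x
  proof (rule has_vector_derivative_diff[OF _ \<Phi>])
    have "((\<Phi> \<circ> (\<lambda>t. t + \<delta>)) has_vector_derivative 1 *\<^sub>R w (x + \<delta>)) (at x)"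
      by (rule vector_diff_chain_at) (auto intro!: derivative_eq_intros \<Phi>)
    then show "((\<lambda>t. \<Phi> (t + \<delta>)) has_vector_derivative w (\<delta> + x)) (at x)"
      by (simp add: o_def add.commute)
  qed
  have "continuous_on UNIV (\<lambda>r. w (\<delta> + r) - w r)"
    unfolding add.commute[of \<delta>] by (intro continuous_intros shift_continuous w)
  from interval_integral_antiderivative[OF this D, of 0]
  have eq: "approx_path \<delta> w t = (1 / \<delta>) *\<^sub>R ((\<Phi> (t + \<delta>) - \<Phi> t) - (\<Phi> \<delta> - \<Phi> 0))" for t
    unfolding approx_path_def by simp
  then show "approx_path \<delta> w t = (1 / \<delta>) *\<^sub>R ((\<Phi> (t + \<delta>) - \<Phi> t) - (\<Phi> \<delta> - \<Phi> 0))" .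
  have "((\<lambda>t. (1 / \<delta>) *\<^sub>R ((\<Phi> (t + \<delta>) - \<Phi> t) - (\<Phi> \<delta> - \<Phi> 0))) has_vector_derivative
      (1 / \<delta>) *\<^sub>R (w (\<delta> + t) - w t - 0)) (at t)"
    by (intro derivative_intros bounded_linear.has_vector_derivative[OF bounded_linear_scaleR_right] D)
  then show "(approx_path \<delta> w has_vector_derivative (1 / \<delta>) *\<^sub>R (w (t + \<delta>) - w t)) (at t)"
    by (simp add: eq[abs_def] add.commute)
qed

lemma approx_path_component:
  assumes "\<And>x. (\<Phi> has_vector_derivative w x) (at x)"
  shows "approx_path \<delta> w t $ i = (\<Phi> (t + \<delta>) $ i - \<Phi> t $ i) / \<delta> - (\<Phi> \<delta> $ i - \<Phi> 0 $ i) / \<delta>"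
  unfolding approx_path_antiderivative(1)[OF assms] by (simp add: right_diff_distrib diff_divide_distrib)

lemma approx_path_deriv:
  "(approx_path \<delta> w has_vector_derivative (1 / \<delta>) *\<^sub>R (w (t + \<delta>) - w t)) (at t)"
  using continuous_antiderivative[OF w] approx_path_antiderivative(2) by metis

lemma approx_path_continuous: "continuous_on UNIV (approx_path \<delta> w)"
  by (intro continuous_at_imp_continuous_on ballI has_vector_derivative_continuous[OF approx_path_deriv])

text \<open>The increment of the approximation is the mean, over shifts between 0 and \<delta>, of
  the shifted increments of \<open>w\<close>; here the mean is discretized with \<open>b N\<close>
  shifts.\<close>

lemma approx_path_increment_tendsto:
  assumes b: "filterlim b at_top sequentially"
  shows "(\<lambda>N. (1 / real (b N)) * (\<Sum>l<b N. w (t + real l * (\<delta> / b N)) $ i - w (s + real l * (\<delta> / b N)) $ i))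
    \<longlonglongrightarrow> approx_path \<delta> w t $ i - approx_path \<delta> w s $ i"
proof -
  obtain \<Phi> where \<Phi>: "\<And>x. (\<Phi> has_vector_derivative w x) (at x)"
    using continuous_antiderivative[OF w] by auto
  have "(\<lambda>N. (1 / real (b N)) * (\<Sum>l<b N. w (t + real l * (\<delta> / b N)) $ i) - (1 / real (b N)) * (\<Sum>l<b N. w (s + real l * (\<delta> / b N)) $ i))
    \<longlonglongrightarrow> (\<Phi> (t + \<delta>) $ i - \<Phi> t $ i) / \<delta> - (\<Phi> (s + \<delta>) $ i - \<Phi> s $ i) / \<delta>"
    by (intro tendsto_diff riemann_mean_tendsto[where \<phi> = "\<lambda>t. w t $ i"] \<delta> b
        has_vector_derivative_component \<Phi> continuous_intros w)
  also have "(\<Phi> (t + \<delta>) $ i - \<Phi> t $ i) / \<delta> - (\<Phi> (s + \<delta>) $ i - \<Phi> s $ i) / \<delta> = approx_path \<delta> w t $ i - approx_path \<delta> w s $ i"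
    using approx_path_component[OF \<Phi>, of t i] approx_path_component[OF \<Phi>, of s i] by linarith
  finally show ?thesis by (simp add: sum_subtractf right_diff_distrib)
qed

text \<open>The base point \<open>s\<close> enters the area only algebraically, so one
  antiderivative \<open>P\<close> serves all pairs; continuity and Chen's relation are then read off
  from \<open>P\<close>.\<close>

lemma approx_area_antiderivative:
  "\<exists>P. (\<forall>r. (P has_vector_derivative tensor (approx_path \<delta> w r) ((1 / \<delta>) *\<^sub>R (w (r + \<delta>) - w r))) (at r)) \<and>
    (\<forall>s t. approx_area \<delta> w s t = P t - P s - tensor (approx_path \<delta> w s) (approx_path \<delta> w t - approx_path \<delta> w s))"
proof -
  let ?f = "approx_path \<delta> w" and ?g = "\<lambda>r. (1 / \<delta>) *\<^sub>R (w (r + \<delta>) - w r)"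
  have g: "continuous_on UNIV ?g"
    by (intro continuous_intros shift_continuous w)
  have c: "continuous_on UNIV (\<lambda>r. tensor (?f r - y) (?g r))" for y
    by (intro tensor.continuous_on continuous_intros approx_path_continuous g)
  obtain P where P: "\<And>r. (P has_vector_derivative tensor (?f r) (?g r)) (at r)"
    using continuous_antiderivative[OF c[of 0]] by auto
  have "approx_area \<delta> w s t = P t - P s - tensor (?f s) (?f t - ?f s)" for s t
  proof -
    have "((\<lambda>r. P r - tensor (?f s) (?f r)) has_vector_derivative tensor (?f r - ?f s) (?g r)) (at r)" for r
      unfolding tensor.diff_left
      by (intro has_vector_derivative_diff P bounded_linear.has_vector_derivative[OF tensor.bounded_linear_right] approx_path_deriv)
    from interval_integral_antiderivative[OF c this, of s t]
    show ?thesis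
      unfolding approx_area_def vector_derivative_at[OF approx_path_deriv]
      by (simp add: tensor.diff_right)
  qed
  then show ?thesis using P by blast
qed

lemma rough_path_approx: "rough_path (approx_path \<delta> w) (approx_area \<delta> w)"
proof -
  obtain P where P: "\<And>r. (P has_vector_derivative tensor (approx_path \<delta> w r) ((1 / \<delta>) *\<^sub>R (w (r + \<delta>) - w r))) (at r)"
    and eq: "\<And>s t. approx_area \<delta> w s t = P t - P s - tensor (approx_path \<delta> w s) (approx_path \<delta> w t - approx_path \<delta> w s)"
    using approx_area_antiderivative by blast
  have cP: "continuous_on UNIV P"
    by (intro continuous_at_imp_continuous_on ballI has_vector_derivative_continuous[OF P])
  have cA: "continuous_on UNIV (approx_area \<delta> w a)" for a
    unfolding eq[abs_def] by (intro tensor.continuous_on continuous_intros cP approx_path_continuous)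
  show ?thesis
    unfolding rough_path_def
    by (auto intro: approx_path_continuous continuous_on_subset[OF cA])
      (simp add: eq tensor.diff_left tensor.diff_right)
qed

text \<open>Integration by parts: \<open>P $ i $ j + P $ j $ i\<close> and the product of the two
  path components have the same derivative.\<close>

lemma approx_area_parts:
  "approx_area \<delta> w s t $ i $ j + approx_area \<delta> w s t $ j $ i =
    (approx_path \<delta> w t $ i - approx_path \<delta> w s $ i) * (approx_path \<delta> w t $ j - approx_path \<delta> w s $ j)"
proof -
  let ?f = "approx_path \<delta> w" and ?g = "\<lambda>r. (1 / \<delta>) *\<^sub>R (w (r + \<delta>) - w r)"
  obtain P where P: "\<And>r. (P has_vector_derivative tensor (?f r) (?g r)) (at r)"
    and eq: "\<And>s t. approx_area \<delta> w s t = P t - P s - tensor (?f s) (?f t - ?f s)"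
    using approx_area_antiderivative by blast
  have P': "((\<lambda>r. P r $ k $ l) has_real_derivative ?f r $ k * ?g r $ l) (at r)" for k l r
    using bounded_linear.has_vector_derivative[OF bounded_linear_compose[OF bounded_linear_vec_nth bounded_linear_vec_nth] P, of k l r]
    by (simp add: has_real_derivative_iff_has_vector_derivative tensor_def)
  have f': "((\<lambda>r. ?f r $ k) has_real_derivative ?g r $ k) (at r)" for k r
    by (rule has_vector_derivative_component[OF approx_path_deriv])
  have "((\<lambda>r. P r $ i $ j + P r $ j $ i - ?f r $ i * ?f r $ j) has_real_derivative 0) (at r)" for r
    using DERIV_diff[OF DERIV_add[OF P'[of i j r] P'[of j i r]] DERIV_mult[OF f'[of i r] f'[of j r]]]
    by (simp add: algebra_simps)
  then have "P t $ i $ j + P t $ j $ i - ?f t $ i * ?f t $ j = P s $ i $ j + P s $ j $ i - ?f s $ i * ?f s $ j"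
    using DERIV_isconst_all[of "\<lambda>r. P r $ i $ j + P r $ j $ i - ?f r $ i * ?f r $ j"] by blast
  then show ?thesis unfolding eq by (simp add: tensor_def algebra_simps)
qed

text \<open>Here the base point is kept inside the integrand, which is the form to which the lemmas
  on Riemann means apply.\<close>

lemma approx_area_integrand:
  "\<exists>\<Psi>. (\<forall>r. (\<Psi> has_real_derivative (approx_path \<delta> w r $ i - approx_path \<delta> w s $ i) * ((w (r + \<delta>) $ j - w r $ j) / \<delta>)) (at r)) \<and>
    (\<forall>t. approx_area \<delta> w s t $ i $ j = \<Psi> t - \<Psi> s)"
proof -
  let ?f = "approx_path \<delta> w" and ?g = "\<lambda>r. (1 / \<delta>) *\<^sub>R (w (r + \<delta>) - w r)"
  obtain P where P: "\<And>r. (P has_vector_derivative tensor (?f r) (?g r)) (at r)"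
    and eq: "\<And>s t. approx_area \<delta> w s t = P t - P s - tensor (?f s) (?f t - ?f s)"
    using approx_area_antiderivative by blast
  have P': "((\<lambda>r. P r $ i $ j) has_real_derivative ?f r $ i * ?g r $ j) (at r)" for r
    using bounded_linear.has_vector_derivative[OF bounded_linear_compose[OF bounded_linear_vec_nth bounded_linear_vec_nth] P, of i j r]
    by (simp add: has_real_derivative_iff_has_vector_derivative tensor_def)
  have f': "((\<lambda>r. ?f r $ j) has_real_derivative ?g r $ j) (at r)" for r
    by (rule has_vector_derivative_component[OF approx_path_deriv])
  have "((\<lambda>r. P r $ i $ j - ?f s $ i * ?f r $ j) has_real_derivative (?f r $ i - ?f s $ i) * ((w (r + \<delta>) $ j - w r $ j) / \<delta>)) (at r)" for r
    using DERIV_diff[OF P'[of r] DERIV_cmult[OF f'[of r]], of "?f s $ i"]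
    by (simp add: algebra_simps diff_divide_distrib)
  moreover have "approx_area \<delta> w s t $ i $ j = (P t $ i $ j - ?f s $ i * ?f t $ j) - (P s $ i $ j - ?f s $ i * ?f s $ j)" for t
    unfolding eq by (simp add: tensor_def algebra_simps)
  ultimately show ?thesis by blast
qed

lemma approx_integrand_continuous:
  "continuous_on UNIV (\<lambda>r. (approx_path \<delta> w r $ i - approx_path \<delta> w s $ i) * ((w (r + \<delta>) $ j - w r $ j) / \<delta>))"
  using \<delta> by (intro continuous_intros approx_path_continuous w shift_continuous) auto

text \<open>Presents the area as a limit of finite expressions in path values, for the sake of
  measurability.\<close>

lemma approx_area_riemann:
  assumes "s < t"
  shows "(\<lambda>N. (t - s) * ((1 / real (Suc N)) * (\<Sum>k<Suc N. (approx_path \<delta> w (s + real k * ((t - s) / real (Suc N))) $ i - approx_path \<delta> w s $ i) *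
      ((w (s + real k * ((t - s) / real (Suc N)) + \<delta>) $ j - w (s + real k * ((t - s) / real (Suc N))) $ j) / \<delta>))))
    \<longlonglongrightarrow> approx_area \<delta> w s t $ i $ j"
proof -
  obtain \<Psi> where \<Psi>: "\<And>r. (\<Psi> has_real_derivative (approx_path \<delta> w r $ i - approx_path \<delta> w s $ i) * ((w (r + \<delta>) $ j - w r $ j) / \<delta>)) (at r)"
    and eq: "\<And>t. approx_area \<delta> w s t $ i $ j = \<Psi> t - \<Psi> s"
    using approx_area_integrand[of i s j] by blast
  have "filterlim Suc at_top sequentially" by (rule filterlim_Suc)
  from tendsto_mult_left[OF riemann_mean_tendsto[OF \<Psi> approx_integrand_continuous _ this, of "t - s" s], of "t - s"]
  show ?thesis using assms by (simp add: eq)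
qed

text \<open>The outer integral and the window mean inside it are discretized with the same step, so
  that \<open>w\<close> is evaluated only at nodes of one grid. The derivative times the step is
  \<open>1 / b N\<close> times an increment across the window, since
  \<open>\<delta> = b N * \<epsilon> N\<close>.\<close>

lemma approx_area_double_riemann:
  assumes st: "s < t" and \<epsilon>: "\<And>N. \<epsilon> N > (0::real)"
    and a: "\<And>N. t - s = real (a N) * \<epsilon> N" "filterlim a at_top sequentially"
    and b: "\<And>N. \<delta> = real (b N) * \<epsilon> N" "filterlim b at_top sequentially"
  shows "(\<lambda>N. \<Sum>k<a N. (1 / real (b N)) *
        (\<Sum>l<b N. w (s + real (k + l) * \<epsilon> N) $ i - w (s + real l * \<epsilon> N) $ i) *
        ((1 / real (b N)) * (w (s + real (k + b N) * \<epsilon> N) $ j - w (s + real k * \<epsilon> N) $ j)))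
    \<longlonglongrightarrow> approx_area \<delta> w s t $ i $ j"
proof -
  let ?f = "approx_path \<delta> w"
  define g where "g r = (w (r + \<delta>) $ j - w r $ j) / \<delta>" for r
  obtain \<Psi> where \<Psi>0: "\<And>r. (\<Psi> has_real_derivative (?f r $ i - ?f s $ i) * ((w (r + \<delta>) $ j - w r $ j) / \<delta>)) (at r)"
    and eq: "\<And>t. approx_area \<delta> w s t $ i $ j = \<Psi> t - \<Psi> s"
    using approx_area_integrand[of i s j] by blast
  have \<Psi>: "(\<Psi> has_real_derivative (?f r $ i - ?f s $ i) * g r) (at r)" for r
    unfolding g_def by (rule \<Psi>0)
  have h: "t - s > 0" using st by simp
  have cg: "continuous_on UNIV (\<lambda>r. (?f r $ i - ?f s $ i) * g r)"
    unfolding g_def by (rule approx_integrand_continuous)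
  have pos: "real (a N) > 0" "real (b N) > 0" for N
  proof -
    have "0 < real (a N) * \<epsilon> N" using h unfolding a(1)[of N] .
    then show "real (a N) > 0" using \<epsilon>[of N] by (simp add: zero_less_mult_iff)
    have "0 < real (b N) * \<epsilon> N" using \<delta> b(1)[of N] by linarith
    then show "real (b N) > 0" using \<epsilon>[of N] by (simp add: zero_less_mult_iff)
  qed
  have eN: "(t - s) / real (a N) = \<epsilon> N" "\<delta> / real (b N) = \<epsilon> N" for N
  proof -
    show "(t - s) / real (a N) = \<epsilon> N" unfolding a(1)[of N] using pos[of N] by simp
    show "\<delta> / real (b N) = \<epsilon> N" by (subst b(1)[of N]) (use pos[of N] in simp)
  qed
  have lim0: "(\<lambda>N. (t - s) * ((1 / real (a N)) * (\<Sum>k<a N. (?f (s + real k * ((t - s) / real (a N))) $ i - ?f s $ i)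
      * g (s + real k * ((t - s) / real (a N))))))
    \<longlonglongrightarrow> (t - s) * ((\<Psi> (s + (t - s)) - \<Psi> s) / (t - s))"
    by (rule tendsto_mult_left[OF riemann_mean_tendsto[OF \<Psi> cg h a(2)]])
  \<comment> \<open>The outer Riemann sum, still with the exact path increments.\<close>
  have 1: "(\<lambda>N. \<epsilon> N * (\<Sum>k<a N. (?f (s + real k * \<epsilon> N) $ i - ?f s $ i) * g (s + real k * \<epsilon> N)))
    \<longlonglongrightarrow> approx_area \<delta> w s t $ i $ j"
  proof -
    have "(t - s) * ((1 / real (a N)) * S) = \<epsilon> N * S" for N S unfolding eN(1)[symmetric] by simp
    moreover have "(t - s) * ((\<Psi> (s + (t - s)) - \<Psi> s) / (t - s)) = \<Psi> t - \<Psi> s" using h by simp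
    ultimately show ?thesis using lim0 unfolding eq eN(1) by (simp only:)
  qed
  obtain \<Phi> where \<Phi>: "\<And>x. (\<Phi> has_vector_derivative w x) (at x)"
    using continuous_antiderivative[OF w] by auto
  have fm: "?f r $ i - ?f s $ i = (\<Phi> (r + \<delta>) $ i - \<Phi> r $ i) / \<delta> - (\<Phi> (s + \<delta>) $ i - \<Phi> s $ i) / \<delta>" for r
    using approx_path_component[OF \<Phi>, of r i] approx_path_component[OF \<Phi>, of s i] by linarith
  have "continuous_on UNIV g"
    unfolding g_def using \<delta> by (intro continuous_intros shift_continuous w) auto
  then have "compact (g ` {s..t})"
    by (rule compact_continuous_image[OF continuous_on_subset]) auto
  then obtain G where G: "G > 0" "\<And>r. r \<in> {s..t} \<Longrightarrow> \<bar>g r\<bar> \<le> G"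
    using compact_imp_bounded bounded_pos[of "g ` {s..t}"] by auto
  define F where "F N r = (1 / real (b N)) * (\<Sum>l<b N. w (r + real l * \<epsilon> N) $ i - w (s + real l * \<epsilon> N) $ i)" for N r
  \<comment> \<open>Replacing the exact increments by discrete window means changes the sum by a
    null sequence: the error is uniform on the interval, \<open>g\<close> is bounded, and the total
    weight is \<open>t - s\<close>.\<close>
  have 2: "(\<lambda>N. \<epsilon> N * (\<Sum>k<a N. (F N (s + real k * \<epsilon> N) - (?f (s + real k * \<epsilon> N) $ i - ?f s $ i)) * g (s + real k * \<epsilon> N))) \<longlonglongrightarrow> 0"
  proof (rule tendstoI)
    fix x :: real assume x: "x > 0"
    \<comment> \<open>The window means at \<open>r\<close> and at \<open>s\<close> err by at most
      \<open>y\<close> each; with \<open>g\<close> bounded by \<open>G\<close> and total weight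
      \<open>t - s\<close>, the sum errs by at most
      \<open>2 * y * G * (t - s) = x / 2\<close>.\<close>
    define y where "y = x / (4 * G * (t - s))"
    have y: "y > 0" using x G h by (simp add: y_def)
    have "\<forall>\<^sub>F N in sequentially. \<forall>r\<in>{s..t}.
      \<bar>(1 / real (b N)) * (\<Sum>l<b N. w (r + real l * (\<delta> / real (b N))) $ i) - (\<Phi> (r + \<delta>) $ i - \<Phi> r $ i) / \<delta>\<bar> \<le> y"
      by (rule riemann_mean_uniform) (intro has_vector_derivative_component \<Phi> continuous_intros w \<delta> b(2) y)+
    then show "\<forall>\<^sub>F N in sequentially. dist (\<epsilon> N * (\<Sum>k<a N. (F N (s + real k * \<epsilon> N) - (?f (s + real k * \<epsilon> N) $ i - ?f s $ i)) * g (s + real k * \<epsilon> N))) 0 < x"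
    proof eventually_elim
      case (elim N)
      have Fd: "\<bar>F N r - (?f r $ i - ?f s $ i)\<bar> \<le> 2 * y" if r: "r \<in> {s..t}" for r
      proof -
        have ss: "s \<in> {s..t}" using h by simp
        have "F N r - (?f r $ i - ?f s $ i) =
          ((1 / real (b N)) * (\<Sum>l<b N. w (r + real l * (\<delta> / real (b N))) $ i) - (\<Phi> (r + \<delta>) $ i - \<Phi> r $ i) / \<delta>)
          - ((1 / real (b N)) * (\<Sum>l<b N. w (s + real l * (\<delta> / real (b N))) $ i) - (\<Phi> (s + \<delta>) $ i - \<Phi> s $ i) / \<delta>)"
          unfolding F_def fm eN(2) sum_subtractf by (simp add: right_diff_distrib del: of_nat_Suc of_nat_mult)
        then show ?thesis using elim[rule_format, OF r] elim[rule_format, OF ss] by linarith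
      qed
      have rk: "s + real k * \<epsilon> N \<in> {s..t}" if "k < a N" for k
      proof -
        have "real k * \<epsilon> N \<le> real (a N) * \<epsilon> N" using that \<epsilon>[of N] by (intro mult_right_mono) (auto simp del: of_nat_mult mult_Suc_right)
        also have "\<dots> = t - s" by (rule a(1)[symmetric])
        finally show ?thesis using \<epsilon>[of N] by simp
      qed
      have "\<bar>\<epsilon> N * (\<Sum>k<a N. (F N (s + real k * \<epsilon> N) - (?f (s + real k * \<epsilon> N) $ i - ?f s $ i)) * g (s + real k * \<epsilon> N))\<bar>
        \<le> \<epsilon> N * (\<Sum>k<a N. 2 * y * G)"
        unfolding abs_mult using \<epsilon>[of N]
      proof (intro mult_mono order_trans[OF sum_abs] sum_mono)
        fix k assume "k \<in> {..<a N}"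
        then have "s + real k * \<epsilon> N \<in> {s..t}" using rk by auto
        then show "\<bar>(F N (s + real k * \<epsilon> N) - (?f (s + real k * \<epsilon> N) $ i - ?f s $ i)) * g (s + real k * \<epsilon> N)\<bar> \<le> 2 * y * G"
          unfolding abs_mult using Fd G(2) y by (intro mult_mono) auto
      qed auto
      also have "\<dots> = (\<epsilon> N * real (a N)) * (2 * y * G)" by (simp del: of_nat_mult of_nat_Suc mult_Suc_right)
      also have "\<epsilon> N * real (a N) = t - s" by (simp only: a(1)[of N] mult.commute)
      also have "(t - s) * (2 * y * G) = x / 2"
        unfolding y_def using G(1) h by (simp add: divide_simps del: diff_gt_0_iff_gt less_iff_diff_less_0)
      finally show ?case using x by (simp add: dist_real_def)
    qed
  qed
  have "(\<lambda>N. \<epsilon> N * (\<Sum>k<a N. F N (s + real k * \<epsilon> N) * g (s + real k * \<epsilon> N))) \<longlonglongrightarrow> 0 + approx_area \<delta> w s t $ i $ j"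
    using tendsto_add[OF 2 1] by (simp add: sum_subtractf left_diff_distrib right_diff_distrib)
  moreover have "\<epsilon> N * (\<Sum>k<a N. F N (s + real k * \<epsilon> N) * g (s + real k * \<epsilon> N)) =
    (\<Sum>k<a N. (1 / real (b N)) *
        (\<Sum>l<b N. w (s + real (k + l) * \<epsilon> N) $ i - w (s + real l * \<epsilon> N) $ i) *
        ((1 / real (b N)) * (w (s + real (k + b N) * \<epsilon> N) $ j - w (s + real k * \<epsilon> N) $ j)))" for N
  proof -
    have gb: "\<epsilon> N * g r = (1 / real (b N)) * (w (r + \<delta>) $ j - w r $ j)" for r
      unfolding g_def eN(2)[symmetric] using \<delta> pos[of N] by (simp add: field_simps)
    have r: "s + real k * \<epsilon> N + \<delta> = s + real (k + b N) * \<epsilon> N" for k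
    proof -
      show ?thesis by (subst b(1)[of N]) (simp only: of_nat_add distrib_right add.assoc)
    qed
    have "\<epsilon> N * (\<Sum>k<a N. F N (s + real k * \<epsilon> N) * g (s + real k * \<epsilon> N)) = (\<Sum>k<a N. F N (s + real k * \<epsilon> N) * (\<epsilon> N * g (s + real k * \<epsilon> N)))"
      by (simp add: sum_distrib_left mult_ac del: of_nat_Suc)
    moreover have "F N (s + real k * \<epsilon> N) = (1 / real (b N)) *
        (\<Sum>l<b N. w (s + real (k + l) * \<epsilon> N) $ i - w (s + real l * \<epsilon> N) $ i)" for k
      unfolding F_def by (simp only: of_nat_add distrib_right add.assoc)
    ultimately show ?thesis by (simp only: gb r)
  qed
  ultimately show ?thesis by simp
qed

end

section \<open>Gaussian bilinear forms\<close>

lemma convex_on_power_nonneg: "convex_on {0::real..} (\<lambda>x. x ^ n)"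
proof (cases "even n")
  case True
  then show ?thesis by (rule convex_on_subset[OF convex_power_even]) auto
qed (rule convex_power_odd)

text \<open>Jensen's inequality for the weights \<open>w m / W\<close>, applied to
  \<open>W * y m / w m\<close>. An index of weight zero must have \<open>y m = 0\<close>, because
  its quotient counts as zero. Later the weights are the variances of Gaussian summands up to a
  common factor, so that all normalized summands have the same moments.\<close>

lemma power_sum_le_weighted:
  fixes y w :: "'i \<Rightarrow> real"
  assumes J: "finite J" and w: "\<And>m. m \<in> J \<Longrightarrow> w m \<ge> 0" and W: "W = sum w J" "W > 0"
    and y: "\<And>m. m \<in> J \<Longrightarrow> y m \<ge> 0" "\<And>m. m \<in> J \<Longrightarrow> w m = 0 \<Longrightarrow> y m = 0"
  shows "(\<Sum>m\<in>J. y m) ^ Suc n \<le> W ^ n * (\<Sum>m\<in>J. w m * (y m / w m) ^ Suc n)"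
proof -
  have "J \<noteq> {}" using W by auto
  have "(\<Sum>m\<in>J. (w m / W) *\<^sub>R (W * y m / w m)) ^ Suc n \<le> (\<Sum>m\<in>J. (w m / W) * (W * y m / w m) ^ Suc n)"
    by (rule convex_on_sum[OF J \<open>J \<noteq> {}\<close> convex_on_power_nonneg])
      (use W w y in \<open>auto simp: sum_divide_distrib[symmetric]\<close>)
  also have "(\<Sum>m\<in>J. (w m / W) *\<^sub>R (W * y m / w m)) = (\<Sum>m\<in>J. y m)"
    using W y by (intro sum.cong) (auto simp: field_simps)
  also have "(\<Sum>m\<in>J. (w m / W) * (W * y m / w m) ^ Suc n) = (\<Sum>m\<in>J. W ^ n * (w m * (y m / w m) ^ Suc n))"
  proof (rule sum.cong)
    fix m
    have "(W * y m / w m) ^ Suc n = W * W ^ n * (y m / w m) ^ Suc n"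
      by (simp only: times_divide_eq_right[symmetric] power_mult_distrib power_Suc[of W])
    then show "(w m / W) * (W * y m / w m) ^ Suc n = W ^ n * (w m * (y m / w m) ^ Suc n)"
      using W by (simp del: power_Suc)
  qed simp
  finally show ?thesis by (simp only: sum_distrib_left)
qed

lemma mean_power_even:
  fixes y :: "'i \<Rightarrow> real"
  assumes S: "finite S" "S \<noteq> {}"
  shows "((\<Sum>x\<in>S. y x) / real (card S)) ^ (2 * n) \<le> (\<Sum>x\<in>S. y x ^ (2 * n)) / real (card S)"
proof -
  have "(\<Sum>x\<in>S. (1 / real (card S)) *\<^sub>R y x) ^ (2 * n) \<le> (\<Sum>x\<in>S. (1 / real (card S)) * y x ^ (2 * n))"
    by (rule convex_on_sum[OF S convex_power_even]) (use S in auto)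
  then show ?thesis by (simp add: sum_divide_distrib)
qed

lemma power_nonneg_even: "(0::real) \<le> x ^ (2 * n)"
  by (simp add: power_mult)

text \<open>By convexity, averaging costs no constant: a bound valid for every shift passes to the
  average over any number of shifts.\<close>

lemma moment_mean_le:
  fixes y :: "'i \<Rightarrow> 'a \<Rightarrow> real"
  assumes S: "finite S" "S \<noteq> {}" and v: "v \<ge> 0"
    and meas: "\<And>x. x \<in> S \<Longrightarrow> y x \<in> borel_measurable M"
    and le: "\<And>x. x \<in> S \<Longrightarrow> (moment M (2 * n) (y x)) \<le> ennreal v"
  shows "moment M (2 * n) (\<lambda>\<omega>. (\<Sum>x\<in>S. y x \<omega>) / real (card S)) \<le> ennreal v"
proof -
  have c: "card S > 0" using S by (simp add: card_gt_0_iff)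
  have "moment M (2 * n) (\<lambda>\<omega>. (\<Sum>x\<in>S. y x \<omega>) / real (card S)) \<le>
      (\<integral>\<^sup>+ \<omega>. (\<Sum>x\<in>S. ennreal (1 / real (card S)) * ennreal (y x \<omega> ^ (2 * n))) \<partial>M)"
  proof (rule nn_integral_mono)
    fix \<omega>
    have "ennreal (((\<Sum>x\<in>S. y x \<omega>) / real (card S)) ^ (2 * n)) \<le> ennreal (\<Sum>x\<in>S. 1 / real (card S) * y x \<omega> ^ (2 * n))"
      using mean_power_even[OF S, of "\<lambda>x. y x \<omega>" n] by (intro ennreal_leI) (simp add: sum_divide_distrib)
    also have "\<dots> = (\<Sum>x\<in>S. ennreal (1 / real (card S) * y x \<omega> ^ (2 * n)))"
      by (intro sum_ennreal[symmetric] mult_nonneg_nonneg power_nonneg_even) auto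
    also have "\<dots> = (\<Sum>x\<in>S. ennreal (1 / real (card S)) * ennreal (y x \<omega> ^ (2 * n)))"
      by (intro sum.cong refl ennreal_mult power_nonneg_even) auto
    finally show "ennreal (((\<Sum>x\<in>S. y x \<omega>) / real (card S)) ^ (2 * n)) \<le> \<dots>" .
  qed
  also have "\<dots> = (\<Sum>x\<in>S. ennreal (1 / real (card S)) * (moment M (2 * n) (y x)))"
  proof (subst nn_integral_sum)
    show "(\<lambda>\<omega>. ennreal (1 / real (card S)) * ennreal (y x \<omega> ^ (2 * n))) \<in> borel_measurable M" if "x \<in> S" for x
      using meas[OF that] by measurable
    show "(\<Sum>x\<in>S. \<integral>\<^sup>+ \<omega>. ennreal (1 / real (card S)) * ennreal (y x \<omega> ^ (2 * n)) \<partial>M) =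
      (\<Sum>x\<in>S. ennreal (1 / real (card S)) * (moment M (2 * n) (y x)))"
    proof (rule sum.cong[OF refl])
      fix x assume "x \<in> S"
      note [measurable] = meas[OF this]
      show "(\<integral>\<^sup>+ \<omega>. ennreal (1 / real (card S)) * ennreal (y x \<omega> ^ (2 * n)) \<partial>M) =
        ennreal (1 / real (card S)) * (moment M (2 * n) (y x))"
        by (rule nn_integral_cmult) measurable
    qed
  qed
  also have "\<dots> \<le> (\<Sum>x\<in>S. ennreal (1 / real (card S)) * ennreal v)"
    by (intro sum_mono mult_left_mono le) auto
  also have "\<dots> = (\<Sum>x\<in>S. ennreal (1 / real (card S) * v))"
    using v by (intro sum.cong refl ennreal_mult[symmetric]) auto
  also have "\<dots> = ennreal (\<Sum>x\<in>S. 1 / real (card S) * v)"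
    using v by (intro sum_ennreal) simp
  also have "(\<Sum>x\<in>S. 1 / real (card S) * v) = v" using c by simp
  finally show ?thesis .
qed

lemma moment_cmult:
  assumes "f \<in> borel_measurable M"
  shows "moment M (2 * n) (\<lambda>\<omega>. c * f \<omega>) = ennreal (c ^ (2 * n)) * (moment M (2 * n) f)"
proof -
  note [measurable] = assms
  have "moment M (2 * n) (\<lambda>\<omega>. c * f \<omega>) = (\<integral>\<^sup>+ \<omega>. ennreal (c ^ (2 * n)) * ennreal (f \<omega> ^ (2 * n)) \<partial>M)"
    by (simp only: power_mult_distrib ennreal_mult[OF power_nonneg_even power_nonneg_even])
  also have "\<dots> = ennreal (c ^ (2 * n)) * (moment M (2 * n) f)"
    by (rule nn_integral_cmult) measurable
  finally show ?thesis .
qed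

lemma moment_sum_le:
  fixes y :: "'i \<Rightarrow> 'a \<Rightarrow> real"
  assumes S: "finite S" and v: "v \<ge> 0" and n: "n > 0"
    and meas: "\<And>x. x \<in> S \<Longrightarrow> y x \<in> borel_measurable M"
    and le: "\<And>x. x \<in> S \<Longrightarrow> (moment M (2 * n) (y x)) \<le> ennreal v"
  shows "moment M (2 * n) (\<lambda>\<omega>. \<Sum>x\<in>S. y x \<omega>) \<le> ennreal (real (card S) ^ (2 * n) * v)"
proof (cases "S = {}")
  case True
  then show ?thesis using n by (simp add: zero_power)
next
  case False
  then have c: "card S > 0" using S by (simp add: card_gt_0_iff)
  have "moment M (2 * n) (\<lambda>\<omega>. \<Sum>x\<in>S. y x \<omega>) =
      (moment M (2 * n) (\<lambda>\<omega>. real (card S) * ((\<Sum>x\<in>S. y x \<omega>) / real (card S))))"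
    using c by simp
  also have "\<dots> = ennreal (real (card S) ^ (2 * n)) * (moment M (2 * n) (\<lambda>\<omega>. (\<Sum>x\<in>S. y x \<omega>) / real (card S)))"
    by (rule moment_cmult) (intro borel_measurable_divide borel_measurable_sum meas borel_measurable_const)
  also have "\<dots> \<le> ennreal (real (card S) ^ (2 * n)) * ennreal v"
    by (intro mult_left_mono moment_mean_le S False v meas le) auto
  finally show ?thesis using v by (simp add: ennreal_mult)
qed

lemma moment_add_le:
  fixes f g :: "'a \<Rightarrow> real"
  assumes v: "v \<ge> 0" and n: "n > 0" and meas: "f \<in> borel_measurable M" "g \<in> borel_measurable M"
    and le: "moment M (2 * n) f \<le> ennreal v" "moment M (2 * n) g \<le> ennreal v"
  shows "moment M (2 * n) (\<lambda>\<omega>. f \<omega> + g \<omega>) \<le> ennreal (4 ^ n * v)"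
    and "moment M (2 * n) (\<lambda>\<omega>. f \<omega> - g \<omega>) \<le> ennreal (4 ^ n * v)"
proof -
  have *: "moment M (2 * n) (\<lambda>\<omega>. f \<omega> + g \<omega>) \<le> ennreal (4 ^ n * v)"
    if "g \<in> borel_measurable M" "moment M (2 * n) g \<le> ennreal v" for g
    \<comment> \<open>The two summands are indexed by \<open>bool\<close>, and the factor
      \<open>2 ^ (2 * n)\<close> is \<open>4 ^ n\<close>.\<close>
    using moment_sum_le[of "UNIV :: bool set" v n "\<lambda>b. if b then f else g" M] v n meas(1) le(1) that
    by (simp add: UNIV_bool power_mult add.commute)
  show "moment M (2 * n) (\<lambda>\<omega>. f \<omega> + g \<omega>) \<le> ennreal (4 ^ n * v)"
    by (rule *) (use meas le in auto)
  show "moment M (2 * n) (\<lambda>\<omega>. f \<omega> - g \<omega>) \<le> ennreal (4 ^ n * v)"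
    using *[of "\<lambda>\<omega>. - g \<omega>"] meas le by simp
qed

text \<open>The \<open>2 * n\<close>-th moment of a standard normal variable, that is, the product
  of the odd numbers below \<open>2 * n\<close>.\<close>

definition gauss_const :: "nat \<Rightarrow> real"
  where "gauss_const n = fact (2 * n) / (2 ^ n * fact n)"

lemma gauss_const_pos: "gauss_const n > 0"
  by (simp add: gauss_const_def)

section \<open>Moments of Gaussian linear and bilinear forms\<close>

context prob_space
begin

lemma normal_moment:
  assumes X: "distributed M lborel X (normal_density 0 \<sigma>)" and \<sigma>: "\<sigma> > 0"
  shows "moment M (2 * n) X = ennreal (gauss_const n * (\<sigma>\<^sup>2) ^ n)"
proof -
  have "moment M (2 * n) X =
      (\<integral>\<^sup>+ x. ennreal (normal_density 0 \<sigma> x) * ennreal (x ^ (2 * n)) \<partial>lborel)"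
    by (rule distributed_nn_integral[OF X, symmetric]) measurable
  also have "\<dots> = (\<integral>\<^sup>+ x. ennreal (normal_density 0 \<sigma> x * (x - 0) ^ (2 * n)) \<partial>lborel)"
    by (simp only: diff_zero ennreal_mult[OF normal_density_nonneg power_nonneg_even])
  also have "\<dots> = ennreal (fact (2 * n) / ((2 / \<sigma>\<^sup>2) ^ n * fact n))"
    using normal_moment_even[OF \<sigma>, of 0 n]
    by (subst nn_integral_eq_integral)
      (auto simp: has_bochner_integral_iff intro!: AE_I2 mult_nonneg_nonneg power_nonneg_even)
  also have "fact (2 * n) / ((2 / \<sigma>\<^sup>2) ^ n * fact n) = gauss_const n * (\<sigma>\<^sup>2) ^ n"
    using \<sigma> by (simp add: gauss_const_def power_divide)
  finally show ?thesis .
qed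

lemma normal_linear_moment:
  fixes c :: "'i \<Rightarrow> real"
  assumes I: "finite I" and ind: "indep_vars (\<lambda>_. borel) X I"
    and X: "\<And>i. i \<in> I \<Longrightarrow> distributed M lborel (X i) (normal_density 0 \<sigma>)" and \<sigma>: "\<sigma> > 0" and n: "n > 0"
  shows "moment M (2 * n) (\<lambda>\<omega>. \<Sum>i\<in>I. c i * X i \<omega>) =
    ennreal (gauss_const n * (\<sigma>\<^sup>2 * (\<Sum>i\<in>I. (c i)\<^sup>2)) ^ n)"
proof -
  \<comment> \<open>Zero coefficients are removed first, as a normal density needs a positive
    deviation. If no index remains, both sides vanish because \<open>n > 0\<close>.\<close>
  define J where "J = {i \<in> I. c i \<noteq> 0}"
  have J: "finite J" "J \<subseteq> I" using I by (auto simp: J_def)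
  have sums: "(\<Sum>i\<in>I. c i * X i \<omega>) = (\<Sum>i\<in>J. c i * X i \<omega>)" "(\<Sum>i\<in>I. (c i)\<^sup>2) = (\<Sum>i\<in>J. (c i)\<^sup>2)" for \<omega>
    by (rule sum.mono_neutral_right; use I in \<open>auto simp: J_def\<close>)+
  show ?thesis
  proof (cases "J = {}")
    case True
    then show ?thesis unfolding sums using n by (simp add: zero_power)
  next
    case False
    have ind': "indep_vars (\<lambda>_. borel) (\<lambda>i \<omega>. c i * X i \<omega>) J"
      by (rule indep_vars_compose2[OF indep_vars_subset[OF ind J(2)]]) auto
    have "distributed M lborel (\<lambda>\<omega>. \<Sum>i\<in>J. c i * X i \<omega>) (normal_density (\<Sum>i\<in>J. 0) (sqrt (\<Sum>i\<in>J. (\<bar>c i\<bar> * \<sigma>)\<^sup>2)))"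
    proof (rule sum_indep_normal[OF J(1) False ind'])
      show "0 < \<bar>c i\<bar> * \<sigma>" if "i \<in> J" for i using that \<sigma> by (simp add: J_def)
      show "distributed M lborel (\<lambda>\<omega>. c i * X i \<omega>) (normal_density 0 (\<bar>c i\<bar> * \<sigma>))" if "i \<in> J" for i
        using normal_density_affine[OF X \<sigma>, of i "c i" 0] that J(2) by (auto simp: J_def)
    qed
    moreover have pos: "(\<Sum>i\<in>J. (\<bar>c i\<bar> * \<sigma>)\<^sup>2) > 0"
      using False J(1) \<sigma> by (intro sum_pos) (auto simp: J_def)
    moreover have "(\<Sum>i\<in>J. (\<bar>c i\<bar> * \<sigma>)\<^sup>2) = \<sigma>\<^sup>2 * (\<Sum>i\<in>J. (c i)\<^sup>2)"
      by (simp add: power_mult_distrib sum_distrib_left mult.commute)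
    ultimately show ?thesis
      unfolding sums using normal_moment[of "\<lambda>\<omega>. \<Sum>i\<in>J. c i * X i \<omega>" "sqrt (\<sigma>\<^sup>2 * (\<Sum>i\<in>J. (c i)\<^sup>2))" n]
      by simp
  qed
qed

text \<open>Given the first vector, the form is linear in the second and normal, with variance
  proportional to the sum of the squared coefficients, which are linear forms in the first vector.
  Jensen's inequality with the squared row norms as weights reduces the power of this sum to moments
  of single linear forms. Each of the two stages contributes one factor
  \<open>gauss_const n\<close>.\<close>

lemma normal_bilinear_moment:
  fixes A :: "'i \<Rightarrow> 'i \<Rightarrow> real"
  assumes fin: "finite I" "finite J" and disj: "I \<inter> J = {}" and ind: "indep_vars (\<lambda>_. borel) X (I \<union> J)"
    and X: "\<And>i. i \<in> I \<union> J \<Longrightarrow> distributed M lborel (X i) (normal_density 0 \<sigma>)" and \<sigma>: "\<sigma> > 0" and n: "n > 0"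
  shows "moment M (2 * n) (\<lambda>\<omega>. \<Sum>m\<in>J. (\<Sum>k\<in>I. A m k * X k \<omega>) * X m \<omega>) \<le>
    ennreal ((gauss_const n)\<^sup>2 * ((\<sigma>\<^sup>2)\<^sup>2 * (\<Sum>m\<in>J. \<Sum>k\<in>I. (A m k)\<^sup>2)) ^ n)"
proof -
  define U where "U \<omega> = (\<lambda>k\<in>I. X k \<omega>)" for \<omega>
  define V where "V \<omega> = (\<lambda>m\<in>J. X m \<omega>)" for \<omega>
  let ?I = "PiM I (\<lambda>_. borel :: real measure)" and ?J = "PiM J (\<lambda>_. borel :: real measure)"
  define h where "h u v = ennreal ((\<Sum>m\<in>J. (\<Sum>k\<in>I. A m k * u k) * v m) ^ (2 * n))" for u v :: "'i \<Rightarrow> real"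
  have hm [measurable]: "case_prod h \<in> borel_measurable (?I \<Otimes>\<^sub>M ?J)"
    unfolding h_def case_prod_beta' by measurable
  \<comment> \<open>Independence of the two restrictions makes their joint law a product, so
    conditioning becomes an iterated integral.\<close>
  have "indep_var ?I U ?J V"
    unfolding U_def V_def by (rule indep_var_restrict[OF ind disj]) auto
  then have [measurable]: "U \<in> measurable M ?I" "V \<in> measurable M ?J"
    and eq: "distr M ?I U \<Otimes>\<^sub>M distr M ?J V = distr M (?I \<Otimes>\<^sub>M ?J) (\<lambda>\<omega>. (U \<omega>, V \<omega>))"
    unfolding indep_var_distribution_eq by auto
  interpret V: prob_space "distr M ?J V" by (rule prob_space_distr) measurable
  define c where "c = gauss_const n"
  have c: "c > 0" by (simp add: c_def gauss_const_pos)
  define x where "x m \<omega> = (\<Sum>k\<in>I. A m k * X k \<omega>)" for m \<omega>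
  define w where "w m = (\<Sum>k\<in>I. (A m k)\<^sup>2)" for m
  define W where "W = (\<Sum>m\<in>J. w m)"
  have w: "w m \<ge> 0" for m by (simp add: w_def sum_nonneg)
  have W0: "W \<ge> 0" unfolding W_def by (intro sum_nonneg w)
  have Xm [measurable]: "X i \<in> borel_measurable M" if "i \<in> I \<union> J" for i
    using distributed_measurable[OF X[OF that]] by simp
  have xm [measurable]: "x m \<in> borel_measurable M" for m
    unfolding x_def by (intro borel_measurable_sum borel_measurable_times borel_measurable_const Xm) auto
  have "moment M (2 * n) (\<lambda>\<omega>. \<Sum>m\<in>J. x m \<omega> * X m \<omega>) = (\<integral>\<^sup>+ \<omega>. h (U \<omega>) (V \<omega>) \<partial>M)"
    unfolding h_def x_def U_def V_def by (intro nn_integral_cong) (simp cong: sum.cong)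
  also have "\<dots> = (\<integral>\<^sup>+ z. case_prod h z \<partial>distr M (?I \<Otimes>\<^sub>M ?J) (\<lambda>\<omega>. (U \<omega>, V \<omega>)))"
    by (subst nn_integral_distr) auto
  also have "\<dots> = (\<integral>\<^sup>+ z. case_prod h z \<partial>(distr M ?I U \<Otimes>\<^sub>M distr M ?J V))" unfolding eq ..
  also have "\<dots> = (\<integral>\<^sup>+ u. \<integral>\<^sup>+ v. case_prod h (u, v) \<partial>distr M ?J V \<partial>distr M ?I U)"
    by (rule V.nn_integral_fst[symmetric])
      (use hm in \<open>simp add: measurable_cong_sets[OF sets_pair_measure_cong[OF sets_distr sets_distr] refl]\<close>)
  also have "\<dots> = (\<integral>\<^sup>+ u. ennreal (c * (\<sigma>\<^sup>2 * (\<Sum>m\<in>J. (\<Sum>k\<in>I. A m k * u k)\<^sup>2)) ^ n) \<partial>distr M ?I U)"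
  proof (rule nn_integral_cong)
    fix u assume u: "u \<in> space (distr M ?I U)"
    have "(\<integral>\<^sup>+ v. case_prod h (u, v) \<partial>distr M ?J V) = (\<integral>\<^sup>+ \<omega>. h u (V \<omega>) \<partial>M)"
      using u by (subst nn_integral_distr) auto
    also have "\<dots> = (moment M (2 * n) (\<lambda>\<omega>. \<Sum>m\<in>J. (\<Sum>k\<in>I. A m k * u k) * X m \<omega>))"
      unfolding h_def V_def by (intro nn_integral_cong) (simp cong: sum.cong)
    also have "\<dots> = ennreal (c * (\<sigma>\<^sup>2 * (\<Sum>m\<in>J. (\<Sum>k\<in>I. A m k * u k)\<^sup>2)) ^ n)"
      unfolding c_def by (rule normal_linear_moment[OF fin(2) indep_vars_subset[OF ind] X \<sigma> n]) auto
    finally show "(\<integral>\<^sup>+ v. case_prod h (u, v) \<partial>distr M ?J V) = \<dots>" .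
  qed
  also have "\<dots> = (\<integral>\<^sup>+ \<omega>. ennreal (c * (\<sigma>\<^sup>2 * (\<Sum>m\<in>J. (x m \<omega>)\<^sup>2)) ^ n) \<partial>M)"
    unfolding x_def by (subst nn_integral_distr) (auto simp: U_def cong: sum.cong intro!: nn_integral_cong)
  also have "\<dots> \<le> ennreal (c\<^sup>2 * ((\<sigma>\<^sup>2)\<^sup>2 * W) ^ n)"
  proof (cases "W = 0")
    case True
    then have "w m = 0" if "m \<in> J" for m using that w fin(2) by (simp add: W_def sum_nonneg_eq_0_iff)
    then have "A m k = 0" if "m \<in> J" "k \<in> I" for m k using that fin(1) by (simp add: w_def sum_nonneg_eq_0_iff)
    then have "x m \<omega> = 0" if "m \<in> J" for m \<omega> using that by (simp add: x_def)
    then show ?thesis using n True by (simp add: zero_power)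
  next
    case False
    then have W: "W > 0" using W0 by simp
    obtain n' where n': "n = Suc n'" using n gr0_implies_Suc by blast
    \<comment> \<open>\<open>B\<close> collects the factors independent of \<open>m\<close>. The
      quotient \<open>w m / w m ^ n\<close> is the Jensen weight with the normalization pulled out,
      and it is zero when the row vanishes.\<close>
    define B where "B = c * (\<sigma>\<^sup>2) ^ n * W ^ n'"
    have B: "B \<ge> 0" using c W by (simp add: B_def)
    have wm: "w m = 0 \<Longrightarrow> x m \<omega> = 0" for m \<omega> using fin(1) by (simp add: w_def x_def sum_nonneg_eq_0_iff)
    have "c * (\<sigma>\<^sup>2 * (\<Sum>m\<in>J. (x m \<omega>)\<^sup>2)) ^ n \<le> (\<Sum>m\<in>J. (B * (w m / w m ^ n)) * x m \<omega> ^ (2 * n))" for \<omega>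
    proof -
      have "(\<Sum>m\<in>J. (x m \<omega>)\<^sup>2) ^ n \<le> W ^ n' * (\<Sum>m\<in>J. w m * ((x m \<omega>)\<^sup>2 / w m) ^ n)"
        unfolding n' by (rule power_sum_le_weighted[OF fin(2) w W_def W]) (use wm in auto)
      then have "(c * (\<sigma>\<^sup>2) ^ n) * (\<Sum>m\<in>J. (x m \<omega>)\<^sup>2) ^ n \<le> (c * (\<sigma>\<^sup>2) ^ n) * (W ^ n' * (\<Sum>m\<in>J. w m * ((x m \<omega>)\<^sup>2 / w m) ^ n))"
        using c by (intro mult_left_mono) auto
      moreover have "(c * (\<sigma>\<^sup>2) ^ n) * (W ^ n' * (\<Sum>m\<in>J. w m * ((x m \<omega>)\<^sup>2 / w m) ^ n)) =
        (\<Sum>m\<in>J. (B * (w m / w m ^ n)) * x m \<omega> ^ (2 * n))"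
        unfolding sum_distrib_left B_def power_divide power_mult by (intro sum.cong refl) simp
      moreover have "c * (\<sigma>\<^sup>2 * (\<Sum>m\<in>J. (x m \<omega>)\<^sup>2)) ^ n = (c * (\<sigma>\<^sup>2) ^ n) * (\<Sum>m\<in>J. (x m \<omega>)\<^sup>2) ^ n"
        by (simp only: power_mult_distrib mult.assoc)
      ultimately show ?thesis by (simp only:)
    qed
    then have "(\<integral>\<^sup>+ \<omega>. ennreal (c * (\<sigma>\<^sup>2 * (\<Sum>m\<in>J. (x m \<omega>)\<^sup>2)) ^ n) \<partial>M) \<le>
      (\<integral>\<^sup>+ \<omega>. (\<Sum>m\<in>J. ennreal (B * (w m / w m ^ n)) * ennreal (x m \<omega> ^ (2 * n))) \<partial>M)"
    proof (intro nn_integral_mono)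
      fix \<omega>
      assume *: "\<And>\<omega>. c * (\<sigma>\<^sup>2 * (\<Sum>m\<in>J. (x m \<omega>)\<^sup>2)) ^ n \<le> (\<Sum>m\<in>J. (B * (w m / w m ^ n)) * x m \<omega> ^ (2 * n))"
      have nn: "B * (w m / w m ^ n) \<ge> 0" for m using B w[of m] by simp
      have "ennreal (c * (\<sigma>\<^sup>2 * (\<Sum>m\<in>J. (x m \<omega>)\<^sup>2)) ^ n) \<le> ennreal (\<Sum>m\<in>J. (B * (w m / w m ^ n)) * x m \<omega> ^ (2 * n))"
        by (rule ennreal_leI[OF *])
      also have "\<dots> = (\<Sum>m\<in>J. ennreal ((B * (w m / w m ^ n)) * x m \<omega> ^ (2 * n)))"
        by (intro sum_ennreal[symmetric] mult_nonneg_nonneg[OF nn power_nonneg_even])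
      also have "\<dots> = (\<Sum>m\<in>J. ennreal (B * (w m / w m ^ n)) * ennreal (x m \<omega> ^ (2 * n)))"
        by (intro sum.cong refl ennreal_mult[OF nn power_nonneg_even])
      finally show "ennreal (c * (\<sigma>\<^sup>2 * (\<Sum>m\<in>J. (x m \<omega>)\<^sup>2)) ^ n) \<le> \<dots>" .
    qed
    also have "\<dots> = (\<Sum>m\<in>J. ennreal (B * (w m / w m ^ n)) * (moment M (2 * n) (x m)))"
      by (subst nn_integral_sum) (auto simp: nn_integral_cmult)
    also have "\<dots> = (\<Sum>m\<in>J. ennreal (B * (w m / w m ^ n)) * ennreal (c * (\<sigma>\<^sup>2 * w m) ^ n))"
      unfolding x_def w_def c_def
      by (intro sum.cong refl arg_cong2[where f = "(*)"] normal_linear_moment[OF fin(1) indep_vars_subset[OF ind] X \<sigma> n]) auto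
    \<comment> \<open>The powers of \<open>w m\<close> cancel down to a single factor, so that the
      sum over the rows restores \<open>W\<close>.\<close>
    also have "\<dots> = (\<Sum>m\<in>J. ennreal (B * c * (\<sigma>\<^sup>2) ^ n * w m))"
    proof (rule sum.cong[OF refl])
      fix m
      have "ennreal (B * (w m / w m ^ n)) * ennreal (c * (\<sigma>\<^sup>2 * w m) ^ n) = ennreal ((B * (w m / w m ^ n)) * (c * (\<sigma>\<^sup>2 * w m) ^ n))"
        using B c w[of m] by (intro ennreal_mult[symmetric]) auto
      also have "(B * (w m / w m ^ n)) * (c * (\<sigma>\<^sup>2 * w m) ^ n) = B * c * (\<sigma>\<^sup>2) ^ n * w m"
        by (cases "w m = 0") (auto simp: power_mult_distrib)
      finally show "ennreal (B * (w m / w m ^ n)) * ennreal (c * (\<sigma>\<^sup>2 * w m) ^ n) = ennreal (B * c * (\<sigma>\<^sup>2) ^ n * w m)" .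
    qed
    also have "\<dots> = ennreal (\<Sum>m\<in>J. B * c * (\<sigma>\<^sup>2) ^ n * w m)"
      using B c w by (intro sum_ennreal) auto
    also have "(\<Sum>m\<in>J. B * c * (\<sigma>\<^sup>2) ^ n * w m) = c\<^sup>2 * ((\<sigma>\<^sup>2)\<^sup>2 * W) ^ n"
      unfolding sum_distrib_left[symmetric] W_def[symmetric]
      by (simp add: B_def n' power_mult_distrib power2_eq_square mult_ac)
    finally show ?thesis .
  qed
  finally show ?thesis unfolding x_def c_def W_def w_def .
qed

end

section \<open>Moments of Brownian increments\<close>

lemma BM_measurable:
  fixes M :: "(real \<Rightarrow> real^'m::finite) measure"
  assumes "canonical_BM M"
  shows "(\<lambda>\<omega>. \<omega> t) \<in> borel_measurable M" "(\<lambda>\<omega>. \<omega> t $ i) \<in> borel_measurable M"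
proof -
  show 1: "(\<lambda>\<omega>. \<omega> t) \<in> borel_measurable M" using assms by (simp add: canonical_BM_def)
  show "(\<lambda>\<omega>. \<omega> t $ i) \<in> borel_measurable M"
    by (rule measurable_compose[OF 1]) measurable
qed

lemma BM_increment_moment:
  fixes M :: "(real \<Rightarrow> real^'m::finite) measure"
  assumes M: "canonical_BM M" and n: "n > 0"
  shows "moment M (2 * n) (\<lambda>\<omega>. \<omega> t $ i - \<omega> s $ i) = ennreal (gauss_const n * \<bar>t - s\<bar> ^ n)"
proof -
  interpret prob_space M using M by (simp add: canonical_BM_def)
  have *: "moment M (2 * n) (\<lambda>\<omega>. \<omega> t $ i - \<omega> s $ i) = ennreal (gauss_const n * \<bar>t - s\<bar> ^ n)"
    if "s < t" for s t
    using normal_moment[of "\<lambda>\<omega>. \<omega> t $ i - \<omega> s $ i" "sqrt (t - s)" n] M that by (simp add: canonical_BM_def)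
  consider "s < t" | "s = t" | "t < s" by linarith
  then show ?thesis
  proof cases
    case 3
    have "(\<omega> t $ i - \<omega> s $ i) ^ (2 * n) = (\<omega> s $ i - \<omega> t $ i) ^ (2 * n)" for \<omega> :: "real \<Rightarrow> real^'m"
      by (simp add: power_mult power2_commute)
    then show ?thesis using *[OF 3] by (simp add: abs_minus_commute)
  qed (use * n in \<open>auto simp: zero_power\<close>)
qed

text \<open>Different components index disjoint families of increments over the cells, which are the
  two independent vectors. With \<open>\<sigma> = sqrt \<epsilon>\<close> the fourth power of
  \<sigma> becomes the squared step.\<close>

lemma BM_bilinear_moment:
  fixes M :: "(real \<Rightarrow> real^'m::finite) measure" and A :: "nat \<Rightarrow> nat \<Rightarrow> real"
  assumes M: "canonical_BM M" and ij: "i \<noteq> j" and \<epsilon>: "\<epsilon> > 0" and n: "n > 0"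
  shows "moment M (2 * n) (\<lambda>\<omega>. \<Sum>m<N. (\<Sum>k<N. A m k * (\<omega> (s + real (Suc k) * \<epsilon>) $ i - \<omega> (s + real k * \<epsilon>) $ i)) *
      (\<omega> (s + real (Suc m) * \<epsilon>) $ j - \<omega> (s + real m * \<epsilon>) $ j))
    \<le> ennreal ((gauss_const n)\<^sup>2 * (\<epsilon>\<^sup>2 * (\<Sum>m<N. \<Sum>k<N. (A m k)\<^sup>2)) ^ n)"
proof -
  interpret prob_space M using M by (simp add: canonical_BM_def)
  define \<tau> where "\<tau> k = s + real k * \<epsilon>" for k
  have \<tau>: "\<tau> k < \<tau> (Suc k)" "\<tau> (Suc k) - \<tau> k = \<epsilon>" for k
    using \<epsilon> by (auto simp: \<tau>_def algebra_simps)
  define X where "X = (\<lambda>(k, i :: 'm) \<omega> :: real \<Rightarrow> real^'m. \<omega> (\<tau> (Suc k)) $ i - \<omega> (\<tau> k) $ i)"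
  have ind: "indep_vars (\<lambda>_. borel) X ({..<N} \<times> {i} \<union> {..<N} \<times> {j})"
    by (rule indep_vars_subset[of _ _ "{..<N} \<times> UNIV"]) (use M \<tau> in \<open>auto simp: canonical_BM_def X_def\<close>)
  have X: "distributed M lborel (X z) (normal_density 0 (sqrt \<epsilon>))" for z
  proof (cases z)
    case (Pair k l)
    have "distributed M lborel (\<lambda>\<omega>. \<omega> (\<tau> (Suc k)) $ l - \<omega> (\<tau> k) $ l) (normal_density 0 (sqrt (\<tau> (Suc k) - \<tau> k)))"
      using M \<tau>(1)[of k] unfolding canonical_BM_def by blast
    then show ?thesis using Pair by (simp add: X_def \<tau>(2))
  qed
  have "moment M (2 * n) (\<lambda>\<omega>. \<Sum>m\<in>{..<N} \<times> {j}. (\<Sum>k\<in>{..<N} \<times> {i}. A (fst m) (fst k) * X k \<omega>) * X m \<omega>)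
    \<le> ennreal ((gauss_const n)\<^sup>2 * (((sqrt \<epsilon>)\<^sup>2)\<^sup>2 * (\<Sum>m\<in>{..<N} \<times> {j}. \<Sum>k\<in>{..<N} \<times> {i}. (A (fst m) (fst k))\<^sup>2)) ^ n)"
    by (rule normal_bilinear_moment[OF _ _ _ ind X]) (use ij \<epsilon> n in auto)
  moreover have "sum g ({..<N} \<times> {l}) = (\<Sum>m<N. g (m, l))" for g :: "_ \<Rightarrow> real" and l :: 'm
    by (rule sum.reindex_cong[of "\<lambda>m. (m, l)"]) (auto simp: inj_on_def)
  ultimately show ?thesis using \<epsilon> by (simp add: X_def \<tau>_def)
qed

section \<open>Riemann sums on a common grid\<close>

text \<open>Fatou's lemma; almost sure convergence suffices, so a subsequence of Riemann sums is
  enough.\<close>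

lemma moment_limit:
  fixes B :: "nat \<Rightarrow> 'a \<Rightarrow> real" and v :: "nat \<Rightarrow> real"
  assumes meas: "\<And>N. B N \<in> borel_measurable M"
    and lim: "AE \<omega> in M. (\<lambda>N. B N \<omega>) \<longlonglongrightarrow> C \<omega>"
    and le: "\<And>N. (moment M (2 * n) (B N)) \<le> ennreal (v N)" and v: "v \<longlonglongrightarrow> v'"
  shows "moment M (2 * n) C \<le> ennreal v'"
proof -
  note [measurable] = meas
  have "moment M (2 * n) C = (\<integral>\<^sup>+ \<omega>. liminf (\<lambda>N. ennreal (B N \<omega> ^ (2 * n))) \<partial>M)"
  proof (rule nn_integral_cong_AE)
    show "AE \<omega> in M. ennreal (C \<omega> ^ (2 * n)) = liminf (\<lambda>N. ennreal (B N \<omega> ^ (2 * n)))"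
      using lim
    proof eventually_elim
      case (elim \<omega>)
      have "(\<lambda>N. ennreal (B N \<omega> ^ (2 * n))) \<longlonglongrightarrow> ennreal (C \<omega> ^ (2 * n))"
        by (intro tendsto_ennrealI tendsto_power elim)
      from lim_imp_Liminf[OF _ this] show ?case by simp
    qed
  qed
  also have "\<dots> \<le> liminf (\<lambda>N. \<integral>\<^sup>+ \<omega>. ennreal (B N \<omega> ^ (2 * n)) \<partial>M)"
    by (rule nn_integral_liminf) measurable
  also have "\<dots> \<le> liminf (\<lambda>N. ennreal (v N))"
    by (intro Liminf_mono always_eventually allI le)
  also have "\<dots> = ennreal v'"
    by (intro lim_imp_Liminf tendsto_ennrealI v) simp
  finally show ?thesis .
qed

lemma Lp_norm_2_less:
  assumes "Lp_norm M 2 (\<lambda>\<omega>. ennreal \<bar>f \<omega>\<bar>) < ennreal e" "e > 0"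
  shows "(\<integral>\<^sup>+ \<omega>. ennreal ((f \<omega>)\<^sup>2) \<partial>M) < ennreal (e\<^sup>2)"
proof -
  have eq: "(\<integral>\<^sup>+ \<omega>. epowr (ennreal \<bar>f \<omega>\<bar>) 2 \<partial>M) = (\<integral>\<^sup>+ \<omega>. ennreal ((f \<omega>)\<^sup>2) \<partial>M)"
    by (intro nn_integral_cong) (simp add: epowr_def powr_numeral)
  then have less: "epowr (\<integral>\<^sup>+ \<omega>. ennreal ((f \<omega>)\<^sup>2) \<partial>M) (1 / 2) < ennreal e"
    using assms(1) by (simp add: Lp_norm_def)
  then have "(\<integral>\<^sup>+ \<omega>. ennreal ((f \<omega>)\<^sup>2) \<partial>M) \<noteq> \<top>"
    by (auto simp: epowr_def)
  then obtain z where z: "(\<integral>\<^sup>+ \<omega>. ennreal ((f \<omega>)\<^sup>2) \<partial>M) = ennreal z" "z \<ge> 0"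
    by (cases "\<integral>\<^sup>+ \<omega>. ennreal ((f \<omega>)\<^sup>2) \<partial>M") auto
  then have "sqrt z < e"
    using less by (simp add: epowr_def powr_half_sqrt ennreal_less_iff)
  then have "(sqrt z)\<^sup>2 < e\<^sup>2" using z by (intro power_strict_mono) auto
  then show ?thesis using z by (simp add: ennreal_less_iff)
qed

text \<open>Mean-square convergence gives almost sure convergence along a subsequence, and this mode
  can be combined with the pathwise limit for the smooth area.\<close>

lemma L2_mesh_limit_AE:
  fixes M :: "(real \<Rightarrow> real^'m::finite) measure"
  assumes M: "canonical_BM M" and I: "L2_mesh_limit M i j s t I" and st: "s < t"
    and a: "\<And>N. t - s = real (a N) * \<epsilon> N" "filterlim a at_top sequentially" and \<epsilon>: "\<And>N. \<epsilon> N > (0::real)"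
  shows "\<exists>r :: nat \<Rightarrow> nat. filterlim r at_top sequentially \<and>
    (AE \<omega> in M. (\<lambda>N. riemann_sum \<omega> i j (a (r N)) (\<lambda>k. s + real k * \<epsilon> (r N))) \<longlonglongrightarrow> I \<omega>)"
proof -
  let ?R = "\<lambda>N \<omega>. riemann_sum \<omega> i j (a N) (\<lambda>k. s + real k * \<epsilon> N)"
  let ?u = "\<lambda>N \<omega>. (I \<omega> - ?R N \<omega>)\<^sup>2"
  have [measurable]: "I \<in> borel_measurable M" using I by (simp add: L2_mesh_limit_def)
  have [measurable]: "(\<lambda>\<omega>. \<omega> t $ i) \<in> borel_measurable M" for t i by (rule BM_measurable[OF M])
  have [measurable]: "?R N \<in> borel_measurable M" for N unfolding riemann_sum_def by measurable
  have \<epsilon>0: "\<epsilon> \<longlonglongrightarrow> 0"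
  proof -
    have "(\<lambda>N. (t - s) / real (a N)) \<longlonglongrightarrow> 0"
      by (rule tendsto_divide_0[OF tendsto_const])
        (rule filterlim_at_top_imp_at_infinity[OF filterlim_compose[OF filterlim_real_sequentially a(2)]])
    moreover have "(t - s) / real (a N) = \<epsilon> N" for N
    proof -
      have "real (a N) \<noteq> 0"
      proof
        assume "real (a N) = 0"
        then have "t - s = 0 * \<epsilon> N" using a(1)[of N] by (simp only:)
        then show False using st by simp
      qed
      then show ?thesis unfolding a(1)[of N] by simp
    qed
    ultimately show ?thesis by simp
  qed
  have ev: "\<forall>\<^sub>F N in sequentially. (\<integral>\<^sup>+ \<omega>. ennreal (?u N \<omega>) \<partial>M) < ennreal (e\<^sup>2)" if e: "e > 0" for e
  proof -
    obtain \<eta> where \<eta>: "\<eta> > 0" "\<And>n p. grid s t n p \<Longrightarrow> (\<forall>k<n. p (Suc k) - p k < \<eta>) \<Longrightarrow>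
        Lp_norm M 2 (\<lambda>\<omega>. ennreal \<bar>I \<omega> - riemann_sum \<omega> i j n p\<bar>) < ennreal e"
      using I e unfolding L2_mesh_limit_def by blast
    have "\<forall>\<^sub>F N in sequentially. \<epsilon> N < \<eta>" using \<epsilon>0 \<eta>(1) by (rule order_tendstoD)
    then show ?thesis
    proof eventually_elim
      case (elim N)
      have "grid s t (a N) (\<lambda>k. s + real k * \<epsilon> N)"
        using a(1)[of N] \<epsilon>[of N] by (auto simp: grid_def algebra_simps)
      moreover have "\<forall>k<a N. (s + real (Suc k) * \<epsilon> N) - (s + real k * \<epsilon> N) < \<eta>"
        using elim by (simp add: algebra_simps)
      ultimately show ?case by (intro Lp_norm_2_less \<eta>(2) e)
    qed
  qed
  \<comment> \<open>Square integrability of the error is known only once the mesh is fine, so the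
    first \<open>N0\<close> grids are dropped.\<close>
  obtain N0 where N0: "\<And>N. N \<ge> N0 \<Longrightarrow> (\<integral>\<^sup>+ \<omega>. ennreal (?u N \<omega>) \<partial>M) < ennreal (1\<^sup>2)"
    using ev[of 1] by (auto simp: eventually_sequentially)
  have int: "integrable M (?u (N + N0))" for N
  proof (rule integrableI_nonneg)
    show "(\<integral>\<^sup>+ \<omega>. ennreal (?u (N + N0) \<omega>) \<partial>M) < \<infinity>"
      using N0[of "N + N0"] by (simp add: less_top order.strict_trans2[OF _ top_greatest])
  qed auto
  have lim: "(\<lambda>N. \<integral>\<omega>. norm (?u (N + N0) \<omega>) \<partial>M) \<longlonglongrightarrow> 0"
  proof (rule tendstoI)
    fix x :: real assume x: "x > 0"
    have "\<forall>\<^sub>F N in sequentially. (\<integral>\<^sup>+ \<omega>. ennreal (?u (N + N0) \<omega>) \<partial>M) < ennreal ((sqrt x)\<^sup>2)"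
      using ev[of "sqrt x"] x by (subst eventually_sequentially_seg) auto
    then show "\<forall>\<^sub>F N in sequentially. dist (\<integral>\<omega>. norm (?u (N + N0) \<omega>) \<partial>M) 0 < x"
    proof eventually_elim
      case (elim N)
      have "(\<integral>\<^sup>+ \<omega>. ennreal (?u (N + N0) \<omega>) \<partial>M) = ennreal (\<integral>\<omega>. ?u (N + N0) \<omega> \<partial>M)"
        by (rule nn_integral_eq_integral[OF int]) auto
      then have "(\<integral>\<omega>. ?u (N + N0) \<omega> \<partial>M) < x"
        using elim x by (simp add: ennreal_less_iff)
      moreover have "(\<integral>\<omega>. ?u (N + N0) \<omega> \<partial>M) \<ge> 0" by (rule integral_nonneg_AE) auto
      ultimately show ?case by (simp add: dist_real_def)
    qed
  qed
  obtain r where r: "strict_mono r" "AE \<omega> in M. (\<lambda>N. ?u (r N + N0) \<omega>) \<longlonglongrightarrow> 0"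
    using tendsto_L1_AE_subseq[of M "\<lambda>N. ?u (N + N0)", OF int lim] by auto
  show ?thesis
  proof (intro exI[of _ "\<lambda>N. r N + N0"] conjI)
    show "filterlim (\<lambda>N. r N + N0) at_top sequentially"
      by (rule filterlim_at_top_mono[OF filterlim_subseq[OF r(1)]]) auto
    show "AE \<omega> in M. (\<lambda>N. ?R (r N + N0) \<omega>) \<longlonglongrightarrow> I \<omega>"
      using r(2)
    proof eventually_elim
      case (elim \<omega>)
      have "(\<lambda>N. \<bar>I \<omega> - ?R (r N + N0) \<omega>\<bar>) \<longlonglongrightarrow> 0"
        using tendsto_real_sqrt[OF elim] by simp
      then have "(\<lambda>N. I \<omega> - (I \<omega> - ?R (r N + N0) \<omega>)) \<longlonglongrightarrow> I \<omega> - 0"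
        by (intro tendsto_diff tendsto_const) (simp add: tendsto_rabs_zero_iff)
      then show ?case by simp
    qed
  qed
qed

section \<open>The coefficient matrix of the area difference\<close>

lemma sum_indicator_telescope:
  fixes U :: "nat \<Rightarrow> real"
  assumes "l \<le> u" "u \<le> N"
  shows "(\<Sum>k<N. (if l \<le> k \<and> k < u then 1 else 0) * (U (Suc k) - U k)) = U u - U l"
proof -
  have "(\<Sum>k<N. (if l \<le> k \<and> k < u then 1 else 0) * (U (Suc k) - U k)) = (\<Sum>k\<in>{l..<u}. U (Suc k) - U k)"
    using assms by (intro sum.mono_neutral_cong_right) auto
  also have "\<dots> = U u - U l" by (rule sum_Suc_diff'[OF assms(1)])
  finally show ?thesis .
qed

text \<open>Row \<open>m\<close> belongs to the integrator, column \<open>k\<close> to the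
  integrand. The first term is the triangle of the Riemann sum with shifts \<open>l\<close> and
  \<open>l'\<close>, the second that of the unshifted sum. The guard \<open>l' \<le> m\<close>
  protects the subtraction of naturals, and both inner conditions have the shape of
  \<open>sum_indicator_telescope\<close>, the second with lower end 0.\<close>

definition shift_matrix :: "nat \<Rightarrow> nat \<Rightarrow> nat \<Rightarrow> nat \<Rightarrow> nat \<Rightarrow> real"
  where "shift_matrix a l l' m k =
    (if l' \<le> m \<and> m < l' + a then if l \<le> k \<and> k < m - l' + l then 1 else 0 else 0)
    - (if m < a then if 0 \<le> k \<and> k < m then 1 else 0 else 0)"

lemma shift_matrix_form:
  fixes U V :: "nat \<Rightarrow> real"
  assumes l: "l < b" "l' < b"
  shows "(\<Sum>m<a + b. (\<Sum>k<a + b. shift_matrix a l l' m k * (U (Suc k) - U k)) * (V (Suc m) - V m)) =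
    (\<Sum>k<a. (U (k + l) - U l) * (V (Suc (k + l')) - V (k + l'))) - (\<Sum>k<a. (U k - U 0) * (V (Suc k) - V k))"
proof -
  let ?N = "a + b"
  have row: "(\<Sum>k<?N. shift_matrix a l l' m k * (U (Suc k) - U k)) =
      (if l' \<le> m \<and> m < l' + a then U (m - l' + l) - U l else 0) - (if m < a then U m - U 0 else 0)" for m
  proof -
    have 1: "(\<Sum>k<?N. (if l' \<le> m \<and> m < l' + a then if l \<le> k \<and> k < m - l' + l then 1 else 0 else 0) * (U (Suc k) - U k))
      = (if l' \<le> m \<and> m < l' + a then U (m - l' + l) - U l else 0)"
      using sum_indicator_telescope[of l "m - l' + l" ?N U] l by auto
    have 2: "(\<Sum>k<?N. (if m < a then if 0 \<le> k \<and> k < m then 1 else 0 else 0) * (U (Suc k) - U k))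
      = (if m < a then U m - U 0 else 0)"
      using sum_indicator_telescope[of 0 m ?N U] l by auto
    show ?thesis unfolding shift_matrix_def left_diff_distrib sum_subtractf 1 2 ..
  qed
  have 3: "(\<Sum>m<?N. (if l' \<le> m \<and> m < l' + a then U (m - l' + l) - U l else 0) * (V (Suc m) - V m)) =
    (\<Sum>k<a. (U (k + l) - U l) * (V (Suc (k + l')) - V (k + l')))"
  proof -
    have "(\<Sum>m<?N. (if l' \<le> m \<and> m < l' + a then U (m - l' + l) - U l else 0) * (V (Suc m) - V m)) =
      (\<Sum>m\<in>{l'..<l' + a}. (U (m - l' + l) - U l) * (V (Suc m) - V m))"
      using l by (intro sum.mono_neutral_cong_right) auto
    also have "\<dots> = (\<Sum>k<a. (U (k + l) - U l) * (V (Suc (k + l')) - V (k + l')))"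
      by (rule sum.reindex_bij_witness[of _ "\<lambda>k. k + l'" "\<lambda>m. m - l'"]) auto
    finally show ?thesis .
  qed
  have 4: "(\<Sum>m<?N. (if m < a then U m - U 0 else 0) * (V (Suc m) - V m)) = (\<Sum>k<a. (U k - U 0) * (V (Suc k) - V k))"
    by (rule sum.mono_neutral_cong_right) auto
  show ?thesis unfolding row left_diff_distrib sum_subtractf 3 4 ..
qed

text \<open>Entries are -1, 0 or 1, so the sum counts the cells where the two triangles disagree. If
  \<open>a \<le> b\<close>, each triangle has at most \<open>a * a\<close> cells. Otherwise a row
  with \<open>m < a\<close> disagrees in at most \<open>3 * b\<close> cells, near its two ends, and
  each of the \<open>b\<close> remaining rows contains at most \<open>a\<close> cells; the total is
  \<open>3 * a * b + a * b\<close>.\<close>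

lemma shift_matrix_bound:
  assumes l: "l < b" "l' < b"
  shows "(\<Sum>m<a + b. \<Sum>k<a + b. (shift_matrix a l l' m k)\<^sup>2) \<le> 4 * (real a * real (min a b))"
proof -
  let ?N = "a + b"
  define P where "P m = {k. l' \<le> m \<and> m < l' + a \<and> l \<le> k \<and> k < m - l' + l}" for m
  define Q where "Q m = {k. m < a \<and> k < m}" for m
  have cP: "finite (P m)" "card (P m) \<le> (if m \<in> {l'..<l' + a} then a else 0)" for m
  proof -
    have P: "P m = (if m \<in> {l'..<l' + a} then {l..<m - l' + l} else {})" by (auto simp: P_def)
    show "finite (P m)" unfolding P by simp
    show "card (P m) \<le> (if m \<in> {l'..<l' + a} then a else 0)" unfolding P by auto
  qed
  have cQ: "finite (Q m)" "card (Q m) \<le> (if m \<in> {..<a} then a else 0)" for m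
  proof -
    have Q: "Q m = (if m \<in> {..<a} then {..<m} else {})" by (auto simp: Q_def)
    show "finite (Q m)" unfolding Q by simp
    show "card (Q m) \<le> (if m \<in> {..<a} then a else 0)" unfolding Q by auto
  qed
  have ind: "(\<Sum>k<?N. if k \<in> S then 1 else 0) \<le> real (card S)" if "finite S" for S
  proof -
    have "(\<Sum>k<?N. if k \<in> S then 1 else 0) = real (card ({..<?N} \<inter> S))"
      by (subst sum.inter_restrict[symmetric]) auto
    also have "\<dots> \<le> real (card S)" using that by (intro of_nat_mono card_mono) auto
    finally show ?thesis .
  qed
  have sm: "shift_matrix a l l' m k = (if k \<in> P m then 1 else 0) - (if k \<in> Q m then 1 else 0)" for m k
    by (simp add: shift_matrix_def P_def Q_def)
  have "(shift_matrix a l l' m k)\<^sup>2 = (if k \<in> (P m - Q m) \<union> (Q m - P m) then 1 else 0)" for m k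
    unfolding sm by (cases "k \<in> P m"; cases "k \<in> Q m") simp_all
  then have row: "(\<Sum>k<?N. (shift_matrix a l l' m k)\<^sup>2) \<le> real (card ((P m - Q m) \<union> (Q m - P m)))" for m
    using ind[of "(P m - Q m) \<union> (Q m - P m)"] cP(1) cQ(1) by simp
  show ?thesis
  proof (cases "a \<le> b")
    case True
    have "(\<Sum>k<?N. (shift_matrix a l l' m k)\<^sup>2) \<le> (if m \<in> {l'..<l' + a} then real a else 0) + (if m \<in> {..<a} then real a else 0)" for m
    proof -
      have "card ((P m - Q m) \<union> (Q m - P m)) \<le> card (P m \<union> Q m)"
        using cP cQ by (intro card_mono) auto
      also have "\<dots> \<le> card (P m) + card (Q m)" by (rule card_Un_le)
      also have "\<dots> \<le> (if m \<in> {l'..<l' + a} then a else 0) + (if m \<in> {..<a} then a else 0)"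
        by (intro add_mono cP cQ)
      finally have "real (card ((P m - Q m) \<union> (Q m - P m))) \<le> real ((if m \<in> {l'..<l' + a} then a else 0) + (if m \<in> {..<a} then a else 0))"
        by (rule of_nat_mono)
      also have "\<dots> = (if m \<in> {l'..<l' + a} then real a else 0) + (if m \<in> {..<a} then real a else 0)" by simp
      finally show ?thesis using row[of m] by linarith
    qed
    then have "(\<Sum>m<?N. \<Sum>k<?N. (shift_matrix a l l' m k)\<^sup>2) \<le> (\<Sum>m<?N. (if m \<in> {l'..<l' + a} then real a else 0) + (if m \<in> {..<a} then real a else 0))"
      by (intro sum_mono)
    also have "\<dots> = real (card ({..<?N} \<inter> {l'..<l' + a})) * real a + real (card ({..<?N} \<inter> {..<a})) * real a"
      by (simp add: sum.distrib sum.If_cases Int_def)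
    also have "\<dots> \<le> real a * real a + real a * real a"
      using card_mono[of "{l'..<l' + a}" "{..<?N} \<inter> {l'..<l' + a}"] card_mono[of "{..<a}" "{..<?N} \<inter> {..<a}"]
      by (intro add_mono mult_right_mono) auto
    finally have "(\<Sum>m<?N. \<Sum>k<?N. (shift_matrix a l l' m k)\<^sup>2) \<le> 2 * (real a * real a)" by simp
    moreover have "0 \<le> real a * real a" by simp
    ultimately have "(\<Sum>m<?N. \<Sum>k<?N. (shift_matrix a l l' m k)\<^sup>2) \<le> 4 * (real a * real a)" by linarith
    then show ?thesis using True by (simp add: min_def)
  next
    case False
    have "(\<Sum>k<?N. (shift_matrix a l l' m k)\<^sup>2) \<le> (if m < a then 3 * real b else real a)" for m
    proof (cases "m < a")
      case True
      \<comment> \<open>The two rows start at \<open>l\<close> and at 0 and end at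
        \<open>m - l' + l\<close> and at \<open>m\<close>, hence differ only near 0 and near
        \<open>m\<close>. For \<open>m < l'\<close> the first row is empty and the second lies below
        \<open>b\<close>.\<close>
      have "(P m - Q m) \<union> (Q m - P m) \<subseteq> {..<b} \<union> {m - b..<m + b}"
        using l True by (auto simp: P_def Q_def)
      then have "card ((P m - Q m) \<union> (Q m - P m)) \<le> card ({..<b} \<union> {m - b..<m + b})"
        by (intro card_mono) auto
      also have "\<dots> \<le> card {..<b} + card {m - b..<m + b}" by (rule card_Un_le)
      also have "\<dots> \<le> 3 * b" by auto
      finally have "real (card ((P m - Q m) \<union> (Q m - P m))) \<le> real (3 * b)" by (rule of_nat_mono)
      then show ?thesis using True row[of m] by simp
    next
      case m: False
      then have "Q m = {}" by (simp add: Q_def)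
      then have "card ((P m - Q m) \<union> (Q m - P m)) \<le> a"
        using cP(2)[of m] by (auto split: if_splits)
      then show ?thesis using row[of m] m by simp
    qed
    then have "(\<Sum>m<?N. \<Sum>k<?N. (shift_matrix a l l' m k)\<^sup>2) \<le> (\<Sum>m<?N. if m < a then 3 * real b else real a)"
      by (intro sum_mono)
    also have "\<dots> = 3 * real a * real b + real a * real b"
    proof -
      have "{..<?N} \<inter> {m. m < a} = {..<a}" "{..<?N} \<inter> - {m. m < a} = {a..<?N}" by auto
      then show ?thesis by (simp add: sum.If_cases)
    qed
    finally show ?thesis using False by (simp add: min_def)
  qed
qed

text \<open>Telescoping the window increment \<open>V (k + b) - V k\<close> into \<open>b\<close>
  elementary ones produces the second shift; \<open>R\<close> is the same for all pairs of shifts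
  and can be moved under the average.\<close>

lemma double_average_form:
  fixes U V :: "nat \<Rightarrow> real"
  assumes b: "b > 0"
  shows "(\<Sum>k<a. (1 / real b) * (\<Sum>l<b. U (k + l) - U l) * ((1 / real b) * (V (k + b) - V k))) - R =
    (\<Sum>z\<in>{..<b} \<times> {..<b}. (\<Sum>k<a. (U (k + fst z) - U (fst z)) * (V (Suc (k + snd z)) - V (k + snd z))) - R)
      / real (card ({..<b} \<times> {..<b}))"
proof -
  have tele: "V (k + b) - V k = (\<Sum>l'<b. V (Suc (k + l')) - V (k + l'))" for k
    using sum_lessThan_telescope[of "\<lambda>l. V (k + l)" b] by simp
  have "(1 / real b) * (\<Sum>l<b. U (k + l) - U l) * ((1 / real b) * (V (k + b) - V k)) =
    (1 / (real b)\<^sup>2) * (\<Sum>z\<in>{..<b} \<times> {..<b}. (U (k + fst z) - U (fst z)) * (V (Suc (k + snd z)) - V (k + snd z)))" for k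
  proof -
    have "(\<Sum>l<b. U (k + l) - U l) * (V (k + b) - V k) =
      (\<Sum>z\<in>{..<b} \<times> {..<b}. (U (k + fst z) - U (fst z)) * (V (Suc (k + snd z)) - V (k + snd z)))"
      unfolding tele sum_product sum.cartesian_product case_prod_beta' ..
    moreover have "(1 / real b) * x * ((1 / real b) * y) = (1 / (real b)\<^sup>2) * (x * y)" for x y :: real
      by (simp add: power2_eq_square)
    ultimately show ?thesis by (simp only:)
  qed
  then have "(\<Sum>k<a. (1 / real b) * (\<Sum>l<b. U (k + l) - U l) * ((1 / real b) * (V (k + b) - V k))) =
    (1 / (real b)\<^sup>2) * (\<Sum>z\<in>{..<b} \<times> {..<b}. \<Sum>k<a. (U (k + fst z) - U (fst z)) * (V (Suc (k + snd z)) - V (k + snd z)))"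
    by (subst sum.swap) (simp only: sum_distrib_left)
  then show ?thesis using b
    by (simp add: sum_subtractf diff_divide_distrib power2_eq_square)
qed

section \<open>From components to norms; the Brownian rough path\<close>

lemma borel_measurable_matrix:
  fixes f :: "'a \<Rightarrow> real^'n::finite^'m::finite"
  assumes "\<And>i j. (\<lambda>\<omega>. f \<omega> $ i $ j) \<in> borel_measurable M"
  shows "f \<in> borel_measurable M"
  by (subst borel_measurable_euclidean_space) (use assms in \<open>auto simp: Basis_vec_def inner_axis\<close>)

lemma borel_measurable_vector:
  fixes f :: "'a \<Rightarrow> real^'n::finite"
  assumes "\<And>i. (\<lambda>\<omega>. f \<omega> $ i) \<in> borel_measurable M"
  shows "f \<in> borel_measurable M"
  by (subst borel_measurable_euclidean_space) (use assms in \<open>auto simp: Basis_vec_def inner_axis\<close>)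

text \<open>A product is controlled by moments of twice the order through Young's inequality, with
  weights balanced so that each square contributes \<open>u * v / 2\<close>.\<close>

lemma moment_mult_le:
  fixes f g :: "'a \<Rightarrow> real"
  assumes meas: "f \<in> borel_measurable M" "g \<in> borel_measurable M" and uv: "u > 0" "v > 0"
    and le: "moment M (2 * (2 * n)) f \<le> ennreal (u\<^sup>2)"
      "moment M (2 * (2 * n)) g \<le> ennreal (v\<^sup>2)"
  shows "moment M (2 * n) (\<lambda>\<omega>. f \<omega> * g \<omega>) \<le> ennreal (u * v)"
proof -
  note [measurable] = meas
  have pt: "(f \<omega> * g \<omega>) ^ (2 * n) \<le> v / (2 * u) * f \<omega> ^ (2 * (2 * n)) + u / (2 * v) * g \<omega> ^ (2 * (2 * n))" for \<omega>
  proof -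
    define x y where "x = f \<omega> ^ (2 * n)" and "y = g \<omega> ^ (2 * n)"
    have "0 \<le> (v * x - u * y)\<^sup>2 / (2 * u * v)" using uv by simp
    also have "\<dots> = v / (2 * u) * x\<^sup>2 + u / (2 * v) * y\<^sup>2 - x * y"
      using uv by (simp add: power2_eq_square field_simps)
    finally have "x * y \<le> v / (2 * u) * x\<^sup>2 + u / (2 * v) * y\<^sup>2" by simp
    moreover have "x\<^sup>2 = f \<omega> ^ (2 * (2 * n))" "y\<^sup>2 = g \<omega> ^ (2 * (2 * n))"
      by (simp_all only: x_def y_def power_mult[symmetric] mult.commute[of 2])
    ultimately show ?thesis by (simp only: power_mult_distrib x_def y_def)
  qed
  have "moment M (2 * n) (\<lambda>\<omega>. f \<omega> * g \<omega>) \<le>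
    (\<integral>\<^sup>+ \<omega>. ennreal (v / (2 * u)) * ennreal (f \<omega> ^ (2 * (2 * n))) + ennreal (u / (2 * v)) * ennreal (g \<omega> ^ (2 * (2 * n))) \<partial>M)"
  proof (rule nn_integral_mono)
    fix \<omega>
    have p: "v / (2 * u) \<ge> 0" "u / (2 * v) \<ge> 0" using uv by auto
    have "ennreal ((f \<omega> * g \<omega>) ^ (2 * n)) \<le> ennreal (v / (2 * u) * f \<omega> ^ (2 * (2 * n)) + u / (2 * v) * g \<omega> ^ (2 * (2 * n)))"
      by (rule ennreal_leI[OF pt])
    also have "\<dots> = ennreal (v / (2 * u)) * ennreal (f \<omega> ^ (2 * (2 * n))) + ennreal (u / (2 * v)) * ennreal (g \<omega> ^ (2 * (2 * n)))"
      using ennreal_mult[OF p(1) power_nonneg_even[of "f \<omega>" "2 * n"]] ennreal_mult[OF p(2) power_nonneg_even[of "g \<omega>" "2 * n"]]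
        ennreal_plus[OF mult_nonneg_nonneg[OF p(1) power_nonneg_even[of "f \<omega>" "2 * n"]] mult_nonneg_nonneg[OF p(2) power_nonneg_even[of "g \<omega>" "2 * n"]]]
      by (simp only:)
    finally show "ennreal ((f \<omega> * g \<omega>) ^ (2 * n)) \<le> \<dots>" .
  qed
  also have "\<dots> = ennreal (v / (2 * u)) * (moment M (2 * (2 * n)) f) + ennreal (u / (2 * v)) * (moment M (2 * (2 * n)) g)"
    by (subst nn_integral_add) (auto simp: nn_integral_cmult)
  also have "\<dots> \<le> ennreal (v / (2 * u)) * ennreal (u\<^sup>2) + ennreal (u / (2 * v)) * ennreal (v\<^sup>2)"
    by (intro add_mono mult_left_mono le) auto
  also have "\<dots> = ennreal (v / (2 * u) * u\<^sup>2 + u / (2 * v) * v\<^sup>2)"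
    using uv by (simp add: ennreal_mult[symmetric] ennreal_plus[symmetric] del: ennreal_plus)
  also have "v / (2 * u) * u\<^sup>2 + u / (2 * v) * v\<^sup>2 = u * v"
    using uv by (simp add: power2_eq_square field_simps)
  finally show ?thesis .
qed

lemma moment_vector_norm:
  fixes f :: "'a \<Rightarrow> real^'m::finite"
  assumes n: "n > 0" and v: "v \<ge> 0" and meas: "\<And>i. (\<lambda>\<omega>. f \<omega> $ i) \<in> borel_measurable M"
    and le: "\<And>i. (moment M (2 * n) (\<lambda>\<omega>. f \<omega> $ i)) \<le> ennreal v"
  shows "moment M (2 * n) (\<lambda>\<omega>. norm (f \<omega>)) \<le> ennreal (real CARD('m) ^ (2 * n) * v)"
proof -
  have "moment M (2 * n) (\<lambda>\<omega>. norm (f \<omega>)) \<le> (moment M (2 * n) (\<lambda>\<omega>. \<Sum>i\<in>UNIV. \<bar>f \<omega> $ i\<bar>))"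
    by (intro nn_integral_mono ennreal_leI power_mono norm_le_l1_cart norm_ge_zero)
  also have "\<dots> \<le> ennreal (real CARD('m) ^ (2 * n) * v)"
    by (rule moment_sum_le) (use n v meas le in \<open>auto simp: power_mult\<close>)
  finally show ?thesis .
qed

lemma moment_matrix_norm:
  fixes f :: "'a \<Rightarrow> real^'m::finite^'m"
  assumes n: "n > 0" and v: "v \<ge> 0" and meas: "\<And>i j. (\<lambda>\<omega>. f \<omega> $ i $ j) \<in> borel_measurable M"
    and le: "\<And>i j. (moment M (2 * n) (\<lambda>\<omega>. f \<omega> $ i $ j)) \<le> ennreal v"
  shows "moment M (2 * n) (\<lambda>\<omega>. norm (f \<omega>)) \<le> ennreal ((real CARD('m))\<^sup>2 ^ (2 * n) * v)"
proof -
  have "norm A \<le> (\<Sum>z\<in>UNIV. \<bar>A $ fst z $ snd z\<bar>)" for A :: "real^'m^'m"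
  proof -
    have "norm A \<le> (\<Sum>i\<in>UNIV. norm (A $ i))" unfolding norm_vec_def by (rule L2_set_le_sum) simp
    also have "\<dots> \<le> (\<Sum>i\<in>UNIV. \<Sum>j\<in>UNIV. \<bar>A $ i $ j\<bar>)" by (intro sum_mono norm_le_l1_cart)
    also have "\<dots> = (\<Sum>z\<in>UNIV. \<bar>A $ fst z $ snd z\<bar>)"
      by (simp add: sum.cartesian_product case_prod_beta flip: UNIV_Times_UNIV)
    finally show ?thesis .
  qed
  then have "moment M (2 * n) (\<lambda>\<omega>. norm (f \<omega>)) \<le> (moment M (2 * n) (\<lambda>\<omega>. \<Sum>z\<in>UNIV. \<bar>f \<omega> $ fst z $ snd z\<bar>))"
    by (intro nn_integral_mono ennreal_leI power_mono norm_ge_zero)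
  also have "\<dots> \<le> ennreal (real CARD('m \<times> 'm) ^ (2 * n) * v)"
    by (rule moment_sum_le) (use n v meas le in \<open>auto simp: power_mult\<close>)
  finally show ?thesis by (simp add: power2_eq_square)
qed

text \<open>Only the components above the diagonal need a probabilistic estimate; the others follow from
  the symmetric part of the area, which is a product of increments.\<close>

lemma area_moment_all_components:
  fixes D :: "'a \<Rightarrow> real^'m::{finite,linorder}^'m::{finite,linorder}" and Z Y :: "'a \<Rightarrow> real^'m::{finite,linorder}"
  assumes n: "n > 0" and mh: "0 < m" "m \<le> h" and AB: "A > 0" "B \<ge> 0"
    and mZ: "\<And>i. (\<lambda>\<omega>. Z \<omega> $ i) \<in> borel_measurable M" and mY: "\<And>i. (\<lambda>\<omega>. Y \<omega> $ i) \<in> borel_measurable M"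
    and mD: "\<And>i j. (\<lambda>\<omega>. D \<omega> $ i $ j) \<in> borel_measurable M"
    and sym: "\<And>\<omega> i j. \<omega> \<in> space M \<Longrightarrow>
      D \<omega> $ i $ j + D \<omega> $ j $ i = Z \<omega> $ i * Z \<omega> $ j + Z \<omega> $ i * Y \<omega> $ j + Y \<omega> $ i * Z \<omega> $ j"
    and Z: "\<And>i. (moment M (2 * (2 * n)) (\<lambda>\<omega>. Z \<omega> $ i)) \<le> ennreal (A * m ^ (2 * n))"
    and Y: "\<And>i. (moment M (2 * (2 * n)) (\<lambda>\<omega>. Y \<omega> $ i)) \<le> ennreal (A * h ^ (2 * n))"
    and D: "\<And>i j. i < j \<Longrightarrow> (moment M (2 * n) (\<lambda>\<omega>. D \<omega> $ i $ j)) \<le> ennreal (B * (h * m) ^ n)"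
  shows "moment M (2 * n) (\<lambda>\<omega>. D \<omega> $ i $ j) \<le> ennreal (4 ^ n * (16 ^ n * A + B) * (h * m) ^ n)"
proof -
  note [measurable] = mZ mY mD
  define K where "K = A * (h * m) ^ n"
  have h: "h > 0" using mh by simp
  have K: "K > 0" using AB mh h by (simp add: K_def)
  \<comment> \<open>The product of increments of \<open>Y + Z\<close> minus that of
    \<open>Y\<close>. Each summand contains \<open>Z\<close>, so its moment is of order
    \<open>(h * m) ^ n\<close>; for the product of two \<open>Z\<close> this uses
    \<open>m \<le> h\<close>.\<close>
  define P where "P i j \<omega> = Z \<omega> $ i * Z \<omega> $ j + Z \<omega> $ i * Y \<omega> $ j + Y \<omega> $ i * Z \<omega> $ j" for i j \<omega>
  have [measurable]: "P i j \<in> borel_measurable M" for i j unfolding P_def by measurable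
  have sq: "(sqrt A * x ^ n)\<^sup>2 = A * x ^ (2 * n)" for x
    using AB by (simp add: power_mult_distrib power_mult[symmetric] mult.commute)
  have pos: "sqrt A * m ^ n > 0" "sqrt A * h ^ n > 0" using AB mh h by auto
  have prods: "moment M (2 * n) (\<lambda>\<omega>. Z \<omega> $ i * Z \<omega> $ j) \<le> ennreal K"
    "moment M (2 * n) (\<lambda>\<omega>. Z \<omega> $ i * Y \<omega> $ j) \<le> ennreal K"
    "moment M (2 * n) (\<lambda>\<omega>. Y \<omega> $ i * Z \<omega> $ j) \<le> ennreal K" for i j
  proof -
    have e1: "(sqrt A * m ^ n) * (sqrt A * h ^ n) = K" "(sqrt A * h ^ n) * (sqrt A * m ^ n) = K"
      using AB by (simp_all add: K_def power_mult_distrib)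
    have e2: "(sqrt A * m ^ n) * (sqrt A * m ^ n) \<le> K"
      unfolding e1(1)[symmetric] using mh AB by (intro mult_left_mono power_mono) auto
    show "moment M (2 * n) (\<lambda>\<omega>. Z \<omega> $ i * Z \<omega> $ j) \<le> ennreal K"
      by (rule order_trans[OF moment_mult_le ennreal_leI[OF e2]]) (use pos Z in \<open>auto simp: sq\<close>)
    show "moment M (2 * n) (\<lambda>\<omega>. Z \<omega> $ i * Y \<omega> $ j) \<le> ennreal K"
      unfolding e1(1)[symmetric] by (rule moment_mult_le) (use pos Z Y in \<open>auto simp: sq\<close>)
    show "moment M (2 * n) (\<lambda>\<omega>. Y \<omega> $ i * Z \<omega> $ j) \<le> ennreal K"
      unfolding e1(2)[symmetric] by (rule moment_mult_le) (use pos Z Y in \<open>auto simp: sq\<close>)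
  qed
  have P: "moment M (2 * n) (P i j) \<le> ennreal (16 ^ n * K)" for i j
  proof -
    have 1: "moment M (2 * n) (\<lambda>\<omega>. Z \<omega> $ i * Z \<omega> $ j + Z \<omega> $ i * Y \<omega> $ j) \<le> ennreal (4 ^ n * K)"
      by (rule moment_add_le(1)) (use K n prods in auto)
    have "K \<le> 4 ^ n * K" using K by simp
    then have 2: "moment M (2 * n) (\<lambda>\<omega>. Y \<omega> $ i * Z \<omega> $ j) \<le> ennreal (4 ^ n * K)"
      by (rule order_trans[OF prods(3) ennreal_leI])
    have "moment M (2 * n) (P i j) \<le> ennreal (4 ^ n * (4 ^ n * K))"
      unfolding P_def by (rule moment_add_le(1)) (use K n 1 2 in auto)
    also have "4 ^ n * (4 ^ n * K) = 16 ^ n * K" by (simp add: power_mult_distrib[symmetric] mult.assoc[symmetric])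
    finally show ?thesis .
  qed
  \<comment> \<open>\<open>16 ^ n\<close> comes from the two additions inside \<open>P\<close>, the
    outer \<open>4 ^ n\<close> of the claim from subtracting the reflected component.\<close>
  define F where "F = (16 ^ n * A + B) * (h * m) ^ n"
  have F: "16 ^ n * K \<le> F" "B * (h * m) ^ n \<le> F" "F \<ge> 0"
    using AB mh h by (auto simp: F_def K_def distrib_right)
  have F4: "F \<le> 4 ^ n * F" using mult_right_mono[OF one_le_power[of "4 :: real" n] F(3)] by simp
  consider "i < j" | "i = j" | "j < i" by (meson linorder_less_linear)
  then have "moment M (2 * n) (\<lambda>\<omega>. D \<omega> $ i $ j) \<le> ennreal (4 ^ n * F)"
  proof cases
    case 1
    show ?thesis by (rule order_trans[OF D[OF 1] ennreal_leI]) (use F F4 in linarith)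
  next
    case 2
    have "moment M (2 * n) (\<lambda>\<omega>. D \<omega> $ i $ j) = (moment M (2 * n) (\<lambda>\<omega>. (1 / 2) * P i j \<omega>))"
    proof (rule nn_integral_cong)
      fix \<omega> assume "\<omega> \<in> space M"
      then have "D \<omega> $ i $ j = (1 / 2) * P i j \<omega>" using sym[of \<omega> i j] 2 by (simp add: P_def)
      then show "ennreal ((D \<omega> $ i $ j) ^ (2 * n)) = ennreal (((1 / 2) * P i j \<omega>) ^ (2 * n))" by (simp only:)
    qed
    also have "\<dots> = ennreal ((1 / 2) ^ (2 * n)) * (moment M (2 * n) (P i j))"
      by (rule moment_cmult) measurable
    also have "\<dots> \<le> 1 * ennreal (16 ^ n * K)"
      by (intro mult_mono P) (auto simp: power_le_one)
    also have "\<dots> \<le> ennreal (4 ^ n * F)" using F F4 by (simp add: ennreal_leI)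
    finally show ?thesis .
  next
    case 3
    have "moment M (2 * n) (\<lambda>\<omega>. D \<omega> $ i $ j) = (moment M (2 * n) (\<lambda>\<omega>. P i j \<omega> - D \<omega> $ j $ i))"
    proof (rule nn_integral_cong)
      fix \<omega> assume "\<omega> \<in> space M"
      then have "D \<omega> $ i $ j = P i j \<omega> - D \<omega> $ j $ i" using sym[of \<omega> i j] by (simp add: P_def)
      then show "ennreal ((D \<omega> $ i $ j) ^ (2 * n)) = ennreal ((P i j \<omega> - D \<omega> $ j $ i) ^ (2 * n))" by (simp only:)
    qed
    also have "\<dots> \<le> ennreal (4 ^ n * F)"
      by (rule moment_add_le(2)) (use F n order_trans[OF P ennreal_leI[OF F(1)]] order_trans[OF D[OF 3] ennreal_leI[OF F(2)]] in auto)
    finally show ?thesis .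
  qed
  then show ?thesis by (simp add: F_def mult.assoc)
qed

section \<open>The Brownian rough path: continuity, symmetry, measurability\<close>

lemma BM_path:
  assumes "canonical_BM M" "\<omega> \<in> space M"
  shows "continuous_on UNIV \<omega>" "\<omega> 0 = 0"
  using assms by (auto simp: canonical_BM_def)

text \<open>Continuity of the area in its second argument is extracted from the Hoelder bounds: by
  Chen's relation the difference between two times is the area over the short interval between them
  plus a product containing the path increment over that interval.\<close>

lemma brownian_rough_path:
  fixes M :: "(real \<Rightarrow> real^'m::{finite,linorder}) measure"
  assumes M: "canonical_BM M" and W: "brownian_area M WW" and \<omega>: "\<omega> \<in> space M"
  shows "rough_path \<omega> (WW \<omega>)"
proof -
  have c: "continuous_on UNIV \<omega>" using BM_path[OF M \<omega>] by simp
  have chen: "WW \<omega> s t - WW \<omega> s u - WW \<omega> u t = tensor (\<omega> u - \<omega> s) (\<omega> t - \<omega> u)" if "s \<le> u" "u \<le> t" for s u t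
    using W \<omega> that unfolding brownian_area_def by blast
  have "continuous_on {a..} (WW \<omega> a)" for a
    unfolding continuous_on_def
  proof (intro ballI)
    fix t0 assume t0: "t0 \<in> {a..}"
    define T where "T = \<bar>a\<bar> + \<bar>t0\<bar> + 1"
    have T: "T > 0" "-T \<le> a" "t0 < T" using t0 by (auto simp: T_def)
    \<comment> \<open>Any exponent strictly between 1/3 and 1/2 would do; \<open>2/5\<close> is
      one.\<close>
    have "holder2 (2 * (2/5)) (-T) T (WW \<omega>) < \<infinity>"
    proof -
      have "\<forall>T>0. \<forall>\<beta>\<in>{1/3<..<1/2}. holder1 \<beta> (-T) T \<omega> < \<infinity> \<and> holder2 (2 * \<beta>) (-T) T (WW \<omega>) < \<infinity>"
        using W \<omega> unfolding brownian_area_def by blast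
      then show ?thesis using T(1) by (auto dest!: spec[of _ T] bspec[of _ _ "2/5"])
    qed
    then obtain K where K: "holder2 (2 * (2/5)) (-T) T (WW \<omega>) = ennreal K" "K \<ge> 0"
      by (cases "holder2 (2 * (2/5)) (-T) T (WW \<omega>)") auto
    have hol: "norm (WW \<omega> s t) \<le> K * \<bar>t - s\<bar> powr (2 * (2/5))" if "-T \<le> s" "s < t" "t \<le> T" for s t
    proof -
      have "ennreal (norm (WW \<omega> s t) / (t - s) powr (2 * (2/5))) \<le> holder2 (2 * (2/5)) (-T) T (WW \<omega>)"
        unfolding holder2_def by (rule SUP_upper2[of "(s, t)"]) (use that in auto)
      then show ?thesis using K that by (simp add: ennreal_le_iff divide_le_eq)
    qed
    \<comment> \<open>One bound for \<open>t\<close> on either side of \<open>t0\<close>, tending to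
      zero at \<open>t0\<close>.\<close>
    let ?b = "\<lambda>t. K * \<bar>t - t0\<bar> powr (2 * (2/5)) + (norm (\<omega> t - \<omega> a) + norm (\<omega> t0 - \<omega> a)) * norm (\<omega> t - \<omega> t0)"
    have bound: "norm (WW \<omega> a t - WW \<omega> a t0) \<le> ?b t" if t: "a \<le> t" "t < T" for t
    proof -
      consider "t0 < t" | "t = t0" | "t < t0" by linarith
      then show ?thesis
      proof cases
        case 1
        have "WW \<omega> a t - WW \<omega> a t0 = WW \<omega> t0 t + tensor (\<omega> t0 - \<omega> a) (\<omega> t - \<omega> t0)"
          using chen[of a t0 t] t0 1 by (simp add: algebra_simps)
        then have "norm (WW \<omega> a t - WW \<omega> a t0) \<le> norm (WW \<omega> t0 t) + norm (\<omega> t0 - \<omega> a) * norm (\<omega> t - \<omega> t0)"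
          by (metis norm_triangle_ineq norm_tensor)
        also have "\<dots> \<le> ?b t" using hol[of t0 t] 1 t T t0 by (intro add_mono mult_right_mono) auto
        finally show ?thesis .
      next
        case 2
        then show ?thesis using K by simp
      next
        case 3
        have "WW \<omega> a t0 - WW \<omega> a t = WW \<omega> t t0 + tensor (\<omega> t - \<omega> a) (\<omega> t0 - \<omega> t)"
          using chen[of a t t0] t 3 by (simp add: algebra_simps)
        then have "norm (WW \<omega> a t0 - WW \<omega> a t) \<le> norm (WW \<omega> t t0) + norm (\<omega> t - \<omega> a) * norm (\<omega> t0 - \<omega> t)"
          by (metis norm_triangle_ineq norm_tensor)
        also have "\<dots> \<le> ?b t" using hol[of t t0] 3 t T
          by (intro add_mono) (auto simp: norm_minus_commute abs_minus_commute intro!: mult_right_mono)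
        finally show ?thesis by (simp add: norm_minus_commute)
      qed
    qed
    have cw: "(\<omega> \<longlongrightarrow> \<omega> t0) (at t0 within {a..})"
      using continuous_on_subset[OF c, of "{a..}"] t0 by (auto simp: continuous_on_def)
    have "(?b \<longlongrightarrow> K * \<bar>t0 - t0\<bar> powr (2 * (2/5)) + (norm (\<omega> t0 - \<omega> a) + norm (\<omega> t0 - \<omega> a)) * norm (\<omega> t0 - \<omega> t0)) (at t0 within {a..})"
      by (intro tendsto_intros cw tendsto_powr2) auto
    then have "(?b \<longlongrightarrow> 0) (at t0 within {a..})" by simp
    moreover have "\<forall>\<^sub>F t in at t0 within {a..}. norm (WW \<omega> a t - WW \<omega> a t0) \<le> ?b t"
    proof -
      have "\<forall>\<^sub>F t in at t0 within {a..}. t \<in> {a..}" by (simp add: eventually_at_filter)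
      moreover have "\<forall>\<^sub>F t in at t0 within {a..}. t < T"
        using T(3) by (intro order_tendstoD(2)[OF tendsto_ident_at])
      ultimately show ?thesis by eventually_elim (use bound in auto)
    qed
    ultimately have "((\<lambda>t. WW \<omega> a t - WW \<omega> a t0) \<longlongrightarrow> 0) (at t0 within {a..})"
      by (rule Lim_null_comparison[rotated])
    then show "(WW \<omega> a \<longlongrightarrow> WW \<omega> a t0) (at t0 within {a..})" by (simp add: LIM_zero_iff)
  qed
  then show ?thesis using c chen unfolding rough_path_def by blast
qed

lemma brownian_area_sym:
  fixes M :: "(real \<Rightarrow> real^'m::{finite,linorder}) measure"
  assumes W: "brownian_area M WW" and \<omega>: "\<omega> \<in> space M" and st: "s \<le> t"
  shows "WW \<omega> s t $ i $ j + WW \<omega> s t $ j $ i = (\<omega> t $ i - \<omega> s $ i) * (\<omega> t $ j - \<omega> s $ j)"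
proof -
  consider "i < j" | "i = j" | "j < i" by (meson linorder_less_linear)
  then show ?thesis
    using W \<omega> st unfolding brownian_area_def
    by cases (auto simp: power2_eq_square mult.commute)
qed

text \<open>The mesh limit provides measurability above the diagonal; the symmetric part supplies
  the remaining components.\<close>

lemma brownian_area_measurable:
  fixes M :: "(real \<Rightarrow> real^'m::{finite,linorder}) measure"
  assumes M: "canonical_BM M" and W: "brownian_area M WW" and st: "s \<le> t"
  shows "(\<lambda>\<omega>. WW \<omega> s t) \<in> borel_measurable M"
proof (rule borel_measurable_matrix)
  fix i j :: 'm
  note [measurable] = BM_measurable[OF M]
  have up: "(\<lambda>\<omega>. WW \<omega> s t $ i $ j) \<in> borel_measurable M" if "i < j" for i j :: 'm
    using W that st by (simp add: brownian_area_def L2_mesh_limit_def)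
  consider "i < j" | "i = j" | "j < i" by (meson linorder_less_linear)
  then show "(\<lambda>\<omega>. WW \<omega> s t $ i $ j) \<in> borel_measurable M"
  proof cases
    case 1
    then show ?thesis by (rule up)
  next
    case 2
    have eq: "WW \<omega> s t $ i $ j = (\<omega> t $ i - \<omega> s $ i)\<^sup>2 / 2" if "\<omega> \<in> space M" for \<omega>
      using brownian_area_sym[OF W that st, of i j] 2 by (simp add: power2_eq_square)
    have "(\<lambda>\<omega>. (\<omega> t $ i - \<omega> s $ i)\<^sup>2 / 2) \<in> borel_measurable M" by measurable
    then show ?thesis
      using measurable_cong[of M "\<lambda>\<omega>. WW \<omega> s t $ i $ j" "\<lambda>\<omega>. (\<omega> t $ i - \<omega> s $ i)\<^sup>2 / 2" borel] eq by blast
  next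
    case 3
    note [measurable] = up[OF 3]
    have "(\<lambda>\<omega>. (\<omega> t $ i - \<omega> s $ i) * (\<omega> t $ j - \<omega> s $ j) - WW \<omega> s t $ j $ i) \<in> borel_measurable M" by measurable
    moreover have "WW \<omega> s t $ i $ j = (\<omega> t $ i - \<omega> s $ i) * (\<omega> t $ j - \<omega> s $ j) - WW \<omega> s t $ j $ i" if "\<omega> \<in> space M" for \<omega>
      using brownian_area_sym[OF W that st, of i j] by simp
    ultimately show ?thesis by (subst measurable_cong) auto
  qed
qed

text \<open>Both levels are pathwise limits of averages and Riemann sums built from finitely many
  evaluations.\<close>

lemma approx_measurable:
  fixes M :: "(real \<Rightarrow> real^'m::finite) measure"
  assumes M: "canonical_BM M" and \<delta>: "\<delta> > 0"
  shows "(\<lambda>\<omega>. approx_path \<delta> \<omega> t) \<in> borel_measurable M"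
    and "s \<le> t \<Longrightarrow> (\<lambda>\<omega>. approx_area \<delta> \<omega> s t) \<in> borel_measurable M"
proof -
  note [measurable] = BM_measurable[OF M]
  show P: "(\<lambda>\<omega>. approx_path \<delta> \<omega> t) \<in> borel_measurable M" for t
  proof (rule borel_measurable_vector)
    fix i
    \<comment> \<open>The path starts at zero, so its increment from time 0 is its value.\<close>
    have z: "approx_path \<delta> \<omega> 0 = 0" for \<omega> :: "real \<Rightarrow> real^'m"
      by (simp add: approx_path_def zero_ereal_def[symmetric])
    show "(\<lambda>\<omega>. approx_path \<delta> \<omega> t $ i) \<in> borel_measurable M"
    proof (rule borel_measurable_LIMSEQ_real)
      show "(\<lambda>N. (1 / real (Suc N)) * (\<Sum>l<Suc N. \<omega> (t + l * (\<delta> / Suc N)) $ i - \<omega> (0 + l * (\<delta> / Suc N)) $ i))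
        \<longlonglongrightarrow> approx_path \<delta> \<omega> t $ i" if "\<omega> \<in> space M" for \<omega>
        using approx_path_increment_tendsto[OF BM_path(1)[OF M that] \<delta> filterlim_Suc, of t i 0] by (simp add: z)
    qed measurable
  qed
  have [measurable]: "(\<lambda>\<omega>. approx_path \<delta> \<omega> t $ i) \<in> borel_measurable M" for t i
    by (rule measurable_compose[OF P]) measurable
  assume "s \<le> t"
  show "(\<lambda>\<omega>. approx_area \<delta> \<omega> s t) \<in> borel_measurable M"
  proof (cases "s = t")
    case True
    have "approx_area \<delta> \<omega> s t = 0" if "\<omega> \<in> space M" for \<omega>
      using rough_path_same[OF rough_path_approx[OF BM_path(1)[OF M that] \<delta>]] True by simp
    then show ?thesis by (subst measurable_cong) auto
  next
    case False
    then have st: "s < t" using \<open>s \<le> t\<close> by simp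
    show ?thesis
    proof (rule borel_measurable_matrix)
      fix i j
      show "(\<lambda>\<omega>. approx_area \<delta> \<omega> s t $ i $ j) \<in> borel_measurable M"
        by (rule borel_measurable_LIMSEQ_real[OF approx_area_riemann[OF BM_path(1)[OF M] \<delta> st]]) measurable
    qed
  qed
qed

section \<open>Moment estimates for Brownian motion\<close>

text \<open>The difference of increments is an average of second differences of \<omega>, with steps
  \<open>t - s\<close> and a shift of at most \<delta>. Each second difference splits into two
  increments along either step, and the choice of the shorter one produces the minimum.\<close>

lemma approx_increment_moment:
  fixes M :: "(real \<Rightarrow> real^'m::finite) measure"
  assumes M: "canonical_BM M" and \<delta>: "\<delta> > 0" and n: "n > 0" and st: "s < t"
  shows "moment M (2 * n) (\<lambda>\<omega>. (approx_path \<delta> \<omega> t - approx_path \<delta> \<omega> s - \<omega> t + \<omega> s) $ i)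
    \<le> ennreal (4 ^ n * (gauss_const n * min \<delta> (t - s) ^ n))"
proof -
  note [measurable] = BM_measurable[OF M]
  define v where "v = gauss_const n * min \<delta> (t - s) ^ n"
  have c: "gauss_const n > 0" by (rule gauss_const_pos)
  have v: "v \<ge> 0" using c \<delta> st by (simp add: v_def)
  define y where "y N l \<omega> = (\<omega> (t + real l * (\<delta> / real (Suc N))) $ i - \<omega> (s + real l * (\<delta> / real (Suc N))) $ i) - (\<omega> t $ i - \<omega> s $ i)"
    for N l and \<omega> :: "real \<Rightarrow> real^'m"
  have [measurable]: "y N l \<in> borel_measurable M" for N l unfolding y_def by measurable
  have y: "moment M (2 * n) (y N l) \<le> ennreal (4 ^ n * v)" if l: "l < Suc N" for N l
  proof -
    define u where "u = real l * (\<delta> / real (Suc N))"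
    have "real l * (\<delta> / real (Suc N)) \<le> real (Suc N) * (\<delta> / real (Suc N))"
      using l \<delta> by (intro mult_right_mono) auto
    then have u: "0 \<le> u" "u \<le> \<delta>" using \<delta> by (auto simp: u_def)
    show ?thesis
    proof (cases "\<delta> \<le> t - s")
      case True
      then have vd: "v = gauss_const n * \<delta> ^ n" by (simp add: v_def min_def)
      have inc: "moment M (2 * n) (\<lambda>\<omega>. \<omega> (x + u) $ i - \<omega> x $ i) \<le> ennreal v" for x
        unfolding BM_increment_moment[OF M n] vd using u c by (intro ennreal_leI mult_left_mono power_mono) auto
      have "y N l \<omega> = (\<omega> (t + u) $ i - \<omega> t $ i) - (\<omega> (s + u) $ i - \<omega> s $ i)" for \<omega>
        by (simp add: y_def u_def)
      then show ?thesis
        by (simp only:) (rule moment_add_le(2)[OF v n _ _ inc inc], measurable)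
    next
      case False
      then have vd: "v = gauss_const n * (t - s) ^ n" by (simp add: v_def min_def)
      have inc: "moment M (2 * n) (\<lambda>\<omega>. \<omega> (t + u) $ i - \<omega> (s + u) $ i) \<le> ennreal v" for u
        unfolding BM_increment_moment[OF M n] vd using st by simp
      have "y N l \<omega> = (\<omega> (t + u) $ i - \<omega> (s + u) $ i) - (\<omega> (t + 0) $ i - \<omega> (s + 0) $ i)" for \<omega>
        by (simp add: y_def u_def)
      then show ?thesis
        by (simp only:) (rule moment_add_le(2)[OF v n _ _ inc inc], measurable)
    qed
  qed
  have "moment M (2 * n) (\<lambda>\<omega>. (approx_path \<delta> \<omega> t - approx_path \<delta> \<omega> s - \<omega> t + \<omega> s) $ i) \<le> ennreal (4 ^ n * v)"
  proof (rule moment_limit[where B = "\<lambda>N \<omega>. (\<Sum>l\<in>{..<Suc N}. y N l \<omega>) / real (card {..<Suc N})" and v = "\<lambda>_. 4 ^ n * v"])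
    show "moment M (2 * n) (\<lambda>\<omega>. (\<Sum>l\<in>{..<Suc N}. y N l \<omega>) / real (card {..<Suc N})) \<le> ennreal (4 ^ n * v)" for N
      by (rule moment_mean_le) (use v y in auto)
    show "AE \<omega> in M. (\<lambda>N. (\<Sum>l\<in>{..<Suc N}. y N l \<omega>) / real (card {..<Suc N}))
      \<longlonglongrightarrow> (approx_path \<delta> \<omega> t - approx_path \<delta> \<omega> s - \<omega> t + \<omega> s) $ i"
    proof (rule AE_I2)
      fix \<omega> assume \<omega>: "\<omega> \<in> space M"
      have "(\<Sum>l\<in>{..<Suc N}. y N l \<omega>) / real (card {..<Suc N}) =
        (1 / real (Suc N)) * (\<Sum>l<Suc N. \<omega> (t + real l * (\<delta> / real (Suc N))) $ i - \<omega> (s + real l * (\<delta> / real (Suc N))) $ i) - (\<omega> t $ i - \<omega> s $ i)" for N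
        unfolding y_def sum_subtractf[of _ "\<lambda>_. \<omega> t $ i - \<omega> s $ i"] by (simp add: diff_divide_distrib del: of_nat_Suc)
      moreover have "(\<lambda>N. (1 / real (Suc N)) * (\<Sum>l<Suc N. \<omega> (t + real l * (\<delta> / real (Suc N))) $ i - \<omega> (s + real l * (\<delta> / real (Suc N))) $ i) - (\<omega> t $ i - \<omega> s $ i))
        \<longlonglongrightarrow> (approx_path \<delta> \<omega> t $ i - approx_path \<delta> \<omega> s $ i) - (\<omega> t $ i - \<omega> s $ i)"
        by (intro tendsto_diff tendsto_const approx_path_increment_tendsto BM_path(1)[OF M \<omega>] \<delta> filterlim_Suc)
      moreover have "(approx_path \<delta> \<omega> t - approx_path \<delta> \<omega> s - \<omega> t + \<omega> s) $ i =
        (approx_path \<delta> \<omega> t $ i - approx_path \<delta> \<omega> s $ i) - (\<omega> t $ i - \<omega> s $ i)" by simp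
      ultimately show "(\<lambda>N. (\<Sum>l\<in>{..<Suc N}. y N l \<omega>) / real (card {..<Suc N}))
        \<longlonglongrightarrow> (approx_path \<delta> \<omega> t - approx_path \<delta> \<omega> s - \<omega> t + \<omega> s) $ i" by (simp only:)
    qed
  qed auto
  then show ?thesis by (simp add: v_def)
qed

lemma matrix_nth_measurable:
  fixes f :: "'a \<Rightarrow> real^'n::finite^'m::finite"
  assumes "f \<in> borel_measurable M"
  shows "(\<lambda>\<omega>. f \<omega> $ i $ j) \<in> borel_measurable M"
  by (rule measurable_compose[OF assms])
    (auto intro!: borel_measurable_continuous_onI continuous_intros)

lemma riemann_sum_grid:
  "riemann_sum \<omega> i j a (\<lambda>k. s + real k * \<epsilon>) = (\<Sum>k<a. (\<omega> (s + real k * \<epsilon>) $ i - \<omega> (s + real 0 * \<epsilon>) $ i) *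
    (\<omega> (s + real (Suc k) * \<epsilon>) $ j - \<omega> (s + real k * \<epsilon>) $ j))"
  by (simp add: riemann_sum_def)

text \<open>The Riemann sum is a bilinear form whose matrix is the indicator of one triangle. It has
  at most as many unit entries as the square of the number of cells, which the squared step turns
  into the squared length.\<close>

lemma area_moment_offdiagonal:
  fixes M :: "(real \<Rightarrow> real^'m::finite) measure"
  assumes M: "canonical_BM M" and I: "L2_mesh_limit M i j s t I" and ij: "i \<noteq> j" and n: "n > 0" and st: "s < t"
  shows "moment M (2 * n) I \<le> ennreal ((gauss_const n)\<^sup>2 * ((t - s) * (t - s)) ^ n)"
proof -
  note [measurable] = BM_measurable[OF M]
  define \<epsilon> where "\<epsilon> N = (t - s) / real (Suc N)" for N
  have \<epsilon>: "\<epsilon> N > 0" "t - s = real (Suc N) * \<epsilon> N" for N using st by (auto simp: \<epsilon>_def)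
  let ?R = "\<lambda>N \<omega>. riemann_sum \<omega> i j (Suc N) (\<lambda>k. s + real k * \<epsilon> N)"
  have [measurable]: "?R N \<in> borel_measurable M" for N unfolding riemann_sum_def by measurable
  obtain r where r: "AE \<omega> in M. (\<lambda>N. ?R (r N) \<omega>) \<longlonglongrightarrow> I \<omega>"
    using L2_mesh_limit_AE[OF M I st \<epsilon>(2) filterlim_Suc \<epsilon>(1)] by blast
  have mom: "moment M (2 * n) (?R N) \<le> ennreal ((gauss_const n)\<^sup>2 * ((t - s) * (t - s)) ^ n)" for N
  proof -
    let ?A = "\<lambda>m k :: nat. if 0 \<le> k \<and> k < m then 1 else 0 :: real"
    let ?N = "Suc N"
    have eq: "?R N \<omega> = (\<Sum>m<?N. (\<Sum>k<?N. ?A m k * (\<omega> (s + real (Suc k) * \<epsilon> N) $ i - \<omega> (s + real k * \<epsilon> N) $ i)) *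
      (\<omega> (s + real (Suc m) * \<epsilon> N) $ j - \<omega> (s + real m * \<epsilon> N) $ j))" for \<omega>
      unfolding riemann_sum_grid
      by (intro sum.cong refl arg_cong2[where f = "(*)"]
          sum_indicator_telescope[where U = "\<lambda>k. \<omega> (s + real k * \<epsilon> N) $ i", symmetric]) auto
    have "(\<Sum>m<?N. \<Sum>k<?N. (?A m k)\<^sup>2) \<le> (\<Sum>m<?N. \<Sum>k<?N. 1)" by (intro sum_mono) auto
    then have "(\<epsilon> N)\<^sup>2 * (\<Sum>m<?N. \<Sum>k<?N. (?A m k)\<^sup>2) \<le> (\<epsilon> N)\<^sup>2 * (real ?N * real ?N)"
      by (intro mult_left_mono) auto
    also have "\<dots> = (t - s) * (t - s)" unfolding \<epsilon>(2)[of N] by (simp add: power2_eq_square)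
    finally have le: "(\<epsilon> N)\<^sup>2 * (\<Sum>m<?N. \<Sum>k<?N. (?A m k)\<^sup>2) \<le> (t - s) * (t - s)" .
    have "0 \<le> (\<epsilon> N)\<^sup>2 * (\<Sum>m<?N. \<Sum>k<?N. (?A m k)\<^sup>2)"
      by (intro mult_nonneg_nonneg sum_nonneg zero_le_power2)
    from mult_left_mono[OF power_mono[OF le this]]
    have "(gauss_const n)\<^sup>2 * ((\<epsilon> N)\<^sup>2 * (\<Sum>m<?N. \<Sum>k<?N. (?A m k)\<^sup>2)) ^ n \<le> (gauss_const n)\<^sup>2 * ((t - s) * (t - s)) ^ n"
      using zero_le_power2 by blast
    then show ?thesis
      unfolding eq by (rule order_trans[OF BM_bilinear_moment[OF M ij \<epsilon>(1) n] ennreal_leI])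
  qed
  show ?thesis
    by (rule moment_limit[OF _ r mom tendsto_const]) measurable
qed

text \<open>\<open>e\<close> measures both \<open>t - s\<close> and \<delta>; dividing it by
  \<open>Suc N\<close> refines the grid while both lengths stay multiples of the step. Each pair of
  shifts gives one bilinear form, bounded uniformly in the pair, and averaging preserves the
  bound.\<close>

lemma area_diff_moment_commensurable:
  fixes M :: "(real \<Rightarrow> real^'m::finite) measure"
  assumes M: "canonical_BM M" and I: "L2_mesh_limit M i j s t I" and ij: "i \<noteq> j" and n: "n > 0"
    and e: "e > 0" and ab: "a0 > 0" "b0 > 0" and t: "t - s = real a0 * e" and \<delta>: "\<delta> = real b0 * e"
  shows "moment M (2 * n) (\<lambda>\<omega>. approx_area \<delta> \<omega> s t $ i $ j - I \<omega>)
    \<le> ennreal ((gauss_const n)\<^sup>2 * (4 * ((t - s) * min \<delta> (t - s))) ^ n)"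
proof -
  note [measurable] = BM_measurable[OF M]
  define \<epsilon> where "\<epsilon> N = e / real (Suc N)" for N
  define a where "a N = a0 * Suc N" for N
  define b where "b N = b0 * Suc N" for N
  have \<epsilon>: "\<epsilon> N > 0" for N using e by (simp add: \<epsilon>_def)
  have a: "t - s = real (a N) * \<epsilon> N" for N unfolding t a_def \<epsilon>_def by (simp del: of_nat_Suc mult_Suc_right)
  have b: "\<delta> = real (b N) * \<epsilon> N" for N unfolding \<delta> b_def \<epsilon>_def by (simp del: of_nat_Suc mult_Suc_right)
  have \<delta>0: "\<delta> > 0" using \<delta> ab e by simp
  have st: "s < t"
  proof -
    have "0 < real a0 * e" using ab e by simp
    then show ?thesis using t by linarith
  qed
  have top: "filterlim (\<lambda>N. c * Suc N) at_top sequentially" if "c > 0" for c :: nat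
  proof (rule filterlim_at_top_mono[OF filterlim_Suc], rule always_eventually, rule allI)
    fix N show "Suc N \<le> c * Suc N" using that mult_le_mono1[of 1 c "Suc N"] by simp
  qed
  have at: "filterlim a at_top sequentially" "filterlim b at_top sequentially"
    unfolding a_def b_def by (rule top[OF ab(1)], rule top[OF ab(2)])
  have bpos: "b N > 0" for N using ab by (simp add: b_def)
  let ?x = "\<lambda>N k. s + real k * \<epsilon> N"
  define R where "R N \<omega> = (\<Sum>k<a N. (\<omega> (?x N k) $ i - \<omega> (?x N 0) $ i) * (\<omega> (?x N (Suc k)) $ j - \<omega> (?x N k) $ j))" for N and \<omega> :: "real \<Rightarrow> real^'m"
  define y where "y N z \<omega> = (\<Sum>k<a N. (\<omega> (?x N (k + fst z)) $ i - \<omega> (?x N (fst z)) $ i) *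
    (\<omega> (?x N (Suc (k + snd z))) $ j - \<omega> (?x N (k + snd z)) $ j)) - R N \<omega>" for N z and \<omega> :: "real \<Rightarrow> real^'m"
  have [measurable]: "y N z \<in> borel_measurable M" for N z unfolding y_def R_def by measurable
  let ?S = "\<lambda>N. {..<b N} \<times> {..<b N}"
  let ?v = "(gauss_const n)\<^sup>2 * (4 * ((t - s) * min \<delta> (t - s))) ^ n"
  define B where "B N \<omega> = (\<Sum>z\<in>?S N. y N z \<omega>) / real (card (?S N))" for N \<omega>
  have v: "?v \<ge> 0" using st \<delta>0 by (auto intro!: mult_nonneg_nonneg)
  have y: "moment M (2 * n) (y N z) \<le> ennreal ?v" if z: "z \<in> ?S N" for N z
  proof -
    let ?A = "shift_matrix (a N) (fst z) (snd z)"
    have z': "fst z < b N" "snd z < b N" using z by auto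
    have eq: "y N z \<omega> = (\<Sum>m<a N + b N. (\<Sum>k<a N + b N. ?A m k * (\<omega> (?x N (Suc k)) $ i - \<omega> (?x N k) $ i)) *
      (\<omega> (?x N (Suc m)) $ j - \<omega> (?x N m) $ j))" for \<omega>
      unfolding y_def R_def
      using shift_matrix_form[OF z', of "a N" "\<lambda>k. \<omega> (?x N k) $ i" "\<lambda>k. \<omega> (?x N k) $ j"] by simp
    have "(\<epsilon> N)\<^sup>2 * (\<Sum>m<a N + b N. \<Sum>k<a N + b N. (?A m k)\<^sup>2) \<le> (\<epsilon> N)\<^sup>2 * (4 * (real (a N) * real (min (a N) (b N))))"
      by (intro mult_left_mono shift_matrix_bound z') auto
    also have "\<dots> = 4 * ((real (a N) * \<epsilon> N) * (real (min (a N) (b N)) * \<epsilon> N))"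
      by (simp add: power2_eq_square)
    \<comment> \<open>The step times the smaller number of cells is the smaller of the two lengths,
      so the bound does not depend on \<open>N\<close>.\<close>
    also have "real (min (a N) (b N)) * \<epsilon> N = min \<delta> (t - s)"
      unfolding a[of N] b[of N] using \<epsilon>[of N] by (auto simp: min_def)
    also have "real (a N) * \<epsilon> N = t - s" by (rule a[symmetric])
    finally have "(gauss_const n)\<^sup>2 * ((\<epsilon> N)\<^sup>2 * (\<Sum>m<a N + b N. \<Sum>k<a N + b N. (?A m k)\<^sup>2)) ^ n \<le> ?v"
      by (intro mult_left_mono power_mono) (auto intro!: mult_nonneg_nonneg sum_nonneg)
    then show ?thesis
      unfolding eq by (rule order_trans[OF BM_bilinear_moment[OF M ij \<epsilon> n] ennreal_leI])
  qed
  have Bm: "moment M (2 * n) (B N) \<le> ennreal ?v" for N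
    unfolding B_def
  proof (rule moment_mean_le)
    show "?S N \<noteq> {}" using bpos[of N] by auto
  qed (use v y in auto)
  \<comment> \<open>The Brownian side converges almost surely along \<open>r\<close> only; the
    smooth side converges on every path and can follow this subsequence.\<close>
  obtain r where r: "filterlim r at_top sequentially"
    "AE \<omega> in M. (\<lambda>N. riemann_sum \<omega> i j (a (r N)) (\<lambda>k. s + real k * \<epsilon> (r N))) \<longlonglongrightarrow> I \<omega>"
    using L2_mesh_limit_AE[OF M I st a at(1) \<epsilon>] by blast
  show ?thesis
  proof (rule moment_limit[where B = "\<lambda>N. B (r N)", OF _ _ Bm tendsto_const])
    show "B (r N) \<in> borel_measurable M" for N unfolding B_def by measurable
    show "AE \<omega> in M. (\<lambda>N. B (r N) \<omega>) \<longlonglongrightarrow> approx_area \<delta> \<omega> s t $ i $ j - I \<omega>"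
      using r(2) AE_space
    proof eventually_elim
      case (elim \<omega>)
      define BB where "BB N = (\<Sum>k<a N. (1 / real (b N)) * (\<Sum>l<b N. \<omega> (?x N (k + l)) $ i - \<omega> (?x N l) $ i) *
        ((1 / real (b N)) * (\<omega> (?x N (k + b N)) $ j - \<omega> (?x N k) $ j)))" for N
      have "BB \<longlonglongrightarrow> approx_area \<delta> \<omega> s t $ i $ j"
        unfolding BB_def
        by (rule approx_area_double_riemann[OF BM_path(1)[OF M elim(2)] \<delta>0 st \<epsilon> a at(1) b at(2)])
      then have "(\<lambda>N. BB (r N) - riemann_sum \<omega> i j (a (r N)) (\<lambda>k. s + real k * \<epsilon> (r N))) \<longlonglongrightarrow> approx_area \<delta> \<omega> s t $ i $ j - I \<omega>"
        by (intro tendsto_diff elim(1) filterlim_compose[OF _ r(1)])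
      moreover have "BB N - riemann_sum \<omega> i j (a N) (\<lambda>k. s + real k * \<epsilon> N) = B N \<omega>" for N
        unfolding BB_def B_def y_def R_def riemann_sum_grid
        by (rule double_average_form[OF bpos, where U = "\<lambda>k. \<omega> (?x N k) $ i" and V = "\<lambda>k. \<omega> (?x N k) $ j"])
      ultimately show ?case by simp
    qed
  qed
qed

text \<open>With \<delta> fixed, the end point is moved up to the next time at which the length is a
  multiple of \<open>\<delta> / Suc N\<close>. Both areas are continuous in the end point, so the
  commensurable case passes to the limit.\<close>

lemma area_diff_moment:
  fixes M :: "(real \<Rightarrow> real^'m::{finite,linorder}) measure"
  assumes M: "canonical_BM M" and W: "brownian_area M WW" and ij: "i < j" and n: "n > 0"
    and \<delta>: "\<delta> > 0" and st: "s < t"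
  shows "moment M (2 * n) (\<lambda>\<omega>. approx_area \<delta> \<omega> s t $ i $ j - WW \<omega> s t $ i $ j)
    \<le> ennreal ((gauss_const n)\<^sup>2 * (4 * ((t - s) * min \<delta> (t - s))) ^ n)"
proof -
  \<comment> \<open>Rounding up keeps \<open>t' N \<ge> t > s\<close> and
    \<open>c N > 0\<close>.\<close>
  define c where "c N = nat \<lceil>(t - s) * real (Suc N) / \<delta>\<rceil>" for N
  define e where "e N = \<delta> / real (Suc N)" for N
  define t' where "t' N = s + real (c N) * e N" for N
  have e: "e N > 0" "\<delta> = real (Suc N) * e N" for N using \<delta> by (auto simp: e_def)
  have z: "(t - s) * real (Suc N) / \<delta> > 0" for N using st \<delta> by simp
  have c: "c N > 0" "(t - s) * real (Suc N) / \<delta> \<le> real (c N)" "real (c N) \<le> (t - s) * real (Suc N) / \<delta> + 1" for N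
    using z[of N] unfolding c_def by linarith+
  have t': "t \<le> t' N" "t' N \<le> t + e N" for N
  proof -
    have eq: "(t - s) * real (Suc N) / \<delta> * e N = t - s" using \<delta> by (simp add: e_def)
    show "t \<le> t' N" using mult_right_mono[OF c(2)[of N], of "e N"] e(1)[of N] eq by (simp add: t'_def)
    show "t' N \<le> t + e N" using mult_right_mono[OF c(3)[of N], of "e N"] e(1)[of N] eq by (simp add: t'_def distrib_right)
  qed
  have e0: "e \<longlonglongrightarrow> 0"
    unfolding e_def by (rule LIMSEQ_Suc[OF lim_const_over_n])
  have t'_lim: "t' \<longlonglongrightarrow> t"
  proof (rule tendsto_sandwich[of "\<lambda>_. t" t' _ "\<lambda>N. t + e N"])
    show "(\<lambda>N. t + e N) \<longlonglongrightarrow> t" using tendsto_add[OF tendsto_const e0, of t] by simp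
  qed (use t' in auto)
  have st': "s \<le> t' N" for N using t'(1)[of N] st by simp
  let ?v = "\<lambda>N. (gauss_const n)\<^sup>2 * (4 * ((t' N - s) * min \<delta> (t' N - s))) ^ n"
  show ?thesis
  proof (rule moment_limit[where B = "\<lambda>N \<omega>. approx_area \<delta> \<omega> s (t' N) $ i $ j - WW \<omega> s (t' N) $ i $ j" and v = ?v])
    note [measurable] = matrix_nth_measurable[OF approx_measurable(2)[OF M \<delta> st']]
      matrix_nth_measurable[OF brownian_area_measurable[OF M W st']]
    show "(\<lambda>\<omega>. approx_area \<delta> \<omega> s (t' N) $ i $ j - WW \<omega> s (t' N) $ i $ j) \<in> borel_measurable M" for N
      by measurable
    show "moment M (2 * n) (\<lambda>\<omega>. approx_area \<delta> \<omega> s (t' N) $ i $ j - WW \<omega> s (t' N) $ i $ j) \<le> ennreal (?v N)" for N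
    proof (rule area_diff_moment_commensurable[OF M _ _ n e(1) c(1) zero_less_Suc _ e(2)])
      show "L2_mesh_limit M i j s (t' N) (\<lambda>\<omega>. WW \<omega> s (t' N) $ i $ j)"
        using W ij st' by (simp add: brownian_area_def)
      show "t' N - s = real (c N) * e N" by (simp add: t'_def)
    qed (use ij in auto)
    show "?v \<longlonglongrightarrow> (gauss_const n)\<^sup>2 * (4 * ((t - s) * min \<delta> (t - s))) ^ n"
      by (intro tendsto_intros t'_lim)
    show "AE \<omega> in M. (\<lambda>N. approx_area \<delta> \<omega> s (t' N) $ i $ j - WW \<omega> s (t' N) $ i $ j)
      \<longlonglongrightarrow> approx_area \<delta> \<omega> s t $ i $ j - WW \<omega> s t $ i $ j"
    proof (rule AE_I2)
      fix \<omega> assume \<omega>: "\<omega> \<in> space M"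
      have lim: "(\<lambda>N. XX s (t' N)) \<longlonglongrightarrow> XX s t" if "rough_path X XX" for X :: "real \<Rightarrow> real^'m::{finite,linorder}" and XX
        by (rule rough_path_tendsto(2)[OF that _ tendsto_const t'_lim]) (use st' in auto)
      show "(\<lambda>N. approx_area \<delta> \<omega> s (t' N) $ i $ j - WW \<omega> s (t' N) $ i $ j)
        \<longlonglongrightarrow> approx_area \<delta> \<omega> s t $ i $ j - WW \<omega> s t $ i $ j"
        by (intro tendsto_diff tendsto_vec_nth lim[OF rough_path_approx[OF BM_path(1)[OF M \<omega>] \<delta>]] lim[OF brownian_rough_path[OF M W \<omega>]])
    qed
  qed
qed

section \<open>Proof of the theorem\<close>

lemma ennreal_add_power_le: "(x + y) ^ r \<le> 2 ^ r * (x ^ r + y ^ r)" for x y :: ennreal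
proof -
  have "x + y \<le> 2 * max x y" by (simp add: mult_2 add_mono)
  then have "(x + y) ^ r \<le> (2 * max x y) ^ r" by (rule power_mono) simp
  also have "\<dots> = 2 ^ r * max x y ^ r" by (rule power_mult_distrib)
  also have "\<dots> \<le> 2 ^ r * (x ^ r + y ^ r)"
    by (intro mult_left_mono) (auto simp: max_def)
  finally show ?thesis .
qed

lemma ennreal_add4_power_le:
  "(x + y + z + w) ^ r \<le> 4 ^ r * (x ^ r + y ^ r + z ^ r + w ^ r)" for x y z w :: ennreal
proof -
  have "(x + y + z + w) ^ r \<le> 2 ^ r * ((x + y) ^ r + (z + w) ^ r)"
    using ennreal_add_power_le[of "x + y" "z + w" r] by (simp add: add.assoc)
  also have "\<dots> \<le> 2 ^ r * (2 ^ r * (x ^ r + y ^ r) + 2 ^ r * (z ^ r + w ^ r))"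
    by (intro mult_left_mono add_mono ennreal_add_power_le) auto
  also have "\<dots> = (2 * 2) ^ r * (x ^ r + y ^ r + z ^ r + w ^ r)"
    by (simp only: power_mult_distrib distrib_left mult.assoc add.assoc)
  finally show ?thesis by simp
qed

lemma dyadic_sup_measurable:
  assumes ab: "a < b" and meas: "\<And>s t. s < t \<Longrightarrow> (\<lambda>\<omega>. F \<omega> s t) \<in> borel_measurable M"
  shows "(\<lambda>\<omega>. dyadic_sup a b e (F \<omega>)) \<in> borel_measurable M"
  unfolding dyadic_sup_def
proof (rule borel_measurable_SUP)
  fix z :: "nat \<times> nat"
  have "dyadic a b (fst z) (snd z) < dyadic a b (fst z) (Suc (snd z))"
    using ab by (simp add: dyadic_def divide_strict_right_mono)
  note [measurable] = meas[OF this]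
  show "(\<lambda>\<omega>. case z of (n, k) \<Rightarrow> ennreal (F \<omega> (dyadic a b n k) (dyadic a b n (Suc k)) / ((b - a) / 2 ^ n) powr e)) \<in> borel_measurable M"
    unfolding case_prod_beta' by measurable
qed auto

text \<open>The hypotheses of the criterion: \<open>g\<close> is the Hoelder exponent in the mean
  and \<kappa> the size of the difference, while \<open>Y\<close> itself carries no factor \<kappa>.
  Path moments are needed at order \<open>2 * r\<close> as well, because the squared suprema in
  \<open>rough_dist_le_sup\<close> are raised to the power \<open>r\<close>.\<close>

definition rough_moments ::
    "'a measure \<Rightarrow> real \<Rightarrow> real \<Rightarrow> real \<Rightarrow> nat \<Rightarrow> real \<Rightarrow> real \<Rightarrow>
      ('a \<Rightarrow> real \<Rightarrow> real^'m::finite) \<Rightarrow> ('a \<Rightarrow> real \<Rightarrow> real \<Rightarrow> real^'m^'m) \<Rightarrow>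
      ('a \<Rightarrow> real \<Rightarrow> real^'m) \<Rightarrow> ('a \<Rightarrow> real \<Rightarrow> real \<Rightarrow> real^'m^'m) \<Rightarrow> bool"
  where "rough_moments M a b g r A \<kappa> X XX Y YY \<longleftrightarrow>
    (\<forall>\<omega>\<in>space M. rough_path (X \<omega>) (XX \<omega>) \<and> rough_path (Y \<omega>) (YY \<omega>)) \<and>
    (\<forall>t. (\<lambda>\<omega>. X \<omega> t) \<in> borel_measurable M \<and> (\<lambda>\<omega>. Y \<omega> t) \<in> borel_measurable M) \<and>
    (\<forall>s t. s \<le> t \<longrightarrow> (\<lambda>\<omega>. XX \<omega> s t) \<in> borel_measurable M \<and> (\<lambda>\<omega>. YY \<omega> s t) \<in> borel_measurable M) \<and>
    (\<forall>s t. a \<le> s \<and> s < t \<and> t \<le> b \<longrightarrow>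
      (\<forall>k\<in>{r, 2 * r}. (moment M k (\<lambda>\<omega>. norm (X \<omega> t - X \<omega> s - Y \<omega> t + Y \<omega> s)))
        \<le> ennreal (A * \<kappa> ^ k * (t - s) powr (g * real k))) \<and>
      (moment M (2 * r) (\<lambda>\<omega>. norm (Y \<omega> t - Y \<omega> s))) \<le> ennreal (A * (t - s) powr (g * real (2 * r))) \<and>
      (moment M r (\<lambda>\<omega>. norm (XX \<omega> s t - YY \<omega> s t)))
        \<le> ennreal (A * \<kappa> ^ r * (t - s) powr (2 * g * real r)))"

lemma rough_moments_measurable:
  assumes "rough_moments M a b g r A \<kappa> X XX Y YY"
  shows "(\<lambda>\<omega>. rough_dist \<beta> s t (X \<omega>, XX \<omega>) (Y \<omega>, YY \<omega>)) \<in> borel_measurable M"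
    and "(\<lambda>\<omega>. rough_norm \<beta> s t (X \<omega>, XX \<omega>)) \<in> borel_measurable M"
proof -
  note * = assms[unfolded rough_moments_def]
  show "(\<lambda>\<omega>. rough_dist \<beta> s t (X \<omega>, XX \<omega>) (Y \<omega>, YY \<omega>)) \<in> borel_measurable M"
    by (rule rough_measurable(1)) (use * in auto)
  have [measurable]: "(\<lambda>\<omega>. holder1 \<beta> s t (X \<omega>)) \<in> borel_measurable M"
    by (rule rough_measurable(2)[of M X XX X XX]) (use * in auto)
  have [measurable]: "(\<lambda>\<omega>. holder2 (2 * \<beta>) s t (XX \<omega>)) \<in> borel_measurable M"
    by (rule rough_measurable(3)[of M X XX X XX]) (use * in auto)
  show "(\<lambda>\<omega>. rough_norm \<beta> s t (X \<omega>, XX \<omega>)) \<in> borel_measurable M"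
    unfolding rough_norm_def prod.case by measurable
qed

text \<open>With the Young weight equal to the size \<kappa>, all four terms have
  \<open>r\<close>-th moments of order \<open>\<kappa> ^ r\<close>: in the last one
  \<open>\<kappa> ^ (2 * r)\<close> meets \<open>(1 / \<kappa>) ^ r\<close>. \<open>K\<close> is
  chosen before \<kappa>, \<beta> and the processes.\<close>

lemma rough_dist_moment:
  fixes M :: "'a measure" and a b e g A :: real and r :: nat
  assumes ab: "a < b" and e: "0 < e" and ge: "(g - e) * real r > 1" and A: "A > 0" and r: "r > 0"
  shows "\<exists>K>0. \<forall>(X :: 'a \<Rightarrow> real \<Rightarrow> real^'m::finite) XX Y YY \<kappa> \<beta> s t.
    rough_moments M a b g r A \<kappa> X XX Y YY \<longrightarrow> 0 < \<kappa> \<longrightarrow> \<kappa> \<le> 1 \<longrightarrow> 0 < \<beta> \<longrightarrow> \<beta> \<le> e \<longrightarrow>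
    a \<le> s \<longrightarrow> s \<le> t \<longrightarrow> t \<le> b \<longrightarrow>
    (\<integral>\<^sup>+ \<omega>. rough_dist \<beta> s t (X \<omega>, XX \<omega>) (Y \<omega>, YY \<omega>) ^ r \<partial>M) \<le> ennreal ((K * \<kappa>) ^ r)"
proof -
  obtain C where C: "C > 0" and dist: "\<And>(X :: real \<Rightarrow> real^'m) XX Y YY \<kappa> \<beta> s t. rough_path X XX \<Longrightarrow> rough_path Y YY \<Longrightarrow>
    0 < \<kappa> \<Longrightarrow> \<kappa> \<le> 1 \<Longrightarrow> 0 < \<beta> \<Longrightarrow> \<beta> \<le> e \<Longrightarrow> a \<le> s \<Longrightarrow> s \<le> t \<Longrightarrow> t \<le> b \<Longrightarrow>
    rough_dist \<beta> s t (X, XX) (Y, YY) \<le> ennreal C *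
      (dyadic_sup a b e (\<lambda>s t. norm (X t - X s - Y t + Y s))
       + dyadic_sup a b (2 * e) (\<lambda>s t. norm (XX s t - YY s t))
       + ennreal \<kappa> * dyadic_sup a b e (\<lambda>s t. norm (Y t - Y s)) ^ 2
       + ennreal (1 / \<kappa>) * dyadic_sup a b e (\<lambda>s t. norm (X t - X s - Y t + Y s)) ^ 2)"
    using rough_dist_le_sup[OF ab e, where 'm = 'm] by blast
  define c1 where "c1 = dyadic_moment_const a b ((g - e) * real r)"
  define c2 where "c2 = dyadic_moment_const a b ((2 * g - 2 * e) * real r)"
  define c3 where "c3 = dyadic_moment_const a b ((g - e) * real (2 * r))"
  have ge2: "(2 * g - 2 * e) * real r > 1" "(g - e) * real (2 * r) > 1"
    using ge by (simp_all add: left_diff_distrib)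
  have c: "c1 > 0" "c2 > 0" "c3 > 0"
    unfolding c1_def c2_def c3_def using dyadic_moment_const_pos ab ge ge2 by blast+
  define B where "B = A * (c1 + c2 + 2 * c3)"
  have B: "B > 0" using A c by (simp add: B_def)
  \<comment> \<open>The 4 stems from raising a sum of four terms to the power \<open>r\<close>;
    \<open>1 + B\<close> appears because \<open>B \<le> (1 + B) ^ r\<close> brings \<open>B\<close>
    under that power.\<close>
  define K where "K = 4 * C * (1 + B)"
  have K: "K > 0" using C B by (simp add: K_def)
  show ?thesis
  proof (intro exI[of _ K] conjI K allI impI)
    fix X Y :: "'a \<Rightarrow> real \<Rightarrow> real^'m" and XX YY and \<kappa> \<beta> s t :: real
    assume RM: "rough_moments M a b g r A \<kappa> X XX Y YY" and \<kappa>: "0 < \<kappa>" "\<kappa> \<le> 1"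
      and \<beta>: "0 < \<beta>" "\<beta> \<le> e" and st: "a \<le> s" "s \<le> t" "t \<le> b"
    note RM' = RM[unfolded rough_moments_def]
    note [measurable] = RM'[THEN conjunct2, THEN conjunct1, rule_format, THEN conjunct1]
      RM'[THEN conjunct2, THEN conjunct1, rule_format, THEN conjunct2]
    let ?FZ = "\<lambda>\<omega> s t. norm (X \<omega> t - X \<omega> s - Y \<omega> t + Y \<omega> s)" and ?FD = "\<lambda>\<omega> s t. norm (XX \<omega> s t - YY \<omega> s t)"
      and ?FY = "\<lambda>\<omega> s t. norm (Y \<omega> t - Y \<omega> s)"
    define SZ where "SZ \<omega> = dyadic_sup a b e (?FZ \<omega>)" for \<omega>
    define SD where "SD \<omega> = dyadic_sup a b (2 * e) (?FD \<omega>)" for \<omega>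
    define SY where "SY \<omega> = dyadic_sup a b e (?FY \<omega>)" for \<omega>
    have mF: "(\<lambda>\<omega>. ?FZ \<omega> s t) \<in> borel_measurable M" "(\<lambda>\<omega>. ?FY \<omega> s t) \<in> borel_measurable M" for s t
      by measurable
    have mD: "(\<lambda>\<omega>. ?FD \<omega> s t) \<in> borel_measurable M" if "s < t" for s t
    proof -
      have [measurable]: "(\<lambda>\<omega>. XX \<omega> s t) \<in> borel_measurable M" "(\<lambda>\<omega>. YY \<omega> s t) \<in> borel_measurable M"
        using RM' that by auto
      show ?thesis by measurable
    qed
    have [measurable]: "SZ \<in> borel_measurable M" "SY \<in> borel_measurable M" "SD \<in> borel_measurable M"
      unfolding SZ_def SY_def SD_def by (intro dyadic_sup_measurable ab mF mD; assumption)+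
    have mom: "moment M r (\<lambda>\<omega>. ?FZ \<omega> s t) \<le> ennreal (A * \<kappa> ^ r * (t - s) powr (g * real r))"
      "moment M (2 * r) (\<lambda>\<omega>. ?FZ \<omega> s t) \<le> ennreal (A * \<kappa> ^ (2 * r) * (t - s) powr (g * real (2 * r)))"
      "moment M (2 * r) (\<lambda>\<omega>. ?FY \<omega> s t) \<le> ennreal (A * (t - s) powr (g * real (2 * r)))"
      "moment M r (\<lambda>\<omega>. ?FD \<omega> s t) \<le> ennreal (A * \<kappa> ^ r * (t - s) powr (2 * g * real r))"
      if "a \<le> s" "s < t" "t \<le> b" for s t
      using RM' that by blast+
    have 1: "(\<integral>\<^sup>+ \<omega>. SZ \<omega> ^ r \<partial>M) \<le> ennreal (A * \<kappa> ^ r * c1)"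
      unfolding SZ_def c1_def
      by (rule dyadic_sup_moment[OF ab r refl ge _ _ mF(1) mom(1)]) (use A \<kappa> in auto)
    have 2: "(\<integral>\<^sup>+ \<omega>. SD \<omega> ^ r \<partial>M) \<le> ennreal (A * \<kappa> ^ r * c2)"
      unfolding SD_def c2_def
      by (rule dyadic_sup_moment[OF ab r refl ge2(1) _ _ mD mom(4)]) (use A \<kappa> in auto)
    have 3: "(\<integral>\<^sup>+ \<omega>. SY \<omega> ^ (2 * r) \<partial>M) \<le> ennreal (A * c3)"
      unfolding SY_def c3_def
      by (rule dyadic_sup_moment[OF ab _ refl ge2(2) _ _ mF(2) mom(3)]) (use A r in auto)
    have 4: "(\<integral>\<^sup>+ \<omega>. SZ \<omega> ^ (2 * r) \<partial>M) \<le> ennreal (A * \<kappa> ^ (2 * r) * c3)"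
      unfolding SZ_def c3_def
      by (rule dyadic_sup_moment[OF ab _ refl ge2(2) _ _ mF(1) mom(2)]) (use A r \<kappa> in auto)
    have "(\<integral>\<^sup>+ \<omega>. rough_dist \<beta> s t (X \<omega>, XX \<omega>) (Y \<omega>, YY \<omega>) ^ r \<partial>M) \<le>
      (\<integral>\<^sup>+ \<omega>. (ennreal C ^ r * 4 ^ r) * (SZ \<omega> ^ r + SD \<omega> ^ r + ennreal \<kappa> ^ r * SY \<omega> ^ (2 * r) + ennreal (1 / \<kappa>) ^ r * SZ \<omega> ^ (2 * r)) \<partial>M)"
    proof (rule nn_integral_mono)
      fix \<omega> assume "\<omega> \<in> space M"
      then have "rough_dist \<beta> s t (X \<omega>, XX \<omega>) (Y \<omega>, YY \<omega>) \<le>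
        ennreal C * (SZ \<omega> + SD \<omega> + ennreal \<kappa> * SY \<omega> ^ 2 + ennreal (1 / \<kappa>) * SZ \<omega> ^ 2)"
        unfolding SZ_def SD_def SY_def using RM' by (intro dist \<kappa> \<beta> st) auto
      then have "rough_dist \<beta> s t (X \<omega>, XX \<omega>) (Y \<omega>, YY \<omega>) ^ r \<le>
        (ennreal C * (SZ \<omega> + SD \<omega> + ennreal \<kappa> * SY \<omega> ^ 2 + ennreal (1 / \<kappa>) * SZ \<omega> ^ 2)) ^ r"
        by (rule power_mono) simp
      also have "\<dots> \<le> ennreal C ^ r * (4 ^ r * (SZ \<omega> ^ r + SD \<omega> ^ r + (ennreal \<kappa> * SY \<omega> ^ 2) ^ r + (ennreal (1 / \<kappa>) * SZ \<omega> ^ 2) ^ r))"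
        unfolding power_mult_distrib[of "ennreal C"] by (intro mult_left_mono ennreal_add4_power_le) simp
      also have "\<dots> = (ennreal C ^ r * 4 ^ r) * (SZ \<omega> ^ r + SD \<omega> ^ r + ennreal \<kappa> ^ r * SY \<omega> ^ (2 * r) + ennreal (1 / \<kappa>) ^ r * SZ \<omega> ^ (2 * r))"
        by (simp only: power_mult_distrib power_mult[symmetric] mult.assoc)
      finally show "rough_dist \<beta> s t (X \<omega>, XX \<omega>) (Y \<omega>, YY \<omega>) ^ r \<le> \<dots>" .
    qed
    also have "\<dots> = (ennreal C ^ r * 4 ^ r) * ((\<integral>\<^sup>+ \<omega>. SZ \<omega> ^ r \<partial>M) + (\<integral>\<^sup>+ \<omega>. SD \<omega> ^ r \<partial>M)
        + ennreal \<kappa> ^ r * (\<integral>\<^sup>+ \<omega>. SY \<omega> ^ (2 * r) \<partial>M) + ennreal (1 / \<kappa>) ^ r * (\<integral>\<^sup>+ \<omega>. SZ \<omega> ^ (2 * r) \<partial>M))"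
      by (simp add: nn_integral_cmult nn_integral_add)
    also have "\<dots> \<le> (ennreal C ^ r * 4 ^ r) * (ennreal (A * \<kappa> ^ r * c1) + ennreal (A * \<kappa> ^ r * c2)
        + ennreal \<kappa> ^ r * ennreal (A * c3) + ennreal (1 / \<kappa>) ^ r * ennreal (A * \<kappa> ^ (2 * r) * c3))"
      by (intro mult_left_mono add_mono 1 2 3 4) auto
    also have "\<dots> = ennreal ((C ^ r * 4 ^ r) * (A * \<kappa> ^ r * c1 + A * \<kappa> ^ r * c2 + \<kappa> ^ r * (A * c3) + (1 / \<kappa>) ^ r * (A * \<kappa> ^ (2 * r) * c3)))"
    proof -
      have four: "(4::ennreal) ^ r = ennreal (4 ^ r)" by (simp add: ennreal_power[symmetric])
      have nn: "A * \<kappa> ^ r * c1 \<ge> 0" "A * \<kappa> ^ r * c2 \<ge> 0" "\<kappa> ^ r * (A * c3) \<ge> 0" "(1 / \<kappa>) ^ r * (A * \<kappa> ^ (2 * r) * c3) \<ge> 0"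
        "A * c3 \<ge> 0" "A * \<kappa> ^ (2 * r) * c3 \<ge> 0" "\<kappa> ^ r \<ge> 0" "(1 / \<kappa>) ^ r \<ge> 0" "C ^ r \<ge> 0"
        using A \<kappa> c C by auto
      show ?thesis
        using nn \<kappa> C unfolding four
        by (simp only: ennreal_power ennreal_mult[symmetric] ennreal_plus[symmetric] add_nonneg_nonneg mult_nonneg_nonneg
            less_imp_le divide_nonneg_nonneg zero_le_one zero_le_power zero_le_numeral)
    qed
    also have "A * \<kappa> ^ r * c1 + A * \<kappa> ^ r * c2 + \<kappa> ^ r * (A * c3) + (1 / \<kappa>) ^ r * (A * \<kappa> ^ (2 * r) * c3) = B * \<kappa> ^ r"
    proof -
      have "(1 / \<kappa>) ^ r * \<kappa> ^ (2 * r) = \<kappa> ^ r"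
        using \<kappa> by (simp add: power_divide mult_2 power_add)
      then have "(1 / \<kappa>) ^ r * (A * \<kappa> ^ (2 * r) * c3) = A * \<kappa> ^ r * c3" by (metis mult.assoc mult.commute)
      then show ?thesis by (simp add: B_def algebra_simps)
    qed
    also have "(C ^ r * 4 ^ r) * (B * \<kappa> ^ r) \<le> (K * \<kappa>) ^ r"
    proof -
      have "B \<le> (1 + B) ^ r"
        using B r self_le_power[of "1 + B" r] by simp
      then have "(C ^ r * 4 ^ r) * (B * \<kappa> ^ r) \<le> (C ^ r * 4 ^ r) * ((1 + B) ^ r * \<kappa> ^ r)"
        using C \<kappa> by (intro mult_left_mono mult_right_mono) auto
      also have "\<dots> = (K * \<kappa>) ^ r" unfolding K_def power_mult_distrib by (simp only: mult_ac)
      finally show ?thesis .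
    qed
    finally show "(\<integral>\<^sup>+ \<omega>. rough_dist \<beta> s t (X \<omega>, XX \<omega>) (Y \<omega>, YY \<omega>) ^ r \<partial>M) \<le> ennreal ((K * \<kappa>) ^ r)"
      by (simp add: ennreal_leI)
  qed
qed

text \<open>Transfers \<open>r\<close>-th moments of distances to norms: \<open>f\<close> is meant
  to be a rough norm, \<open>g\<close> and \<open>h\<close> the distances along a chain ending at
  the zero rough path.\<close>

lemma in_Lp_dominated:
  assumes M: "prob_space M" and p: "0 < p" "p \<le> real r"
    and f: "f \<in> borel_measurable M" and g: "g \<in> borel_measurable M" "(\<integral>\<^sup>+ x. g x ^ r \<partial>M) < \<infinity>"
    and h: "h \<in> borel_measurable M" "(\<integral>\<^sup>+ x. h x ^ r \<partial>M) < \<infinity>"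
    and le: "\<And>x. f x \<le> 1 + 2 * (g x + h x)"
  shows "in_Lp M p f"
proof -
  interpret prob_space M by (rule M)
  have "(\<integral>\<^sup>+ x. f x ^ r \<partial>M) \<le> (\<integral>\<^sup>+ x. 4 ^ r * (1 + (2 ^ r * g x ^ r + 2 ^ r * h x ^ r)) \<partial>M)"
  proof (rule nn_integral_mono)
    fix x
    have "f x ^ r \<le> (1 + 2 * g x + 2 * h x + 0) ^ r"
      using le[of x] by (intro power_mono) (auto simp: distrib_left add.assoc)
    also have "\<dots> \<le> 4 ^ r * (1 ^ r + (2 * g x) ^ r + (2 * h x) ^ r + 0 ^ r)" by (rule ennreal_add4_power_le)
    also have "(0::ennreal) ^ r = 0" using p by (intro zero_power) (cases r, auto)
    finally show "f x ^ r \<le> 4 ^ r * (1 + (2 ^ r * g x ^ r + 2 ^ r * h x ^ r))"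
      by (simp add: power_mult_distrib add.assoc)
  qed
  also have "\<dots> = 4 ^ r * (1 + (2 ^ r * (\<integral>\<^sup>+ x. g x ^ r \<partial>M) + 2 ^ r * (\<integral>\<^sup>+ x. h x ^ r \<partial>M)))"
    using g(1) h(1) by (simp add: nn_integral_cmult nn_integral_add emeasure_space_1)
  also have "\<dots> < \<infinity>" using g(2) h(2) by (simp add: ennreal_mult_less_top power_less_top_ennreal)
  finally obtain z where z: "(\<integral>\<^sup>+ x. f x ^ r \<partial>M) = ennreal z" "z \<ge> 0"
    by (cases "\<integral>\<^sup>+ x. f x ^ r \<partial>M") auto
  have "r > 0" using p by (cases r) auto
  \<comment> \<open>A finite bound is rewritten as an \<open>r\<close>-th power, the form that
    \<open>Lp_from_moment\<close> expects.\<close>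
  then have "z \<le> (1 + z) ^ r" using z self_le_power[of "1 + z" r] by simp
  then have "(\<integral>\<^sup>+ x. f x ^ r \<partial>M) \<le> ennreal ((1 + z) ^ r)" using z by (simp add: ennreal_leI)
  then have "Lp_norm M p f \<le> ennreal (2 powr (1 / p) * (1 + z))"
    using z by (intro Lp_from_moment[OF M _ p f]) auto
  then show ?thesis unfolding in_Lp_def using f by (auto intro: order.strict_trans1)
qed

section \<open>Moment hypotheses for Brownian motion and its approximation\<close>

lemma min_power_le:
  fixes \<delta> h \<rho> :: real
  assumes "\<delta> > 0" "h > 0" "\<rho> > 1"
  shows "min \<delta> h ^ k \<le> (\<delta> powr ((1 / 2) * (1 - 1 / \<rho>))) ^ (2 * k) * h powr (1 / (2 * \<rho>) * real (2 * k))"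
proof -
  let ?m = "min \<delta> h" and ?c = "1 - 1 / \<rho>"
  have m: "?m > 0" using assms by simp
  have c: "?c > 0" "1 / \<rho> > 0" using assms by (auto simp: field_simps)
  have "?m = ?m powr ?c * ?m powr (1 / \<rho>)" using m by (simp add: powr_add[symmetric])
  also have "\<dots> \<le> \<delta> powr ?c * h powr (1 / \<rho>)"
    using m c by (intro mult_mono powr_mono2) auto
  finally have "?m ^ k \<le> (\<delta> powr ?c * h powr (1 / \<rho>)) ^ k" using m by (intro power_mono) auto
  also have "\<dots> = \<delta> powr (?c * real k) * h powr (1 / \<rho> * real k)"
    using assms by (simp add: power_mult_distrib powr_powr powr_realpow[symmetric])
  also have "\<delta> powr (?c * real k) = (\<delta> powr ((1 / 2) * ?c)) ^ (2 * k)"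
    using assms(1) by (simp add: powr_powr powr_realpow[symmetric])
  also have "1 / \<rho> * real k = 1 / (2 * \<rho>) * real (2 * k)" by simp
  finally show ?thesis .
qed

text \<open>Lowers the exponent from 1/2 to \<open>1 / (2 * \<rho>)\<close>; on lengths of at most
  \<open>2 * T\<close> the surplus \<open>h powr (1 - 1 / \<rho>)\<close> is bounded by
  \<open>1 + 2 * T\<close>.\<close>

lemma power_le_powr:
  fixes h T \<rho> :: real
  assumes "0 < h" "h \<le> 2 * T" "\<rho> > 1"
  shows "h ^ k \<le> (1 + 2 * T) ^ k * h powr (1 / (2 * \<rho>) * real (2 * k))"
proof -
  have c: "0 \<le> 1 - 1 / \<rho>" "1 - 1 / \<rho> \<le> 1" using assms by (auto simp: field_simps)
  have "h powr (1 - 1 / \<rho>) \<le> (1 + 2 * T) powr (1 - 1 / \<rho>)" using assms c by (intro powr_mono2) auto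
  also have "\<dots> \<le> (1 + 2 * T) powr 1" using assms c by (intro powr_mono) auto
  finally have "h powr (1 - 1 / \<rho>) * h powr (1 / \<rho>) \<le> (1 + 2 * T) * h powr (1 / \<rho>)"
    using assms by (intro mult_right_mono) auto
  then have "h \<le> (1 + 2 * T) * h powr (1 / \<rho>)" using assms by (simp add: powr_add[symmetric])
  then have "h ^ k \<le> ((1 + 2 * T) * h powr (1 / \<rho>)) ^ k" using assms by (intro power_mono) auto
  also have "\<dots> = (1 + 2 * T) ^ k * h powr (1 / \<rho> * real k)"
    using assms by (simp add: power_mult_distrib powr_powr powr_realpow[symmetric])
  also have "1 / \<rho> * real k = 1 / (2 * \<rho>) * real (2 * k)" by simp
  finally show ?thesis .
qed

lemma BM_norm_moment:
  fixes M :: "(real \<Rightarrow> real^'m::finite) measure"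
  assumes M: "canonical_BM M" and k: "k > 0" and h: "s < t" "t - s \<le> 2 * T" and \<rho>: "\<rho> > 1"
  shows "moment M (2 * k) (\<lambda>\<omega>. norm (\<omega> t - \<omega> s)) \<le>
    ennreal (real CARD('m) ^ (2 * k) * (gauss_const k * (1 + 2 * T) ^ k) * (t - s) powr (1 / (2 * \<rho>) * real (2 * k)))"
proof -
  note [measurable] = BM_measurable[OF M]
  have g: "gauss_const k > 0" by (rule gauss_const_pos)
  have "moment M (2 * k) (\<lambda>\<omega>. norm (\<omega> t - \<omega> s)) \<le> ennreal (real CARD('m) ^ (2 * k) * (gauss_const k * (t - s) ^ k))"
    by (rule moment_vector_norm[OF k]) (use g h BM_increment_moment[OF M k] in auto)
  also have "\<dots> \<le> ennreal (real CARD('m) ^ (2 * k) * (gauss_const k * ((1 + 2 * T) ^ k * (t - s) powr (1 / (2 * \<rho>) * real (2 * k)))))"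
    using g h \<rho> by (intro ennreal_leI mult_left_mono power_le_powr) auto
  finally show ?thesis by (simp only: mult.assoc)
qed

text \<open>The zero rough path serves as reference, with \<kappa> = 1; this feeds the integrability
  of the Brownian rough norm.\<close>

lemma brownian_rough_moments:
  fixes M :: "(real \<Rightarrow> real^'m::{finite,linorder}) measure"
  assumes M: "canonical_BM M" and W: "brownian_area M WW" and T: "T > 0" and \<rho>: "\<rho> > 1" and n: "n > 0"
  shows "\<exists>A>0. rough_moments M (-T) T (1 / (2 * \<rho>)) (2 * n) A 1 (\<lambda>\<omega>. \<omega>) WW (\<lambda>_ _. 0) (\<lambda>_ _ _. 0)"
proof -
  let ?N = "real CARD('m)"
  define A1 where "A1 k = ?N ^ (2 * k) * (gauss_const k * (1 + 2 * T) ^ k)" for k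
  define A2 where "A2 = (?N\<^sup>2) ^ (2 * n) * (4 ^ n * (16 ^ n * gauss_const (2 * n) + (gauss_const n)\<^sup>2)) * (1 + 2 * T) ^ (2 * n)"
  define A where "A = A1 n + A1 (2 * n) + A2 + 1"
  have g: "gauss_const k > 0" for k by (rule gauss_const_pos)
  have A1: "A1 k \<ge> 0" for k using g[of k] T by (simp add: A1_def)
  have A2: "A2 \<ge> 0" using g[of "2 * n"] T by (simp add: A2_def)
  have A: "A > 0" "A1 n \<le> A" "A1 (2 * n) \<le> A" "A2 \<le> A" using A1[of n] A1[of "2 * n"] A2 by (auto simp: A_def)
  have Z: "moment M (2 * k) (\<lambda>\<omega>. norm (\<omega> t - \<omega> s)) \<le> ennreal (A * (t - s) powr (1 / (2 * \<rho>) * real (2 * k)))"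
    if "-T \<le> s" "s < t" "t \<le> T" "k = n \<or> k = 2 * n" for s t k
  proof -
    have k: "k > 0" "A1 k \<le> A" using that n A by auto
    have h: "t - s \<le> 2 * T" using that by simp
    show ?thesis
      by (rule order_trans[OF BM_norm_moment[OF M k(1) that(2) h \<rho>]])
        (use k(2) in \<open>auto simp: A1_def intro!: ennreal_leI mult_right_mono\<close>)
  qed
  have D: "moment M (2 * n) (\<lambda>\<omega>. norm (WW \<omega> s t)) \<le> ennreal (A * (t - s) powr (2 * (1 / (2 * \<rho>)) * real (2 * n)))"
    if st: "-T \<le> s" "s < t" "t \<le> T" for s t
  proof -
    have h: "0 < t - s" "t - s \<le> 2 * T" using st by auto
    note [measurable] = BM_measurable[OF M] matrix_nth_measurable[OF brownian_area_measurable[OF M W less_imp_le[OF st(2)]]]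
    let ?c = "4 ^ n * (16 ^ n * gauss_const (2 * n) + (gauss_const n)\<^sup>2)"
    have comp: "moment M (2 * n) (\<lambda>\<omega>. WW \<omega> s t $ i $ j) \<le> ennreal (?c * ((t - s) * (t - s)) ^ n)" for i j
    \<comment> \<open>With \<open>Y = 0\<close> and both lengths equal to \<open>t - s\<close>, the
      symmetric part is just the product of Brownian increments.\<close>
    proof (rule area_moment_all_components[where Z = "\<lambda>\<omega>. \<omega> t - \<omega> s" and Y = "\<lambda>_. 0", OF n h(1) order_refl g])
      show "WW \<omega> s t $ i $ j + WW \<omega> s t $ j $ i = (\<omega> t - \<omega> s) $ i * (\<omega> t - \<omega> s) $ j + (\<omega> t - \<omega> s) $ i * (0 :: real^'m::{finite,linorder}) $ j + (0 :: real^'m::{finite,linorder}) $ i * (\<omega> t - \<omega> s) $ j"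
        if "\<omega> \<in> space M" for \<omega> i j
        using brownian_area_sym[OF W that less_imp_le[OF st(2)], of i j] by simp
      show "moment M (2 * (2 * n)) (\<lambda>\<omega>. (\<omega> t - \<omega> s) $ i) \<le> ennreal (gauss_const (2 * n) * (t - s) ^ (2 * n))" for i
        using BM_increment_moment[OF M, of "2 * n" t i s] n st by simp
      show "moment M (2 * n) (\<lambda>\<omega>. WW \<omega> s t $ i $ j) \<le> ennreal ((gauss_const n)\<^sup>2 * ((t - s) * (t - s)) ^ n)"
        if "i < j" for i j
        by (rule area_moment_offdiagonal[OF M _ less_imp_neq[OF that] n st(2)]) (use W that st in \<open>auto simp: brownian_area_def\<close>)
    qed (use g[of "2 * n"] h n in \<open>auto simp: zero_power\<close>)
    have "moment M (2 * n) (\<lambda>\<omega>. norm (WW \<omega> s t)) \<le> ennreal ((?N\<^sup>2) ^ (2 * n) * (?c * ((t - s) * (t - s)) ^ n))"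
      by (rule moment_matrix_norm[OF n _ _ comp]) (use g[of "2 * n"] h in auto)
    also have "\<dots> \<le> ennreal ((?N\<^sup>2) ^ (2 * n) * (?c * ((1 + 2 * T) ^ (2 * n) * (t - s) powr (1 / (2 * \<rho>) * real (2 * (2 * n))))))"
      using power_le_powr[OF h \<rho>, of "2 * n"] g[of "2 * n"]
      by (intro ennreal_leI mult_left_mono) (auto simp: power_mult power2_eq_square)
    also have "\<dots> = ennreal (A2 * (t - s) powr (2 * (1 / (2 * \<rho>)) * real (2 * n)))"
      by (simp add: A2_def mult.assoc)
    also have "\<dots> \<le> ennreal (A * (t - s) powr (2 * (1 / (2 * \<rho>)) * real (2 * n)))"
      using A by (intro ennreal_leI mult_right_mono) auto
    finally show ?thesis .
  qed
  have "rough_moments M (-T) T (1 / (2 * \<rho>)) (2 * n) A 1 (\<lambda>\<omega>. \<omega>) WW (\<lambda>_ _. 0) (\<lambda>_ _ _. 0)"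
    unfolding rough_moments_def
    using brownian_rough_path[OF M W] rough_path_zero BM_measurable[OF M] brownian_area_measurable[OF M W] Z[of _ _ n] Z[of _ _ "2 * n"] D A(1) n
    by (auto simp: zero_power)
  then show ?thesis using A(1) by blast
qed

text \<open>The minimum of \<delta> and the length is traded for powers of \<kappa> by lowering the
  exponent of the length; \<open>A\<close> is chosen before \<delta>.\<close>

lemma approx_rough_moments:
  fixes M :: "(real \<Rightarrow> real^'m::{finite,linorder}) measure"
  assumes M: "canonical_BM M" and W: "brownian_area M WW" and T: "T > 0" and \<rho>: "\<rho> > 1" and n: "n > 0"
  shows "\<exists>A>0. \<forall>\<delta>>0. rough_moments M (-T) T (1 / (2 * \<rho>)) (2 * n) A (\<delta> powr ((1 / 2) * (1 - 1 / \<rho>)))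
    (approx_path \<delta>) (approx_area \<delta>) (\<lambda>\<omega>. \<omega>) WW"
proof -
  let ?N = "real CARD('m)" and ?g = "1 / (2 * \<rho>)"
  define A0 where "A0 k = ?N ^ (2 * k) * (4 ^ k * gauss_const k)" for k
  define A1 where "A1 = ?N ^ (2 * (2 * n)) * (gauss_const (2 * n) * (1 + 2 * T) ^ (2 * n))"
  \<comment> \<open>One constant serves both increments in
    \<open>area_moment_all_components\<close>; its factor \<open>4 ^ (2 * n)\<close> comes from
    \<open>approx_increment_moment\<close>.\<close>
  define a where "a = 4 ^ (2 * n) * gauss_const (2 * n)"
  define c where "c = 4 ^ n * (16 ^ n * a + (gauss_const n)\<^sup>2 * 4 ^ n)"
  define A2 where "A2 = (?N\<^sup>2) ^ (2 * n) * c * (1 + 2 * T) ^ n"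
  define A where "A = A0 n + A0 (2 * n) + A1 + A2 + 1"
  have g: "gauss_const k > 0" for k by (rule gauss_const_pos)
  have a: "a > 0" using g by (simp add: a_def)
  have c: "c \<ge> 0" using a by (simp add: c_def)
  have A0: "A0 k \<ge> 0" for k using g[of k] by (simp add: A0_def)
  have A12: "A1 \<ge> 0" "A2 \<ge> 0" using g[of "2 * n"] T c by (auto simp: A1_def A2_def)
  have A: "A > 0" "A0 n \<le> A" "A0 (2 * n) \<le> A" "A1 \<le> A" "A2 \<le> A"
    using A0[of n] A0[of "2 * n"] A12 by (auto simp: A_def)
  show ?thesis
  proof (intro exI[of _ A] conjI A(1) allI impI)
    fix \<delta> :: real assume \<delta>: "\<delta> > 0"
    define \<kappa> where "\<kappa> = \<delta> powr ((1 / 2) * (1 - 1 / \<rho>))"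
    have \<kappa>: "\<kappa> > 0" using \<delta> by (simp add: \<kappa>_def)
    note mm = approx_measurable(1)[OF M \<delta>] approx_measurable(2)[OF M \<delta>]
    have [measurable]: "(\<lambda>\<omega>. approx_path \<delta> \<omega> t) \<in> borel_measurable M" for t by (rule mm(1))
    have [measurable]: "(\<lambda>\<omega>. approx_path \<delta> \<omega> t $ i) \<in> borel_measurable M" for t i
      by (rule measurable_compose[OF mm(1)]) measurable
    note [measurable] = BM_measurable[OF M]
    have Z: "moment M (2 * k) (\<lambda>\<omega>. norm (approx_path \<delta> \<omega> t - approx_path \<delta> \<omega> s - \<omega> t + \<omega> s)) \<le>
        ennreal (A * \<kappa> ^ (2 * k) * (t - s) powr (?g * real (2 * k)))"
      if st: "-T \<le> s" "s < t" "t \<le> T" and k: "k = n \<or> k = 2 * n" for s t k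
    proof -
      have k': "k > 0" "A0 k \<le> A" using k n A by auto
      have h: "t - s > 0" using st by simp
      have "moment M (2 * k) (\<lambda>\<omega>. norm (approx_path \<delta> \<omega> t - approx_path \<delta> \<omega> s - \<omega> t + \<omega> s)) \<le>
        ennreal (?N ^ (2 * k) * (4 ^ k * (gauss_const k * min \<delta> (t - s) ^ k)))"
        by (rule moment_vector_norm[OF k'(1) _ _ approx_increment_moment[OF M \<delta> k'(1) st(2)]])
          (use g[of k] h \<delta> in auto)
      also have "\<dots> = ennreal (A0 k * min \<delta> (t - s) ^ k)" by (simp add: A0_def mult.assoc)
      also have "\<dots> \<le> ennreal (A * (\<kappa> ^ (2 * k) * (t - s) powr (?g * real (2 * k))))"
        unfolding \<kappa>_def using k' A0[of k] h \<delta> A(1) by (intro ennreal_leI mult_mono min_power_le \<rho>) auto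
      finally show ?thesis by (simp only: mult.assoc)
    qed
    have Y: "moment M (2 * (2 * n)) (\<lambda>\<omega>. norm (\<omega> t - \<omega> s)) \<le> ennreal (A * (t - s) powr (?g * real (2 * (2 * n))))"
      if st: "-T \<le> s" "s < t" "t \<le> T" for s t
    proof -
      have h: "t - s \<le> 2 * T" using st by simp
      have n2: "2 * n > 0" using n by simp
      show ?thesis
        by (rule order_trans[OF BM_norm_moment[OF M n2 st(2) h \<rho>]])
          (use A(4) in \<open>auto simp: A1_def intro!: ennreal_leI mult_right_mono\<close>)
    qed
    have D: "moment M (2 * n) (\<lambda>\<omega>. norm (approx_area \<delta> \<omega> s t - WW \<omega> s t)) \<le>
        ennreal (A * \<kappa> ^ (2 * n) * (t - s) powr (2 * ?g * real (2 * n)))"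
      if st: "-T \<le> s" "s < t" "t \<le> T" for s t
    proof -
      have h: "0 < t - s" "t - s \<le> 2 * T" using st by auto
      define m where "m = min \<delta> (t - s)"
      have m: "0 < m" "m \<le> t - s" using h \<delta> by (auto simp: m_def)
      note [measurable] = matrix_nth_measurable[OF brownian_area_measurable[OF M W less_imp_le[OF st(2)]]]
        matrix_nth_measurable[OF mm(2)[OF less_imp_le[OF st(2)]]]
      let ?D = "\<lambda>\<omega>. approx_area \<delta> \<omega> s t - WW \<omega> s t"
      have n2: "2 * n > 0" using n by simp
      have comp: "moment M (2 * n) (\<lambda>\<omega>. ?D \<omega> $ i $ j) \<le> ennreal (c * ((t - s) * m) ^ n)" for i j
        unfolding c_def
      proof (rule area_moment_all_components[where Z = "\<lambda>\<omega>. approx_path \<delta> \<omega> t - approx_path \<delta> \<omega> s - \<omega> t + \<omega> s" and Y = "\<lambda>\<omega>. \<omega> t - \<omega> s", OF n m a])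
        show "?D \<omega> $ i $ j + ?D \<omega> $ j $ i =
          (approx_path \<delta> \<omega> t - approx_path \<delta> \<omega> s - \<omega> t + \<omega> s) $ i * (approx_path \<delta> \<omega> t - approx_path \<delta> \<omega> s - \<omega> t + \<omega> s) $ j
          + (approx_path \<delta> \<omega> t - approx_path \<delta> \<omega> s - \<omega> t + \<omega> s) $ i * (\<omega> t - \<omega> s) $ j
          + (\<omega> t - \<omega> s) $ i * (approx_path \<delta> \<omega> t - approx_path \<delta> \<omega> s - \<omega> t + \<omega> s) $ j"
          if "\<omega> \<in> space M" for \<omega> i j
          using brownian_area_sym[OF W that less_imp_le[OF st(2)], of i j]
            approx_area_parts[OF BM_path(1)[OF M that] \<delta>, of s t i j]
          by (simp add: algebra_simps)
        show "moment M (2 * (2 * n)) (\<lambda>\<omega>. (approx_path \<delta> \<omega> t - approx_path \<delta> \<omega> s - \<omega> t + \<omega> s) $ i) \<le> ennreal (a * m ^ (2 * n))" for i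
          using approx_increment_moment[OF M \<delta> n2 st(2), of i] by (simp only: a_def m_def mult.assoc)
        show "moment M (2 * (2 * n)) (\<lambda>\<omega>. (\<omega> t - \<omega> s) $ i) \<le> ennreal (a * (t - s) ^ (2 * n))" for i
        proof -
          have "gauss_const (2 * n) \<le> a"
            unfolding a_def using mult_right_mono[OF one_le_power[of "4 :: real" "2 * n"] less_imp_le[OF g[of "2 * n"]]] by simp
          then have "gauss_const (2 * n) * (t - s) ^ (2 * n) \<le> a * (t - s) ^ (2 * n)"
            using h by (intro mult_right_mono) auto
          then show ?thesis using BM_increment_moment[OF M n2, of t i s] h by (simp add: ennreal_leI)
        qed
        show "moment M (2 * n) (\<lambda>\<omega>. ?D \<omega> $ i $ j) \<le> ennreal ((gauss_const n)\<^sup>2 * 4 ^ n * ((t - s) * m) ^ n)"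
          if "i < j" for i j
          using area_diff_moment[OF M W that n \<delta> st(2)] by (simp add: m_def power_mult_distrib mult.assoc)
      qed simp_all
      have "moment M (2 * n) (\<lambda>\<omega>. norm (?D \<omega>)) \<le> ennreal ((?N\<^sup>2) ^ (2 * n) * (c * ((t - s) * m) ^ n))"
        by (rule moment_matrix_norm[OF n _ _ comp]) (use c h m in auto)
      also have "\<dots> = ennreal (((?N\<^sup>2) ^ (2 * n) * c) * ((t - s) ^ n * m ^ n))"
        by (simp only: power_mult_distrib mult.assoc)
      \<comment> \<open>Only the factor \<open>m ^ n\<close> yields \<kappa>; the plain power
        \<open>(t - s) ^ n\<close> gives up part of its exponent, so that the two exponents add up
        to \<open>2 * ?g * real (2 * n)\<close>.\<close>
      also have "\<dots> \<le> ennreal (((?N\<^sup>2) ^ (2 * n) * c) * (((1 + 2 * T) ^ n * (t - s) powr (?g * real (2 * n))) * (\<kappa> ^ (2 * n) * (t - s) powr (?g * real (2 * n)))))"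
        unfolding m_def \<kappa>_def using c h \<delta> T
        by (intro ennreal_leI mult_left_mono mult_mono power_le_powr min_power_le \<rho>) auto
      also have "\<dots> = ennreal (A2 * (\<kappa> ^ (2 * n) * (t - s) powr (2 * ?g * real (2 * n))))"
      proof -
        have "(t - s) powr (2 * ?g * real (2 * n)) = (t - s) powr (?g * real (2 * n)) * (t - s) powr (?g * real (2 * n))"
          by (simp add: powr_add[symmetric])
        then show ?thesis by (simp only: A2_def mult_ac)
      qed
      also have "\<dots> \<le> ennreal (A * (\<kappa> ^ (2 * n) * (t - s) powr (2 * ?g * real (2 * n))))"
        using A \<kappa> by (intro ennreal_leI mult_right_mono) auto
      finally show ?thesis by (simp only: mult.assoc)
    qed
    have "rough_moments M (-T) T ?g (2 * n) A \<kappa> (approx_path \<delta>) (approx_area \<delta>) (\<lambda>\<omega>. \<omega>) WW"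
      unfolding rough_moments_def
      using brownian_rough_path[OF M W] rough_path_approx[OF BM_path(1)[OF M] \<delta>] mm BM_measurable[OF M]
        brownian_area_measurable[OF M W] Z[of _ _ n] Z[of _ _ "2 * n"] Y D
      by blast
    then show "rough_moments M (-T) T ?g (2 * n) A (\<delta> powr ((1 / 2) * (1 - 1 / \<rho>))) (approx_path \<delta>) (approx_area \<delta>) (\<lambda>\<omega>. \<omega>) WW"
      by (simp only: \<kappa>_def)
  qed
qed

theorem theorem13:
  fixes M :: "(real \<Rightarrow> real^'m::{finite,linorder}) measure"
    and WW :: "(real \<Rightarrow> real^'m::{finite,linorder}) \<Rightarrow> real \<Rightarrow> real \<Rightarrow>
      real^'m::{finite,linorder}^'m::{finite,linorder}"
    and T \<rho> q :: real
  assumes "canonical_BM M" and "brownian_area M WW"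
    and "T > 0" and "\<rho> > 1" and "q > 1" and "1 / \<rho> - 1 / q > 2 / 3"
  shows
    "(\<forall>\<beta> \<in> {1/3 <..< 1 / (2 * \<rho>) - 1 / (2 * q)}.
        in_Lp M (2 * q) (\<lambda>\<omega>. rough_norm \<beta> (-T) T (\<omega>, WW \<omega>)) \<and>
        (\<forall>\<delta> \<in> {0<..1}. in_Lp M (2 * q) (\<lambda>\<omega>. rough_norm \<beta> (-T) T (approx_rough \<delta> \<omega>)))) \<and>
     (\<exists>C>0. \<forall>\<beta> \<in> {1/3 <..< 1 / (2 * \<rho>) - 1 / (2 * q)}. \<forall>\<delta> \<in> {0<..1}.
        \<forall>s t. -T \<le> s \<and> s \<le> t \<and> t \<le> T \<longrightarrow>
          (\<lambda>\<omega>. rough_dist \<beta> s t (approx_rough \<delta> \<omega>) (\<omega>, WW \<omega>)) \<in> borel_measurable M \<and>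
          Lp_norm M (2 * q) (\<lambda>\<omega>. rough_dist \<beta> s t (approx_rough \<delta> \<omega>) (\<omega>, WW \<omega>))
            \<le> ennreal (C * \<delta> powr ((1 / 2) * (1 - 1 / \<rho>)))) \<and>
     (\<forall>\<beta> \<in> {1/3 <..< 1 / (2 * \<rho>) - 1 / (2 * q)}.
        \<forall>s t. -T \<le> s \<and> s \<le> t \<and> t \<le> T \<longrightarrow>
          ((\<lambda>\<delta>. \<integral>\<^sup>+ \<omega>. epowr (rough_dist \<beta> s t (approx_rough \<delta> \<omega>) (\<omega>, WW \<omega>)) (2 * q) \<partial>M)
            \<longlongrightarrow> 0) (at_right 0))"
proof -
  note M = assms(1) and W = assms(2) and T = assms(3) and \<rho> = assms(4) and q = assms(5)
  have pM: "prob_space M" using M by (simp add: canonical_BM_def)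
  let ?g = "1 / (2 * \<rho>)" and ?e = "1 / (2 * \<rho>) - 1 / (2 * q)"
  let ?\<kappa> = "\<lambda>\<delta>. \<delta> powr ((1 / 2) * (1 - 1 / \<rho>))"
  have e: "?e > 0"
  proof -
    have "?e = (1 / \<rho> - 1 / q) / 2" by (simp add: diff_divide_distrib)
    then show ?thesis using assms(6) by simp
  qed
  \<comment> \<open>Moments of order strictly larger than \<open>2 q\<close> reach the endpoint exponent \<open>?e\<close> itself, which
    makes the constant uniform in \<open>\<beta>\<close>.\<close>
  define n where "n = nat \<lceil>q\<rceil> + 1"
  have n: "n > 0" "q < real n" using q by (auto simp: n_def) linarith
  define r where "r = 2 * n"
  have r: "r > 0" "2 * q \<le> real r" using n by (auto simp: r_def)
  \<comment> \<open>\<open>?g - ?e = 1 / (2 * q)\<close>, so the product equals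
    \<open>n / q\<close>.\<close>
  have ge: "(?g - ?e) * real r > 1" using n q by (simp add: r_def field_simps)
  have T2: "- T < T" using T by simp
  have p: "0 < 2 * q" using q by simp
  obtain A1 where A1: "A1 > 0" "rough_moments M (-T) T ?g r A1 1 (\<lambda>\<omega>. \<omega>) WW (\<lambda>_ _. 0) (\<lambda>_ _ _. 0)"
    using brownian_rough_moments[OF M W T \<rho> n(1)] unfolding r_def by blast
  obtain A2 where A2: "A2 > 0" "\<And>\<delta>. \<delta> > 0 \<Longrightarrow> rough_moments M (-T) T ?g r A2 (?\<kappa> \<delta>) (approx_path \<delta>) (approx_area \<delta>) (\<lambda>\<omega>. \<omega>) WW"
    using approx_rough_moments[OF M W T \<rho> n(1)] unfolding r_def by blast
  obtain K1 where K1: "\<And>\<beta> s t. 0 < \<beta> \<Longrightarrow> \<beta> \<le> ?e \<Longrightarrow> -T \<le> s \<Longrightarrow> s \<le> t \<Longrightarrow> t \<le> T \<Longrightarrow>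
    (\<integral>\<^sup>+ \<omega>. rough_dist \<beta> s t (\<omega>, WW \<omega>) (\<lambda>_. 0, \<lambda>_ _. 0) ^ r \<partial>M) \<le> ennreal ((K1 * 1) ^ r)"
  proof -
    obtain K where bound: "\<And>(X :: (real \<Rightarrow> real^'m::{finite,linorder}) \<Rightarrow> real \<Rightarrow> real^'m::{finite,linorder}) XX Y YY \<kappa> \<beta> s t.
      rough_moments M (-T) T ?g r A1 \<kappa> X XX Y YY \<Longrightarrow> 0 < \<kappa> \<Longrightarrow> \<kappa> \<le> 1 \<Longrightarrow> 0 < \<beta> \<Longrightarrow> \<beta> \<le> ?e \<Longrightarrow>
      -T \<le> s \<Longrightarrow> s \<le> t \<Longrightarrow> t \<le> T \<Longrightarrow>
      (\<integral>\<^sup>+ \<omega>. rough_dist \<beta> s t (X \<omega>, XX \<omega>) (Y \<omega>, YY \<omega>) ^ r \<partial>M) \<le> ennreal ((K * \<kappa>) ^ r)"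
      using rough_dist_moment[OF T2 e ge A1(1) r(1), of M] by blast
    show thesis
      by (rule that) (rule bound[OF A1(2) zero_less_one order_refl])
  qed
  obtain K where K: "K > 0" "\<And>\<delta> \<beta> s t. 0 < \<delta> \<Longrightarrow> \<delta> \<le> 1 \<Longrightarrow> 0 < \<beta> \<Longrightarrow> \<beta> \<le> ?e \<Longrightarrow> -T \<le> s \<Longrightarrow> s \<le> t \<Longrightarrow> t \<le> T \<Longrightarrow>
    (\<integral>\<^sup>+ \<omega>. rough_dist \<beta> s t (approx_rough \<delta> \<omega>) (\<omega>, WW \<omega>) ^ r \<partial>M) \<le> ennreal ((K * ?\<kappa> \<delta>) ^ r)"
  proof -
    obtain K where K: "K > 0" and bound: "\<And>(X :: (real \<Rightarrow> real^'m::{finite,linorder}) \<Rightarrow> real \<Rightarrow> real^'m::{finite,linorder}) XX Y YY \<kappa> \<beta> s t.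
      rough_moments M (-T) T ?g r A2 \<kappa> X XX Y YY \<Longrightarrow> 0 < \<kappa> \<Longrightarrow> \<kappa> \<le> 1 \<Longrightarrow> 0 < \<beta> \<Longrightarrow> \<beta> \<le> ?e \<Longrightarrow>
      -T \<le> s \<Longrightarrow> s \<le> t \<Longrightarrow> t \<le> T \<Longrightarrow>
      (\<integral>\<^sup>+ \<omega>. rough_dist \<beta> s t (X \<omega>, XX \<omega>) (Y \<omega>, YY \<omega>) ^ r \<partial>M) \<le> ennreal ((K * \<kappa>) ^ r)"
      using rough_dist_moment[OF T2 e ge A2(1) r(1), of M] by blast
    have \<kappa>: "0 < ?\<kappa> \<delta>" "?\<kappa> \<delta> \<le> 1" if "0 < \<delta>" "\<delta> \<le> 1" for \<delta>
      using that \<rho> by (auto intro!: powr_le1 simp: field_simps)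
    show thesis
      by (rule that[OF K]) (unfold approx_rough_def, rule bound[OF A2(2) \<kappa>])
  qed
  have md: "(\<lambda>\<omega>. rough_dist \<beta> s t (approx_rough \<delta> \<omega>) (\<omega>, WW \<omega>)) \<in> borel_measurable M" if "\<delta> > 0" for \<beta> s t \<delta>
    unfolding approx_rough_def by (rule rough_moments_measurable(1)[OF A2(2)[OF that]])
  have \<kappa>p: "K * ?\<kappa> \<delta> > 0" if "0 < \<delta>" for \<delta> using K(1) that by simp
  \<comment> \<open>The Brownian norm needs one distance, to the zero path; the norm of the
    approximation needs two, to the Brownian rough path and from there to zero.\<close>
  have P1: "in_Lp M (2 * q) (\<lambda>\<omega>. rough_norm \<beta> (-T) T (\<omega>, WW \<omega>))"
    "0 < \<delta> \<Longrightarrow> \<delta> \<le> 1 \<Longrightarrow> in_Lp M (2 * q) (\<lambda>\<omega>. rough_norm \<beta> (-T) T (approx_rough \<delta> \<omega>))"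
    if \<beta>: "\<beta> \<in> {1/3 <..< ?e}" for \<beta> \<delta>
  proof -
    have b: "0 < \<beta>" "\<beta> \<le> ?e" using \<beta> by auto
    let ?d0 = "\<lambda>\<omega>. rough_dist \<beta> (-T) T (\<omega>, WW \<omega>) (\<lambda>_. 0, \<lambda>_ _. 0)"
    have m0: "?d0 \<in> borel_measurable M" by (rule rough_moments_measurable(1)[OF A1(2)])
    have f0: "(\<integral>\<^sup>+ \<omega>. ?d0 \<omega> ^ r \<partial>M) < \<infinity>"
      by (rule order.strict_trans1[OF K1[OF b]]) (use T in auto)
    show "in_Lp M (2 * q) (\<lambda>\<omega>. rough_norm \<beta> (-T) T (\<omega>, WW \<omega>))"
    proof (rule in_Lp_dominated[OF pM p r(2) rough_moments_measurable(2)[OF A1(2)] m0 f0, where h = "\<lambda>_. 0"])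
      show "(\<integral>\<^sup>+ \<omega>. 0 ^ r \<partial>M) < (\<infinity> :: ennreal)" using r(1) by (simp add: zero_power)
      show "rough_norm \<beta> (-T) T (\<omega>, WW \<omega>) \<le> 1 + 2 * (?d0 \<omega> + 0)" for \<omega>
        using rough_norm_le[of \<beta> "-T" T \<omega> "WW \<omega>"] by simp
    qed auto
    assume \<delta>: "0 < \<delta>" "\<delta> \<le> 1"
    let ?d1 = "\<lambda>\<omega>. rough_dist \<beta> (-T) T (approx_rough \<delta> \<omega>) (\<omega>, WW \<omega>)"
    have f1: "(\<integral>\<^sup>+ \<omega>. ?d1 \<omega> ^ r \<partial>M) < \<infinity>"
      by (rule order.strict_trans1[OF K(2)[OF \<delta> b]]) (use T in auto)
    show "in_Lp M (2 * q) (\<lambda>\<omega>. rough_norm \<beta> (-T) T (approx_rough \<delta> \<omega>))"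
    proof (rule in_Lp_dominated[OF pM p r(2) _ md[OF \<delta>(1)] f1 m0 f0])
      show "(\<lambda>\<omega>. rough_norm \<beta> (-T) T (approx_rough \<delta> \<omega>)) \<in> borel_measurable M"
        unfolding approx_rough_def by (rule rough_moments_measurable(2)[OF A2(2)[OF \<delta>(1)]])
      show "rough_norm \<beta> (-T) T (approx_rough \<delta> \<omega>) \<le> 1 + 2 * (?d1 \<omega> + ?d0 \<omega>)" for \<omega>
        unfolding approx_rough_def
        by (rule order_trans[OF rough_norm_le]) (intro add_left_mono mult_left_mono rough_dist_triangle, simp)
    qed
  qed
  \<comment> \<open>\<open>K\<close> was obtained at the endpoint exponent, so the constant is the
    same for all \<beta>, \<delta>, \<open>s\<close> and \<open>t\<close>.\<close>
  have P2: "Lp_norm M (2 * q) (\<lambda>\<omega>. rough_dist \<beta> s t (approx_rough \<delta> \<omega>) (\<omega>, WW \<omega>))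
      \<le> ennreal ((2 powr (1 / (2 * q)) * K) * ?\<kappa> \<delta>)"
    "(\<integral>\<^sup>+ \<omega>. epowr (rough_dist \<beta> s t (approx_rough \<delta> \<omega>) (\<omega>, WW \<omega>)) (2 * q) \<partial>M)
      \<le> ennreal (2 * (K * ?\<kappa> \<delta>) powr (2 * q))"
    if "\<beta> \<in> {1/3 <..< ?e}" "0 < \<delta>" "\<delta> \<le> 1" "-T \<le> s" "s \<le> t" "t \<le> T" for \<beta> \<delta> s t
  proof -
    have le: "(\<integral>\<^sup>+ \<omega>. rough_dist \<beta> s t (approx_rough \<delta> \<omega>) (\<omega>, WW \<omega>) ^ r \<partial>M) \<le> ennreal ((K * ?\<kappa> \<delta>) ^ r)"
      by (rule K(2)) (use that in auto)
    show "Lp_norm M (2 * q) (\<lambda>\<omega>. rough_dist \<beta> s t (approx_rough \<delta> \<omega>) (\<omega>, WW \<omega>))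
      \<le> ennreal ((2 powr (1 / (2 * q)) * K) * ?\<kappa> \<delta>)"
      using Lp_from_moment(2)[OF pM \<kappa>p p r(2) md le] that(2) by (simp only: mult.assoc)
    show "(\<integral>\<^sup>+ \<omega>. epowr (rough_dist \<beta> s t (approx_rough \<delta> \<omega>) (\<omega>, WW \<omega>)) (2 * q) \<partial>M)
      \<le> ennreal (2 * (K * ?\<kappa> \<delta>) powr (2 * q))"
      by (rule Lp_from_moment(1)[OF pM \<kappa>p p r(2) md le]) (use that in auto)
  qed
  have P3: "((\<lambda>\<delta>. \<integral>\<^sup>+ \<omega>. epowr (rough_dist \<beta> s t (approx_rough \<delta> \<omega>) (\<omega>, WW \<omega>)) (2 * q) \<partial>M) \<longlongrightarrow> 0) (at_right 0)"
    if \<beta>: "\<beta> \<in> {1/3 <..< ?e}" and st: "-T \<le> s" "s \<le> t" "t \<le> T" for \<beta> s t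
  \<comment> \<open>The expectation is squeezed below a positive power of \<delta>; \<rho> > 1 makes
    the exponent positive.\<close>
  proof (rule tendsto_sandwich[where f = "\<lambda>_. 0" and h = "\<lambda>\<delta>. ennreal (2 * (K * ?\<kappa> \<delta>) powr (2 * q))"])
    have "((\<lambda>\<delta>. \<delta> powr ((1 / 2) * (1 - 1 / \<rho>))) \<longlongrightarrow> 0 powr ((1 / 2) * (1 - 1 / \<rho>))) (at_right 0)"
      using \<rho> by (intro tendsto_powr2 tendsto_const tendsto_ident_at) (auto simp: eventually_at_filter)
    then have "((\<lambda>\<delta>. 2 * (K * ?\<kappa> \<delta>) powr (2 * q)) \<longlongrightarrow> 2 * (K * 0) powr (2 * q)) (at_right 0)"
      using p K(1) by (intro tendsto_mult tendsto_powr2 tendsto_const) auto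
    then show "((\<lambda>\<delta>. ennreal (2 * (K * ?\<kappa> \<delta>) powr (2 * q))) \<longlongrightarrow> 0) (at_right 0)"
      using tendsto_ennrealI by fastforce
    have "\<forall>\<^sub>F \<delta> in at_right (0::real). \<delta> \<in> {0<..<1}" by (rule eventually_at_right_real) simp
    then show "\<forall>\<^sub>F \<delta> in at_right 0. (\<integral>\<^sup>+ \<omega>. epowr (rough_dist \<beta> s t (approx_rough \<delta> \<omega>) (\<omega>, WW \<omega>)) (2 * q) \<partial>M)
      \<le> ennreal (2 * (K * ?\<kappa> \<delta>) powr (2 * q))"
      by eventually_elim (use P2(2) \<beta> st in auto)
  qed auto
  show ?thesis
  proof (intro conjI ballI allI impI exI[of _ "2 powr (1 / (2 * q)) * K"])
    show "2 powr (1 / (2 * q)) * K > 0" using K(1) by simp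
  qed (use P1 md P2(1) P3 in auto)
qed

end
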